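(* As $k\to\infty$, $$\Psi(S_k) = (1+o(1))\,\zeta(2)^k \qquad\text{and}\qquad \Psi(P_k) = (1+o(1))\,\frac{k^2}{12},$$ where $\zeta$ is the Riemann zeta function.
   Context: $S_k$ and $P_k$ denote the star and the path with $k$ edges, respectively. Definition of $\Psi$: for $t>1$ let $\theta(t)$ be the unique positive solution of $1-\theta(t)=e^{-t\theta(t)}$, and $\theta(t)=0$ for $t\le 1$. For a finite tree $T$, let $(A_v)_{v\in V(T)}$ be i.i.d. random variables with $\mathbb{P}_A(A_v\le t)=\theta(t)$. For $e\in E(T)$ let $T_e^-,T_e^+$ be the two connected components of $T\setminus\{e\}$ and $$\tau_e(T):=\max\Bigl\{\min_{u\in V(T_e^-)}A_u,\ \min_{v\in V(T_e^+)}A_v\Bigr\}.$$ Then $\Psi(T):=\mathbb{E}_A\left[\prod_{e\in E(T)}\tau_e(T)\right]$. *)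

theory Defs
  imports "HOL-Probability.Probability" "HOL-Library.Landau_Symbols" "HOL-Real_Asymp.Real_Asymp"
begin

section \<open>The distribution function \<open>\<theta>\<close>\<close>

definition theta :: "real \<Rightarrow> real" where
  "theta t = (if t > 1 then (THE x. x > 0 \<and> 1 - x = exp (- t * x)) else 0)"

lemma exp_strict_chord:
  fixes t x y :: real
  assumes "0 < x" "x < y" "t \<noteq> 0"
  shows "y * exp (- t * x) < y - x + x * exp (- t * y)"
proof -
  have strict: "1 + z < exp z" if "z \<noteq> 0" for z :: real
  proof -
    have "exp z \<noteq> 1 + z"
      using ln_eq_minus_one[of "exp z"] that by auto
    then show ?thesis
      using exp_ge_add_one_self[of z] by linarith
  qed
  let ?w = "exp (- t * x)"
  have e1: "exp (t * x) * ?w = 1" and e2: "exp (- t * (y - x)) * ?w = exp (- t * y)"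
    by (simp_all add: exp_add[symmetric] algebra_simps)
  have "(1 + t * x) * ?w < 1"
    using strict[of "t * x"] assms e1 by (metis exp_gt_zero mult_strict_right_mono
        mult_eq_0_iff less_irrefl)
  then have a: "(y - x) * ((1 + t * x) * ?w) < (y - x) * 1"
    using assms by (intro mult_strict_left_mono) auto
  have "(1 - t * (y - x)) * ?w < exp (- t * y)"
  proof -
    have "1 - t * (y - x) < exp (- t * (y - x))"
      using strict[of "- t * (y - x)"] assms by simp
    from mult_strict_right_mono[OF this, of ?w] show ?thesis
      unfolding e2 by simp
  qed
  then have b: "x * ((1 - t * (y - x)) * ?w) < x * exp (- t * y)"
    using assms by (intro mult_strict_left_mono) auto
  have "(y - x) * ((1 + t * x) * ?w) + x * ((1 - t * (y - x)) * ?w) = y * ?w"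
    by (simp add: algebra_simps)
  then show ?thesis
    using add_strict_mono[OF a b] by simp
qed

lemma theta_ex1:
  fixes t :: real
  assumes "t > 1"
  shows "\<exists>!x. x > 0 \<and> 1 - x = exp (- t * x)"
proof -
  define x0 where "x0 = ln t / t"
  have ltt: "ln t < t - 1"
    using ln_le_minus_one[of t] ln_eq_minus_one[of t] assms by fastforce
  have x0: "0 < x0" "x0 < 1"
    using assms ltt by (auto simp: x0_def)
  have "exp (- t * x0) = 1 / t"
    using assms by (simp add: x0_def exp_minus field_simps)
  then have p: "0 \<le> 1 - x0 - exp (- t * x0)"
    using assms ltt by (simp add: x0_def field_simps)
  have n: "1 - 1 - exp (- t * 1) \<le> 0"
    by simp
  have "\<exists>x\<ge>x0. x \<le> 1 \<and> 1 - x - exp (- t * x) = 0"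
    by (rule IVT2') (use x0 p n in \<open>auto intro!: continuous_intros\<close>)
  then obtain x where x: "x0 \<le> x" "1 - x - exp (- t * x) = 0"
    by blast
  show ?thesis
  proof (rule ex1I[of _ x])
    show "x > 0 \<and> 1 - x = exp (- t * x)"
      using x x0 by auto
    have no_two: "\<not> (0 < a \<and> a < b \<and> 1 - a = exp (- t * a) \<and> 1 - b = exp (- t * b))" for a b
    proof
      assume *: "0 < a \<and> a < b \<and> 1 - a = exp (- t * a) \<and> 1 - b = exp (- t * b)"
      have "b * exp (- t * a) < b - a + a * exp (- t * b)"
        using exp_strict_chord[of a b t] * assms by auto
      moreover have "exp (- t * a) = 1 - a" "exp (- t * b) = 1 - b"
        using * by auto
      ultimately have "b * (1 - a) < b - a + a * (1 - b)"
        by (simp only:)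
      then show False
        by (simp add: algebra_simps)
    qed
    show "y = x" if "y > 0 \<and> 1 - y = exp (- t * y)" for y
      using no_two[of x y] no_two[of y x] that x x0 by fastforce
  qed
qed

lemma theta_pos_root:
  assumes "t > 1"
  shows "theta t > 0" "1 - theta t = exp (- t * theta t)"
  using theI'[OF theta_ex1[OF assms]] assms by (simp_all add: theta_def)

lemma theta_nonneg: "0 \<le> theta t"
  using theta_pos_root(1)[of t] by (cases "t > 1") (auto simp: theta_def)

lemma theta_less_one: "theta t < 1"
proof (cases "t > 1")
  case True
  then have "0 < 1 - theta t"
    using theta_pos_root(2)[OF True] exp_gt_zero by metis
  then show ?thesis
    by simp
qed (simp add: theta_def)

lemma theta_less_iff:
  assumes "x > 0"
  shows "theta t < x \<longleftrightarrow> 1 - x < exp (- t * x)"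
proof (cases "t > 1")
  case True
  note r = theta_pos_root[OF True]
  consider "theta t < x" | "x = theta t" | "x < theta t"
    by linarith
  then show ?thesis
  proof cases
    case 1
    have "x * (1 - theta t) < x - theta t + theta t * exp (- t * x)"
      using exp_strict_chord[of "theta t" x t] r 1 True by simp
    then have "theta t * (1 - x) < theta t * exp (- t * x)"
      by (simp add: algebra_simps)
    then show ?thesis
      using 1 r by (simp add: mult_less_cancel_left)
  next
    case 2
    then show ?thesis
      using r by simp
  next
    case 3
    have "theta t * exp (- t * x) < theta t - x + x * (1 - theta t)"
      using exp_strict_chord[of x "theta t" t] r 3 True assms by simp
    then have "theta t * exp (- t * x) < theta t * (1 - x)"
      by (simp add: algebra_simps)
    then show ?thesis
      using 3 r by (simp add: mult_less_cancel_left)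
  qed
next
  case False
  have "1 - x < exp (- x)"
    using exp_ge_add_one_self[of "- x"] ln_eq_minus_one[of "exp (- x)"] assms by fastforce
  also have "\<dots> \<le> exp (- t * x)"
    using False assms by simp
  finally show ?thesis
    using False assms by (simp add: theta_def)
qed

lemma theta_mono:
  assumes "s \<le> t"
  shows "theta s \<le> theta t"
proof (rule ccontr)
  assume "\<not> theta s \<le> theta t"
  then have *: "theta t < theta s" "0 < theta s"
    using theta_nonneg[of t] by auto
  have "1 - theta s < exp (- t * theta s)"
    using theta_less_iff[of "theta s" t] * by simp
  also have "\<dots> \<le> exp (- s * theta s)"
    using assms * by simp
  finally show False
    using theta_less_iff[of "theta s" s] * by simp
qed

lemma theta_right_continuous: "continuous (at_right a) theta"
  unfolding continuous_within
proof (rule order_tendstoI)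
  fix y assume "y < theta a"
  then show "eventually (\<lambda>b. y < theta b) (at_right a)"
    using theta_mono by (intro eventually_at_rightI[of a "a + 1"]) (auto intro: less_le_trans)
next
  fix y assume y: "theta a < y"
  then have "y > 0"
    using theta_nonneg[of a] by linarith
  have "((\<lambda>b. exp (- b * y)) \<longlongrightarrow> exp (- a * y)) (at_right a)"
    by (intro tendsto_intros)
  then have "eventually (\<lambda>b. 1 - y < exp (- b * y)) (at_right a)"
    using y theta_less_iff[OF \<open>y > 0\<close>, of a] by (intro order_tendstoD(1)) auto
  then show "eventually (\<lambda>b. theta b < y) (at_right a)"
    using theta_less_iff[OF \<open>y > 0\<close>] by simp
qed

lemma theta_at_bot: "(theta \<longlongrightarrow> 0) at_bot"
  by (rule tendsto_eventually, rule eventually_at_bot_linorderI[of 1]) (simp add: theta_def)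

lemma theta_at_top: "(theta \<longlongrightarrow> 1) at_top"
proof (rule order_tendstoI)
  fix y :: real assume "y < 1"
  define x where "x = max (1/2) ((1 + y) / 2)"
  have x: "0 < x" "x < 1" "y < x"
    using \<open>y < 1\<close> by (auto simp: x_def less_max_iff_disj)
  have "((\<lambda>t. exp (- t * x)) \<longlongrightarrow> 0) at_top"
    using x by real_asymp
  then have "eventually (\<lambda>t. exp (- t * x) < 1 - x) at_top"
    using x by (intro order_tendstoD(2)) auto
  then show "eventually (\<lambda>t. y < theta t) at_top"
  proof eventually_elim
    case (elim t)
    then show ?case
      using theta_less_iff[OF x(1), of t] x by linarith
  qed
next
  fix y :: real assume "1 < y"
  then show "eventually (\<lambda>t. theta t < y) at_top"
    using theta_less_one by (intro always_eventually) (meson less_trans)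
qed

text \<open>The law of each \<open>A\<^sub>v\<close>; as the next two facts show, it is the probability
  measure on the reals with distribution function \<open>\<theta>\<close>.\<close>

definition A_law :: "real measure" where
  "A_law = interval_measure theta"

lemma real_distribution_A_law: "real_distribution A_law"
  unfolding A_law_def
  by (intro real_distribution_interval_measure theta_mono theta_right_continuous
      theta_at_bot theta_at_top)

lemma cdf_A_law: "cdf A_law = theta"
  unfolding A_law_def
  by (intro cdf_interval_measure theta_mono theta_right_continuous theta_at_bot)


section \<open>Trees and the functional \<open>\<Psi>\<close>\<close>

record 'a graph =
  verts :: "'a set"
  edges :: "'a set set"

definition reachable :: "'a graph \<Rightarrow> 'a \<Rightarrow> 'a \<Rightarrow> bool" where
  "reachable G u v \<longleftrightarrow> (u, v) \<in> {(x, y). {x, y} \<in> edges G}\<^sup>*"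

definition graph_components :: "'a graph \<Rightarrow> 'a set set" where
  "graph_components G = (\<lambda>u. {v \<in> verts G. reachable G u v}) ` verts G"

definition delete_edge :: "'a graph \<Rightarrow> 'a set \<Rightarrow> 'a graph" where
  "delete_edge G e = G\<lparr>edges := edges G - {e}\<rparr>"

text \<open>For an edge \<open>e\<close> of a finite tree there are exactly two components after deletion, so
  the outer maximum is the maximum of the two component minima.\<close>

definition tau :: "'a graph \<Rightarrow> 'a set \<Rightarrow> ('a \<Rightarrow> real) \<Rightarrow> real" where
  "tau T e A = Max ((\<lambda>C. Min (A ` C)) ` graph_components (delete_edge T e))"

text \<open>The i.i.d. family \<open>(A\<^sub>v)\<close> is the family of coordinates on the product space.\<close>

definition Psi :: "'a graph \<Rightarrow> real" where
  "Psi T = (\<integral>A. (\<Prod>e\<in>edges T. tau T e A) \<partial>(Pi\<^sub>M (verts T) (\<lambda>_. A_law)))"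

text \<open>Star with centre 0 and leaves \<open>1, \<dots>, k\<close>, and path \<open>0 - 1 - \<dots> - k\<close>;
  both have \<open>k\<close> edges.\<close>

definition star_graph :: "nat \<Rightarrow> nat graph" where
  "star_graph k = \<lparr>verts = {0..k}, edges = (\<lambda>i. {0, i}) ` {1..k}\<rparr>"

definition path_graph :: "nat \<Rightarrow> nat graph" where
  "path_graph k = \<lparr>verts = {0..k}, edges = (\<lambda>i. {i, Suc i}) ` {..<k}\<rparr>"

lemma components_two:
  assumes "a \<in> verts G" "b \<in> verts G" "P a" "\<not> P b"
    and "\<And>u v. u \<in> verts G \<Longrightarrow> v \<in> verts G \<Longrightarrow> reachable G u v \<longleftrightarrow> (P u \<longleftrightarrow> P v)"
  shows "graph_components G = {{v \<in> verts G. P v}, {v \<in> verts G. \<not> P v}}"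
proof -
  have c: "{v \<in> verts G. reachable G u v} =
      (if P u then {v \<in> verts G. P v} else {v \<in> verts G. \<not> P v})" if "u \<in> verts G" for u
    using assms(5)[OF that] by auto
  have "graph_components G =
      (\<lambda>u. if P u then {v \<in> verts G. P v} else {v \<in> verts G. \<not> P v}) ` verts G"
    unfolding graph_components_def by (intro image_cong refl c)
  also have "\<dots> = {{v \<in> verts G. P v}, {v \<in> verts G. \<not> P v}}"
  proof (intro equalityI subsetI)
    fix C assume "C \<in> {{v \<in> verts G. P v}, {v \<in> verts G. \<not> P v}}"
    then consider "C = {v \<in> verts G. P v}" | "C = {v \<in> verts G. \<not> P v}"
      by blast
    then show "C \<in> (\<lambda>u. if P u then {v \<in> verts G. P v} else {v \<in> verts G. \<not> P v}) ` verts G"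
    proof cases
      case 1
      then show ?thesis
        using assms(1,3) by (intro image_eqI[of _ _ a]) simp_all
    next
      case 2
      then show ?thesis
        using assms(2,4) by (intro image_eqI[of _ _ b]) simp_all
    qed
  qed (auto split: if_splits)
  finally show ?thesis .
qed

lemma components_star_delete_edge:
  assumes "i \<in> {1..k}"
  shows "graph_components (delete_edge (star_graph k) {0, i}) = {{0..k} - {i}, {i}}"
proof -
  let ?G = "delete_edge (star_graph k) {0, i}"
  define r where "r = {(x, y). {x, y} \<in> edges ?G}"
  have R: "(x, y) \<in> r \<longleftrightarrow> (x = 0 \<and> y \<in> {1..k} - {i}) \<or> (y = 0 \<and> x \<in> {1..k} - {i})" for x y
  proof -
    have "(x, y) \<in> r \<longleftrightarrow> (\<exists>j\<in>{1..k}. {x, y} = {0, j}) \<and> {x, y} \<noteq> {0, i}"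
      unfolding r_def delete_edge_def star_graph_def by (simp add: image_iff)
    also have "\<dots> \<longleftrightarrow> (x = 0 \<and> y \<in> {1..k} - {i}) \<or> (y = 0 \<and> x \<in> {1..k} - {i})"
      unfolding doubleton_eq_iff using assms by blast
    finally show ?thesis .
  qed
  have inv: "(u, v) \<in> r\<^sup>* \<Longrightarrow> u \<noteq> i \<longleftrightarrow> v \<noteq> i" for u v
  proof (induction rule: rtrancl_induct)
    case (step y z)
    then show ?case
      using R[of y z] assms by auto
  qed simp
  have via0: "(u, 0) \<in> r\<^sup>* \<and> (0, u) \<in> r\<^sup>*" if "u \<in> {0..k} - {i}" for u
  proof (cases "u = 0")
    case False
    then have "(u, 0) \<in> r" "(0, u) \<in> r"
      using that by (auto simp: R)
    then show ?thesis
      by blast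
  qed simp
  have v: "verts ?G = {0..k}"
    by (simp add: delete_edge_def star_graph_def)
  have "graph_components ?G = {{v \<in> verts ?G. v \<noteq> i}, {v \<in> verts ?G. \<not> v \<noteq> i}}"
  proof (rule components_two)
    show "0 \<in> verts ?G" "i \<in> verts ?G" "0 \<noteq> i" "\<not> i \<noteq> i"
      using assms unfolding v by auto
    fix u w assume "u \<in> verts ?G" "w \<in> verts ?G"
    then have "u \<noteq> i \<Longrightarrow> w \<noteq> i \<Longrightarrow> (u, w) \<in> r\<^sup>*"
      using via0[of u] via0[of w] unfolding v by (meson DiffI rtrancl_trans singletonD)
    then show "reachable ?G u w \<longleftrightarrow> (u \<noteq> i \<longleftrightarrow> w \<noteq> i)"
      unfolding reachable_def r_def[symmetric] using inv[of u w] by blast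
  qed
  also have "\<dots> = {{0..k} - {i}, {i}}"
    using assms unfolding v by (intro arg_cong2[where f = "\<lambda>A B. {A, B}"]) auto
  finally show ?thesis .
qed

lemma components_path_delete_edge:
  assumes "i < k"
  shows "graph_components (delete_edge (path_graph k) {i, Suc i}) = {{0..i}, {Suc i..k}}"
proof -
  let ?G = "delete_edge (path_graph k) {i, Suc i}"
  define r where "r = {(x, y). {x, y} \<in> edges ?G}"
  have R: "(x, y) \<in> r \<longleftrightarrow> (y = Suc x \<and> x < k \<and> x \<noteq> i) \<or> (x = Suc y \<and> y < k \<and> y \<noteq> i)" for x y
    using assms by (auto simp: r_def delete_edge_def path_graph_def doubleton_eq_iff)
  have inv: "(u, v) \<in> r\<^sup>* \<Longrightarrow> u \<le> i \<longleftrightarrow> v \<le> i" for u v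
  proof (induction rule: rtrancl_induct)
    case (step y z)
    then show ?case
      using R[of y z] by auto
  qed simp
  have up: "(a, b) \<in> r\<^sup>* \<and> (b, a) \<in> r\<^sup>*" if "a \<le> b" "b \<le> k" "a \<le> i \<longleftrightarrow> b \<le> i" for a b
    using that
  proof (induction rule: dec_induct)
    case (step n)
    then have "(n, Suc n) \<in> r" "(Suc n, n) \<in> r"
      unfolding R by linarith+
    moreover have "(a, n) \<in> r\<^sup>*" "(n, a) \<in> r\<^sup>*"
    proof -
      have "n \<le> k" "a \<le> i \<longleftrightarrow> n \<le> i"
        using step.prems step.hyps \<open>(n, Suc n) \<in> r\<close> unfolding R by auto
      then show "(a, n) \<in> r\<^sup>*" "(n, a) \<in> r\<^sup>*"
        using step.IH by blast+
    qed
    ultimately show ?case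
      by (meson converse_rtrancl_into_rtrancl rtrancl_into_rtrancl)
  qed simp
  have v: "verts ?G = {0..k}"
    by (simp add: delete_edge_def path_graph_def)
  have "graph_components ?G = {{v \<in> verts ?G. v \<le> i}, {v \<in> verts ?G. \<not> v \<le> i}}"
  proof (rule components_two)
    show "0 \<in> verts ?G" "Suc i \<in> verts ?G" "0 \<le> i" "\<not> Suc i \<le> i"
      using assms unfolding v by auto
    fix u w assume "u \<in> verts ?G" "w \<in> verts ?G"
    then have "(u \<le> i \<longleftrightarrow> w \<le> i) \<Longrightarrow> (u, w) \<in> r\<^sup>*"
      using up[of u w] up[of w u] unfolding v by (meson atLeastAtMost_iff nle_le)
    then show "reachable ?G u w \<longleftrightarrow> (u \<le> i \<longleftrightarrow> w \<le> i)"
      unfolding reachable_def r_def[symmetric] using inv[of u w] by blast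
  qed
  also have "\<dots> = {{0..i}, {Suc i..k}}"
    using assms unfolding v by (intro arg_cong2[where f = "\<lambda>A B. {A, B}"]) auto
  finally show ?thesis .
qed


section \<open>The Riemann zeta function\<close>

text \<open>The Dirichlet series, on its half-line of convergence \<open>s > 1\<close>.\<close>

definition zeta :: "real \<Rightarrow> real" where
  "zeta s = (\<Sum>n. 1 / real (Suc n) powr s)"

end

(* If Y is exponentially distributed with rate 1, then A = G(Y) with G(y) = y / (1 - exp(-y)).

   Star: for a leaf i, tau is A_i unless A_i is the strict minimum of all values, in which case it
   is the second smallest value. Hence Psi(S_k) is at least (E A)^k = zeta(2)^k, and it is at most
   (c + o(1)) zeta(2)^k for every c > 1, since under the measure biased by the product of the A_i
   the second smallest value exceeds c only with exponentially small probability.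

   Path: conditioning on the position and value of the minimum gives
   Psi(P_k) = sum_{j <= k} int_0^oo f_j(y) f_{k-j}(y) exp(-y) dy, where f_n(y) is the mean of the
   product of n running minima on the event that all n values exceed G(y), and
   f_n' = - sum_{j < n} f_j h^(n-j) with h(y) = y / (exp(y) - 1). Therefore
   sum_n f_n X^n = E / (1 - h X)^2, where the coefficients of E are absolutely summable uniformly
   in y and E(1) = 1 / R tends to 1/2 as y tends to 0. Consequently the integrand is the coefficient
   of X^k in E^2 / (1 - h X)^4, about E(1)^2 (k^3 / 6) exp(-k y / 2) near y = 0, and dominated
   convergence in the variable s = k y yields (1/4) (k^3 / 6) (2 / k) = k^2 / 12. *)

theory Submission
  imports Defs
begin

text \<open>For paths the obstacle is uniformity at small y: there h tends to 1, so 1 / (1 - h X)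
  becomes singular at X = 1, and exactly this region, y of order 1 / k, carries the integral.
  Dividing out (1 - h X)^(-2) works because h agrees with exp (- y / 2) to first order at 0, and (1
  - exp (- y / 2) X)^(-2) solves the analogous equation exactly; the defect \<open>\<kappa>\<close>
  is nonnegative and of order y, so \<open>\<kappa> / (1 - h)\<close> stays bounded. The
  coefficients of E have no fixed sign, but those of V = 1 / E are nonnegative, by integration from
  infinity, and dominate them in modulus. Their sum is governed by the equation at X = 1, which has
  a closed solution: the generating function there is exp y / (exp y - 1 - y), and multiplying by (1
  - h)^2 gives 1 / \<open>R\<close>. Since \<open>R\<close> stays below 2, summability is uniform.
  Integrals are kept in the extended nonnegative reals, so finiteness is a result and not an
  assumption.\<close>

unbundle no vec_syntax and fps_syntax

section \<open>The law of \<open>A\<^sub>v\<close> as an image of the exponential distribution\<close>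

text \<open>The quantile function in the coordinate y: solving 1 - x = exp (- t x) for t at x = 1 -
  exp (- y) gives t = y / x.\<close>

definition G :: "real \<Rightarrow> real" where
  "G y = y / (1 - exp (- y))"

lemma G_measurable [measurable]: "G \<in> borel_measurable borel"
  unfolding G_def by measurable

lemma G_gt_one:
  assumes "0 < y"
  shows "1 < G y"
proof -
  have "1 - y < exp (- y)"
    using exp_ge_add_one_self[of "- y"] ln_eq_minus_one[of "exp (- y)"] assms by fastforce
  then show ?thesis
    using assms by (simp add: G_def)
qed

lemma G_le_Suc:
  assumes "0 < y"
  shows "G y \<le> 1 + y"
proof -
  have "(1 + y) * exp (- y) \<le> exp y * exp (- y)"
    by (intro mult_right_mono exp_ge_add_one_self) auto
  then have "(1 + y) * exp (- y) \<le> 1"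
    by (simp flip: exp_add)
  then show ?thesis
    using assms by (simp add: G_def pos_divide_le_eq algebra_simps)
qed

text \<open>At x = 1 - exp (- y) both sides of the criterion \<open>theta_less_iff\<close> are
  exponentials, and comparing exponents gives a condition linear in t.\<close>

lemma G_le_iff:
  assumes "0 < y"
  shows "G y \<le> t \<longleftrightarrow> 1 - exp (- y) \<le> theta t"
proof -
  have p: "0 < 1 - exp (- y)"
    using assms by simp
  have "theta t < 1 - exp (- y) \<longleftrightarrow> exp (- y) < exp (- t * (1 - exp (- y)))"
    using theta_less_iff[OF p, of t] by simp
  also have "\<dots> \<longleftrightarrow> t < G y"
    using p by (simp add: G_def pos_less_divide_eq)
  finally show ?thesis
    by linarith
qed

lemma theta_G:
  assumes "0 < y"
  shows "theta (G y) = 1 - exp (- y)"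
proof -
  have "1 < G y"
    using G_gt_one[OF assms] .
  moreover have "0 < 1 - exp (- y)" "1 - (1 - exp (- y)) = exp (- G y * (1 - exp (- y)))"
    using assms by (auto simp: G_def)
  ultimately show ?thesis
    using theta_ex1[of "G y"] theta_pos_root[of "G y"] by blast
qed

lemma G_less_iff:
  assumes "0 < y" "0 < z"
  shows "G y < G z \<longleftrightarrow> y < z"
  using G_le_iff[of z "G y"] theta_G assms by auto

lemma A_law_eq_distr: "A_law = distr (density lborel (exponential_density 1)) borel G"
proof (rule cdf_unique)
  interpret expo: prob_space "density lborel (exponential_density 1)"
    by (rule prob_space_exponential_density) simp
  show "real_distribution A_law"
    by (rule real_distribution_A_law)
  show rd: "real_distribution (distr (density lborel (exponential_density 1)) borel G)"
    by (intro expo.real_distribution_distr) simp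
  interpret D: prob_space "distr (density lborel (exponential_density 1)) borel G"
    using rd by (simp add: real_distribution_def)
  show "cdf A_law = cdf (distr (density lborel (exponential_density 1)) borel G)"
  proof
    fix t
    \<comment> \<open>The point where 1 - exp (- a) = theta t, so that by \<open>G_le_iff\<close>
      the event \<open>G y \<le> t\<close> is \<open>y \<le> a\<close>.\<close>
    define a where "a = - ln (1 - theta t)"
    have a: "0 \<le> a" "exp (- a) = 1 - theta t"
      using theta_nonneg[of t] theta_less_one[of t] by (auto simp: a_def)
    have le_iff: "G y \<le> t \<longleftrightarrow> y \<le> a" if "0 < y" for y
    proof -
      have "G y \<le> t \<longleftrightarrow> exp (- a) \<le> exp (- y)"
        unfolding G_le_iff[OF that] a(2) by linarith
      then show ?thesis
        by simp
    qed
    have [measurable]: "G -` {..t} \<in> sets borel"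
      by (rule measurable_sets_borel[OF G_measurable]) auto
    have "emeasure (distr (density lborel (exponential_density 1)) borel G) {..t}
        = (\<integral>\<^sup>+y. ennreal (exponential_density 1 y) * indicator (G -` {..t}) y \<partial>lborel)"
      by (simp add: emeasure_distr emeasure_density)
    also have "\<dots> = (\<integral>\<^sup>+y. ennreal (exponential_density 1 y) * indicator {..a} y \<partial>lborel)"
    \<comment> \<open>At y = 0 the density is positive but \<open>G 0 = 0\<close> is a division
      default, so this null point is discarded; for negative y the density vanishes.\<close>
    proof (rule nn_integral_cong_AE, rule AE_mp[OF AE_lborel_singleton[of 0]], intro AE_I2 impI)
      fix y :: real assume "y \<noteq> 0"
      then consider "y < 0" | "0 < y"
        by linarith
      then show "ennreal (exponential_density 1 y) * indicator (G -` {..t}) y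
          = ennreal (exponential_density 1 y) * indicator {..a} y"
        by cases (simp_all add: exponential_density_def indicator_def le_iff)
    qed
    also have "\<dots> = emeasure (density lborel (exponential_density 1)) {..a}"
      by (subst emeasure_density) auto
    also have "\<dots> = ennreal (theta t)"
      using emeasure_erlang_density[of 1 0 a] a by (simp add: erlang_CDF_0)
    finally have "measure (distr (density lborel (exponential_density 1)) borel G) {..t} = theta t"
      using theta_nonneg[of t] by (simp add: measure_def)
    then show "cdf A_law t = cdf (distr (density lborel (exponential_density 1)) borel G) t"
      using fun_cong[OF cdf_A_law, of t] by (simp add: cdf_def)
  qed
qed

lemma sets_A_law [measurable_cong, simp]: "sets A_law = sets borel"
  by (simp add: A_law_eq_distr)

lemma space_A_law [simp]: "space A_law = UNIV"
  by (simp add: A_law_eq_distr)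

interpretation A_law: prob_space A_law
  using real_distribution_A_law by (simp add: real_distribution_def)

lemma nn_integral_A_law:
  assumes [measurable]: "f \<in> borel_measurable borel"
  shows "(\<integral>\<^sup>+a. f a \<partial>A_law) = (\<integral>\<^sup>+y. f (G y) * ennreal (exp (- y)) * indicator {0<..} y \<partial>lborel)"
proof -
  have "(\<integral>\<^sup>+a. f a \<partial>A_law) = (\<integral>\<^sup>+y. ennreal (exponential_density 1 y) * f (G y) \<partial>lborel)"
    unfolding A_law_eq_distr by (simp add: nn_integral_distr nn_integral_density)
  also have "\<dots> = (\<integral>\<^sup>+y. f (G y) * ennreal (exp (- y)) * indicator {0<..} y \<partial>lborel)"
    by (intro nn_integral_cong_AE, rule AE_mp[OF AE_lborel_singleton[of 0]])
      (auto simp: exponential_density_def mult.commute split: split_indicator)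
  finally show ?thesis .
qed

lemma A_law_gt_one: "AE a in A_law. 1 < a"
proof (rule AE_I)
  show "{a \<in> space A_law. \<not> 1 < a} \<subseteq> {..1}"
    by auto
  have "cdf A_law 1 = 0"
    by (simp add: cdf_A_law theta_def)
  then show "emeasure A_law {..1} = 0"
    by (simp add: cdf_def A_law.emeasure_eq_measure)
qed simp

lemma emeasure_A_law_greaterThan: "emeasure A_law {b<..} = ennreal (1 - theta b)"
proof -
  have "measure A_law {b<..} = 1 - measure A_law {..b}"
    using A_law.prob_compl[of "{..b}"] by (simp add: Compl_eq_Diff_UNIV[symmetric] Compl_atMost)
  then show ?thesis
    using fun_cong[OF cdf_A_law, of b] by (simp add: A_law.emeasure_eq_measure cdf_def)
qed

lemma emeasure_A_law_greaterThan_G: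
  assumes "0 < y"
  shows "emeasure A_law {G y<..} = ennreal (exp (- y))"
  by (simp add: emeasure_A_law_greaterThan theta_G[OF assms])

text \<open>\<open>G\<close> is strictly increasing on the positive half-line, so each level set
  there is at most a point and hence Lebesgue null.\<close>

lemma A_law_no_atoms: "emeasure A_law {c} = 0"
proof -
  have 1: "(\<integral>\<^sup>+a. indicator {c} a \<partial>A_law)
      = (\<integral>\<^sup>+y. indicator {c} (G y) * ennreal (exp (- y)) * indicator {0<..} y \<partial>lborel)"
    by (rule nn_integral_A_law) simp
  have "AE y in lborel. (indicator {c} (G y) * ennreal (exp (- y)) * indicator {0<..} y) = (0::ennreal)"
  proof (cases "\<exists>z>0. G z = c")
    case True
    then obtain z where z: "z > 0" "G z = c" by blast
    have "G y \<noteq> c" if "y > 0" "y \<noteq> z" for y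
      using G_less_iff[of y z] G_less_iff[of z y] z that by (auto simp: neq_iff)
    then show ?thesis
      using AE_lborel_singleton[of z] by (auto elim!: eventually_mono split: split_indicator)
  qed (auto split: split_indicator)
  then have "(\<integral>\<^sup>+y. indicator {c} (G y) * ennreal (exp (- y)) * indicator {0<..} y \<partial>lborel) = 0"
    by (subst nn_integral_0_iff_AE) auto
  with 1 show ?thesis
    by simp
qed

lemma nn_integral_power_exp:
  assumes c: "0 < c"
  shows "(\<integral>\<^sup>+y. ennreal (y ^ n * exp (- (c * y))) * indicator {0<..} y \<partial>lborel)
    = ennreal (fact n / c ^ Suc n)"
proof -
  have "(\<integral>\<^sup>+y. ennreal (y ^ n * exp (- (c * y))) * indicator {0<..} y \<partial>lborel)
      = ennreal (1 / c) * (\<integral>\<^sup>+x. ennreal ((x / c) ^ n * exp (- x)) * indicator {0<..} x \<partial>lborel)"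
    using c by (subst nn_integral_real_affine[where c = "1 / c" and t = 0])
      (auto intro!: arg_cong2[where f = "(*)"] nn_integral_cong
        simp: field_simps zero_less_divide_iff split: split_indicator)
  also have "(\<integral>\<^sup>+x. ennreal ((x / c) ^ n * exp (- x)) * indicator {0<..} x \<partial>lborel)
      = (\<integral>\<^sup>+x. ennreal (1 / c ^ n) * (ennreal (x ^ n * exp (- x)) * indicator {0..} x) \<partial>lborel)"
    by (intro nn_integral_cong_AE, rule AE_mp[OF AE_lborel_singleton[of 0]])
      (use c in \<open>auto simp: power_divide ennreal_mult'[symmetric] split: split_indicator\<close>)
  also have "\<dots> = ennreal (1 / c ^ n) * ennreal (fact n)"
    by (subst nn_integral_cmult) (simp_all add: nn_intergal_power_times_exp_Ici)
  also have "ennreal (1 / c) * (ennreal (1 / c ^ n) * ennreal (fact n)) = ennreal (fact n / c ^ Suc n)"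
    using c by (simp add: ennreal_mult[symmetric] field_simps)
  finally show ?thesis .
qed

interpretation A_prod: product_sigma_finite "\<lambda>_. A_law"
  by (simp add: product_sigma_finite_def A_law.sigma_finite_measure_axioms)

section \<open>Stars\<close>

text \<open>Independence, with the coordinates outside \<open>J\<close> padded by the constant 1.
  For stars \<open>J\<close> is the set of leaves and the centre is left out.\<close>

lemma nn_integral_PiM_A_law_prod:
  assumes "finite I" "J \<subseteq> I" "\<And>i. i \<in> J \<Longrightarrow> f i \<in> borel_measurable borel"
  shows "(\<integral>\<^sup>+x. (\<Prod>i\<in>J. f i (x i)) \<partial>Pi\<^sub>M I (\<lambda>_. A_law)) = (\<Prod>i\<in>J. \<integral>\<^sup>+a. f i a \<partial>A_law)"
proof -
  define g where "g i = (if i \<in> J then f i else (\<lambda>_. 1))" for i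
  have "(\<integral>\<^sup>+x. (\<Prod>i\<in>J. f i (x i)) \<partial>Pi\<^sub>M I (\<lambda>_. A_law)) = (\<integral>\<^sup>+x. (\<Prod>i\<in>I. g i (x i)) \<partial>Pi\<^sub>M I (\<lambda>_. A_law))"
    using assms(1,2) by (intro nn_integral_cong prod.mono_neutral_cong_left) (auto simp: g_def)
  also have "\<dots> = (\<Prod>i\<in>I. \<integral>\<^sup>+a. g i a \<partial>A_law)"
    using assms by (intro A_prod.product_nn_integral_prod) (auto simp: g_def)
  also have "\<dots> = (\<Prod>i\<in>J. \<integral>\<^sup>+a. f i a \<partial>A_law)"
    using assms(1,2) A_law.emeasure_space_1
    by (intro prod.mono_neutral_cong_right) (auto simp: g_def)
  finally show ?thesis .
qed

lemma AE_PiM_A_law_gt_one: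
  assumes "finite I"
  shows "AE x in Pi\<^sub>M I (\<lambda>_. A_law). \<forall>i\<in>I. 1 < x i"
proof (rule AE_finite_allI[OF assms])
  fix i assume i: "i \<in> I"
  have "distr (Pi\<^sub>M I (\<lambda>_. A_law)) A_law (\<lambda>x. x i) = A_law"
    using A_law.prob_space_axioms i by (rule distr_PiM_component)
  then have "AE a in distr (Pi\<^sub>M I (\<lambda>_. A_law)) A_law (\<lambda>x. x i). 1 < a"
    using A_law_gt_one by (simp only:)
  with measurable_component_singleton[OF i] show "AE x in Pi\<^sub>M I (\<lambda>_. A_law). 1 < x i"
    by (rule AE_distrD)
qed

section \<open>Moments of A\<close>

lemma summable_zeta_2: "summable (\<lambda>n. 1 / real (Suc n) ^ 2)"
  using summable_Suc_iff[THEN iffD2, OF inverse_power_summable[of 2, where ?'a = real]]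
  unfolding inverse_eq_divide by simp

lemma zeta_2_eq: "zeta 2 = (\<Sum>n. 1 / real (Suc n) ^ 2)"
  unfolding zeta_def by (subst powr_numeral) (rule of_nat_0_le_iff, rule refl)

lemma zeta_2_pos: "0 < zeta 2"
  unfolding zeta_2_eq by (rule suminf_pos[OF summable_zeta_2]) simp

lemma G_exp_sums:
  assumes "0 < y"
  shows "(\<lambda>n. y ^ 1 * exp (- (real (Suc n) * y))) sums (G y * exp (- y))"
proof -
  have "(\<lambda>n. y * exp (- y) * exp (- y) ^ n) sums (y * exp (- y) * (1 / (1 - exp (- y))))"
    using assms by (intro sums_mult geometric_sums) simp
  moreover have "y * exp (- y) * exp (- y) ^ n = y ^ 1 * exp (- (real (Suc n) * y))" for n
    by (simp add: exp_of_nat_mult[symmetric] mult_exp_exp algebra_simps)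
  ultimately show ?thesis
    by (simp add: G_def)
qed

text \<open>By the geometric series of \<open>G_exp_sums\<close> the integrand is the sum of the
  functions y exp (- (n + 1) y), and each of them integrates to 1 / (n + 1)^2.\<close>

lemma nn_integral_A_law_id: "(\<integral>\<^sup>+a. ennreal a \<partial>A_law) = ennreal (zeta 2)"
proof -
  have "(\<integral>\<^sup>+a. ennreal a \<partial>A_law)
      = (\<integral>\<^sup>+y. ennreal (G y) * ennreal (exp (- y)) * indicator {0<..} y \<partial>lborel)"
    by (rule nn_integral_A_law) simp
  also have "\<dots> = (\<integral>\<^sup>+y. (\<Sum>n. ennreal (y ^ 1 * exp (- (real (Suc n) * y))) * indicator {0<..} y) \<partial>lborel)"
  proof (rule nn_integral_cong)
    fix y :: real
    show "ennreal (G y) * ennreal (exp (- y)) * indicator {0<..} y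
        = (\<Sum>n. ennreal (y ^ 1 * exp (- (real (Suc n) * y))) * indicator {0<..} y)"
    proof (cases "0 < y")
      case True
      then have "(\<Sum>n. ennreal (y ^ 1 * exp (- (real (Suc n) * y)))) = ennreal (G y * exp (- y))"
        by (intro suminf_ennreal_eq G_exp_sums) auto
      then show ?thesis
        using True by (simp only: indicator_simps(1) greaterThan_iff mult_1_right ennreal_mult'' exp_ge_zero)
    qed simp
  qed
  also have "\<dots> = (\<Sum>n. \<integral>\<^sup>+y. ennreal (y ^ 1 * exp (- (real (Suc n) * y))) * indicator {0<..} y \<partial>lborel)"
    by (rule nn_integral_suminf) simp
  also have "\<dots> = (\<Sum>n. ennreal (1 / real (Suc n) ^ 2))"
  proof (intro arg_cong[where f = suminf] ext)
    fix n
    show "(\<integral>\<^sup>+y. ennreal (y ^ 1 * exp (- (real (Suc n) * y))) * indicator {0<..} y \<partial>lborel)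
        = ennreal (1 / real (Suc n) ^ 2)"
      by (subst nn_integral_power_exp) (simp_all only: fact_1 of_nat_0_less_iff zero_less_Suc Suc_1)
  qed
  also have "\<dots> = ennreal (zeta 2)"
    unfolding zeta_2_eq using summable_zeta_2 by (intro suminf_ennreal_eq) (auto intro: summable_sums)
  finally show ?thesis .
qed

text \<open>The bound \<open>G y \<le> 1 + y\<close> reduces this to the mean of (1 + Y)^2, which is
  1 + 2 + 2. The second moment is needed because in the star estimate one leaf value replaces the
  smallest one and is then counted twice.\<close>

lemma nn_integral_A_law_square: "(\<integral>\<^sup>+a. ennreal (a\<^sup>2) \<partial>A_law) \<le> ennreal 5"
proof -
  have "(\<integral>\<^sup>+a. ennreal (a\<^sup>2) \<partial>A_law)
      = (\<integral>\<^sup>+y. ennreal ((G y)\<^sup>2) * ennreal (exp (- y)) * indicator {0<..} y \<partial>lborel)"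
    by (rule nn_integral_A_law) simp
  also have "\<dots> \<le> (\<integral>\<^sup>+y. ennreal (y ^ 0 * exp (- (1 * y))) * indicator {0<..} y +
      (2 * (ennreal (y ^ 1 * exp (- (1 * y))) * indicator {0<..} y) +
       ennreal (y ^ 2 * exp (- (1 * y))) * indicator {0<..} y) \<partial>lborel)"
  proof (rule nn_integral_mono)
    fix y :: real
    show "ennreal ((G y)\<^sup>2) * ennreal (exp (- y)) * indicator {0<..} y \<le>
        ennreal (y ^ 0 * exp (- (1 * y))) * indicator {0<..} y +
        (2 * (ennreal (y ^ 1 * exp (- (1 * y))) * indicator {0<..} y) +
        ennreal (y ^ 2 * exp (- (1 * y))) * indicator {0<..} y)"
    proof (cases "0 < y")
      case True
      have "(G y)\<^sup>2 * exp (- y) \<le> (1 + y)\<^sup>2 * exp (- y)"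
        using G_le_Suc[OF True] G_gt_one[OF True] by (intro mult_right_mono power_mono) auto
      also have "\<dots> = exp (- y) + (2 * (y * exp (- y)) + y\<^sup>2 * exp (- y))"
        by (simp add: power2_eq_square algebra_simps)
      finally have "ennreal ((G y)\<^sup>2 * exp (- y)) \<le> ennreal (exp (- y) + (2 * (y * exp (- y)) + y\<^sup>2 * exp (- y)))"
        by (rule ennreal_leI)
      then show ?thesis
        using True by (simp add: ennreal_mult'' ennreal_plus[symmetric] ennreal_mult' del: ennreal_plus)
          (simp add: ennreal_mult' ennreal_plus)
    qed simp
  qed
  also have "\<dots> = (\<integral>\<^sup>+y. ennreal (y ^ 0 * exp (- (1 * y))) * indicator {0<..} y \<partial>lborel) +
      (2 * (\<integral>\<^sup>+y. ennreal (y ^ 1 * exp (- (1 * y))) * indicator {0<..} y \<partial>lborel) +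
       (\<integral>\<^sup>+y. ennreal (y ^ 2 * exp (- (1 * y))) * indicator {0<..} y \<partial>lborel))"
    by (simp add: nn_integral_add nn_integral_cmult)
  also have "\<dots> = ennreal 1 + (2 * ennreal 1 + ennreal 2)"
    unfolding nn_integral_power_exp[OF zero_less_one] by simp
  also have "\<dots> = ennreal 5"
    by simp
  finally show ?thesis .
qed

text \<open>Since A > 1 almost surely, discarding the event \<open>A \<le> c\<close> lowers the mean
  by at least its probability \<open>theta c\<close>, which is positive for c > 1. The strict gap
  yields the exponential gain for stars.\<close>

lemma nn_integral_A_law_truncated:
  assumes "1 < c"
  obtains \<rho> where "0 \<le> \<rho>" "\<rho> < zeta 2"
    "(\<integral>\<^sup>+a. ennreal (a * indicator {c<..} a) \<partial>A_law) = ennreal \<rho>"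
proof -
  define I where "I = (\<integral>\<^sup>+a. ennreal (a * indicator {c<..} a) \<partial>A_law)"
  have "ennreal (theta c) = emeasure A_law {..c}"
    using fun_cong[OF cdf_A_law, of c] by (simp add: cdf_def A_law.emeasure_eq_measure)
  also have "\<dots> = (\<integral>\<^sup>+a. indicator {..c} a \<partial>A_law)"
    by simp
  finally have "I + ennreal (theta c) = (\<integral>\<^sup>+a. ennreal (a * indicator {c<..} a) + indicator {..c} a \<partial>A_law)"
    unfolding I_def by (subst nn_integral_add) auto
  also have "\<dots> \<le> (\<integral>\<^sup>+a. ennreal a \<partial>A_law)"
    using A_law_gt_one
    by (intro nn_integral_mono_AE) (auto elim!: eventually_mono split: split_indicator)
  finally have le: "I + ennreal (theta c) \<le> ennreal (zeta 2)"
    by (simp add: nn_integral_A_law_id)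
  then have "I < \<top>"
    by (metis add_left_mono ennreal_add_eq_top ennreal_less_top le_less_trans less_top)
  then obtain \<rho> where \<rho>: "0 \<le> \<rho>" "I = ennreal \<rho>"
    by (cases I) auto
  with le have "\<rho> + theta c \<le> zeta 2"
    using theta_nonneg[of c] zeta_2_pos by (simp add: ennreal_plus[symmetric] del: ennreal_plus)
  then show ?thesis
    using that[of \<rho>] \<rho> theta_pos_root(1)[OF assms] by (simp add: I_def)
qed

section \<open>Pathwise and integrated bounds for the star\<close>

lemma tau_star_graph:
  assumes "i \<in> {1..k}"
  shows "tau (star_graph k) {0, i} x = max (Min (x ` ({0..k} - {i}))) (x i)"
  unfolding tau_def components_star_delete_edge[OF assms] by simp

lemma prod_edges_star_graph:
  "(\<Prod>e\<in>edges (star_graph k). tau (star_graph k) e x) = (\<Prod>i\<in>{1..k}. max (Min (x ` ({0..k} - {i}))) (x i))"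
proof -
  have "inj_on (\<lambda>i. {0, i}) {1..k}"
    by (auto simp: inj_on_def doubleton_eq_iff)
  then have "(\<Prod>e\<in>edges (star_graph k). tau (star_graph k) e x) = (\<Prod>i\<in>{1..k}. tau (star_graph k) {0, i} x)"
    by (subst star_graph_def) (simp add: prod.reindex)
  then show ?thesis
    by (simp only: tau_star_graph cong: prod.cong)
qed

text \<open>At most one leaf \<open>j\<close> can lie below all other vertices, and only its edge has \<open>\<tau> \<noteq> x j\<close>. Either all other
  values exceed \<open>c\<close>, which is exponentially unlikely, or replacing \<open>x j\<close> by the second smallest value costs at most a factor \<open>c\<close>.\<close>

lemma prod_star_le:
  fixes x :: "nat \<Rightarrow> real"
  assumes "2 \<le> k" and x: "\<And>i. i \<le> k \<Longrightarrow> 1 < x i" and "1 < c"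
  shows "(\<Prod>i\<in>{1..k}. max (Min (x ` ({0..k} - {i}))) (x i)) \<le> c * (\<Prod>i\<in>{1..k}. x i) +
    (\<Sum>j\<in>{1..k}. \<Prod>i\<in>{1..k}. if i = j then x i else if i = (if j = 1 then 2 else 1) then (x i)\<^sup>2
       else x i * indicator {c<..} (x i))"
    (is "?lhs \<le> c * ?P + (\<Sum>j\<in>_. ?Q j)")
proof -
  have P: "0 \<le> ?P"
    using x by (intro prod_nonneg) (auto intro: less_imp_le less_trans[OF zero_less_one])
  have Q: "0 \<le> ?Q j" for j
    using x by (intro prod_nonneg) (auto intro: less_imp_le less_trans[OF zero_less_one] split: split_indicator)
  have fin: "finite (x ` ({0..k} - {i}))" for i
    by simp
  show ?thesis
  proof (cases "\<exists>j\<in>{1..k}. \<forall>i\<in>{0..k} - {j}. x j < x i")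
    case False
    have "max (Min (x ` ({0..k} - {i}))) (x i) = x i" if "i \<in> {1..k}" for i
    proof -
      have "\<not> (\<forall>l\<in>{0..k} - {i}. x i < x l)"
        using False that by blast
      then obtain l where "l \<in> {0..k} - {i}" "x l \<le> x i"
        unfolding not_less[symmetric] by blast
      then have "Min (x ` ({0..k} - {i})) \<le> x i"
        by (intro order_trans[OF Min_le[OF fin]]) auto
      then show ?thesis
        by simp
    qed
    then have "?lhs = ?P"
      by simp
    also have "?P \<le> c * ?P"
      using P assms(3) by (simp add: mult_le_cancel_right1)
    finally show ?thesis
      using Q by (simp add: add_increasing2 sum_nonneg)
  next
    case True
    then obtain j where j: "j \<in> {1..k}" "\<And>i. i \<in> {0..k} - {j} \<Longrightarrow> x j < x i"
      by blast
    define m where "m = Min (x ` ({0..k} - {j}))"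
    have m_le: "m \<le> x i" if "i \<in> {0..k} - {j}" for i
      unfolding m_def using that by (intro Min_le) auto
    have "m \<in> x ` ({0..k} - {j})"
      unfolding m_def using j by (intro Min_in) auto
    then obtain i where i: "i \<in> {0..k} - {j}" "m = x i"
      by blast
    have m: "1 < m" "x j < m"
      using x[of i] j(2)[OF i(1)] i by auto
    have "max (Min (x ` ({0..k} - {i}))) (x i) = x i" if "i \<in> {1..k} - {j}" for i
    proof -
      have "Min (x ` ({0..k} - {i})) \<le> x j"
        using j(1) that by (intro Min_le) auto
      also have "x j < x i"
        using that by (intro j(2)) auto
      finally show ?thesis
        by simp
    qed
    then have rest: "(\<Prod>i\<in>{1..k} - {j}. max (Min (x ` ({0..k} - {i}))) (x i)) = (\<Prod>i\<in>{1..k} - {j}. x i)"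
      by (rule prod.cong[OF refl])
    note remove_j = prod.remove[OF finite_atLeastAtMost j(1)]
    have lhs: "?lhs = m * (\<Prod>i\<in>{1..k} - {j}. x i)"
      unfolding remove_j rest m_def[symmetric] using m by simp
    define R where "R = (\<Prod>i\<in>{1..k} - {j}. x i)"
    have R: "0 \<le> R"
      unfolding R_def using x by (intro prod_nonneg) (auto intro: less_imp_le less_trans[OF zero_less_one])
    have PR: "?P = x j * R"
      unfolding remove_j R_def by (rule refl)
    have xj: "1 < x j"
      using x j(1) by simp
    show ?thesis
    proof (cases "m \<le> c")
      case True
      have "?lhs = m * R"
        using lhs by (simp add: R_def)
      also have "\<dots> \<le> c * R"
        using True R by (rule mult_right_mono)
      also have "\<dots> \<le> c * (x j * R)"
        using xj R assms(3) by (intro mult_left_mono) (auto simp: mult_le_cancel_right1)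
      finally show ?thesis
        using Q PR by (simp add: add_increasing2 sum_nonneg)
    next
      case False
      \<comment> \<open>Any leaf other than \<open>j\<close> bounds the second smallest value
        \<open>m\<close> from above; a fixed choice keeps the bound a product over leaves. This is
        where two leaves are required.\<close>
      define l where "l = (if j = 1 then 2 else 1 :: nat)"
      have l: "l \<in> {1..k} - {j}"
        using assms(1) by (auto simp: l_def)
      note remove_l = prod.remove[OF finite_Diff[OF finite_atLeastAtMost] l]
      have "?Q j = x j * (\<Prod>i\<in>{1..k} - {j}. if i = l then (x i)\<^sup>2 else x i * indicator {c<..} (x i))"
        unfolding l_def[symmetric] remove_j by (intro arg_cong2[where f = "(*)"] prod.cong) auto
      also have "(\<Prod>i\<in>{1..k} - {j}. if i = l then (x i)\<^sup>2 else x i * indicator {c<..} (x i))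
          = (\<Prod>i\<in>{1..k} - {j}. if i = l then (x i)\<^sup>2 else x i)"
      proof (intro prod.cong refl)
        fix i assume "i \<in> {1..k} - {j}"
        then have "c < x i"
          using m_le[of i] False by auto
        then show "(if i = l then (x i)\<^sup>2 else x i * indicator {c<..} (x i)) = (if i = l then (x i)\<^sup>2 else x i)"
          by simp
      qed
      also have "\<dots> = (x l)\<^sup>2 * (\<Prod>i\<in>{1..k} - {j} - {l}. x i)"
        unfolding remove_l by (intro arg_cong2[where f = "(*)"] prod.cong) auto
      also have "\<dots> = x l * R"
        unfolding R_def remove_l by (simp add: power2_eq_square)
      finally have Qj: "?Q j = x j * (x l * R)" .
      have "?lhs = m * R"
        using lhs by (simp add: R_def)
      also have "\<dots> \<le> x l * R"
        using m_le[of l] l R by (intro mult_right_mono) auto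
      \<comment> \<open>The factor \<open>x j > 1\<close> is inserted so that the bound becomes the
        full product \<open>?Q j\<close>, in which \<open>x l\<close> occurs squared.\<close>
      also have "\<dots> \<le> x j * (x l * R)"
        using mult_right_mono[of 1 "x j" "x l * R"] xj x[of l] l R by simp
      also have "\<dots> \<le> (\<Sum>j\<in>{1..k}. ?Q j)"
        unfolding Qj[symmetric] using j(1) Q by (intro member_le_sum) auto
      finally show ?thesis
        using P assms(3) by (simp add: add_increasing)
    qed
  qed
qed

lemma Psi_star_graph:
  "Psi (star_graph k) = enn2real (\<integral>\<^sup>+x. ennreal (\<Prod>i\<in>{1..k}. max (Min (x ` ({0..k} - {i}))) (x i))
    \<partial>Pi\<^sub>M {0..k} (\<lambda>_. A_law))"
proof -
  have "AE x in Pi\<^sub>M {0..k} (\<lambda>_. A_law). 0 \<le> (\<Prod>i\<in>{1..k}. max (Min (x ` ({0..k} - {i}))) (x i))"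
    using AE_PiM_A_law_gt_one[OF finite_atLeastAtMost]
  proof eventually_elim
    case (elim x)
    show ?case
    proof (rule prod_nonneg)
      fix i assume "i \<in> {1..k}"
      then have "1 < x i"
        using elim by simp
      then show "0 \<le> max (Min (x ` ({0..k} - {i}))) (x i)"
        by simp
    qed
  qed
  moreover have "verts (star_graph k) = {0..k}"
    by (simp add: star_graph_def)
  ultimately show ?thesis
    unfolding Psi_def prod_edges_star_graph by (simp add: integral_eq_nn_integral)
qed

lemma nn_integral_star_ge:
  "ennreal (zeta 2 ^ k) \<le> (\<integral>\<^sup>+x. ennreal (\<Prod>i\<in>{1..k}. max (Min (x ` ({0..k} - {i}))) (x i))
    \<partial>Pi\<^sub>M {0..k} (\<lambda>_. A_law))"
proof -
  have "ennreal (zeta 2 ^ k) = (\<integral>\<^sup>+x. (\<Prod>i\<in>{1..k}. ennreal (x i)) \<partial>Pi\<^sub>M {0..k} (\<lambda>_. A_law))"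
    using zeta_2_pos
    by (subst nn_integral_PiM_A_law_prod) (auto simp: nn_integral_A_law_id ennreal_power)
  also have "\<dots> \<le> (\<integral>\<^sup>+x. ennreal (\<Prod>i\<in>{1..k}. max (Min (x ` ({0..k} - {i}))) (x i))
      \<partial>Pi\<^sub>M {0..k} (\<lambda>_. A_law))"
  proof (rule nn_integral_mono_AE, rule AE_mp[OF AE_PiM_A_law_gt_one[OF finite_atLeastAtMost]], intro AE_I2 impI)
    fix x :: "nat \<Rightarrow> real" assume x: "\<forall>i\<in>{0..k}. 1 < x i"
    have x0: "0 \<le> x i" if "i \<in> {1..k}" for i
    proof -
      have "1 < x i"
        using x that by simp
      then show ?thesis
        by simp
    qed
    then have "(\<Prod>i\<in>{1..k}. ennreal (x i)) = ennreal (\<Prod>i\<in>{1..k}. x i)"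
      by (rule prod_ennreal)
    also have "\<dots> \<le> ennreal (\<Prod>i\<in>{1..k}. max (Min (x ` ({0..k} - {i}))) (x i))"
      using x0 by (intro ennreal_leI prod_mono) auto
    finally show "(\<Prod>i\<in>{1..k}. ennreal (x i)) \<le> ennreal (\<Prod>i\<in>{1..k}. max (Min (x ` ({0..k} - {i}))) (x i))" .
  qed
  finally show ?thesis .
qed

text \<open>By independence each summand of \<open>prod_star_le\<close> factors:
  \<open>zeta 2\<close> from leaf \<open>j\<close>, at most 5 from the squared leaf, and
  \<open>\<rho>\<close> from each of the other k - 2 leaves.\<close>

lemma nn_integral_star_le:
  assumes k: "2 \<le> k" and c: "1 < c" and \<rho>: "0 \<le> \<rho>"
    and I\<rho>: "(\<integral>\<^sup>+a. ennreal (a * indicator {c<..} a) \<partial>A_law) = ennreal \<rho>"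
  shows "(\<integral>\<^sup>+x. ennreal (\<Prod>i\<in>{1..k}. max (Min (x ` ({0..k} - {i}))) (x i)) \<partial>Pi\<^sub>M {0..k} (\<lambda>_. A_law))
    \<le> ennreal (c * zeta 2 ^ k + real k * (5 * zeta 2 * \<rho> ^ (k - 2)))"
proof -
  define f :: "nat \<Rightarrow> nat \<Rightarrow> real \<Rightarrow> ennreal" where
    "f j i a = (if i = j then ennreal a else if i = (if j = 1 then 2 else 1) then ennreal (a\<^sup>2)
       else ennreal (a * indicator {c<..} a))" for j i a
  have [measurable]: "f j i \<in> borel_measurable borel" for j i
    unfolding f_def by measurable
  have "(\<integral>\<^sup>+x. ennreal (\<Prod>i\<in>{1..k}. max (Min (x ` ({0..k} - {i}))) (x i)) \<partial>Pi\<^sub>M {0..k} (\<lambda>_. A_law))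
      \<le> (\<integral>\<^sup>+x. ennreal c * (\<Prod>i\<in>{1..k}. ennreal (x i)) + (\<Sum>j\<in>{1..k}. \<Prod>i\<in>{1..k}. f j i (x i))
        \<partial>Pi\<^sub>M {0..k} (\<lambda>_. A_law))"
  proof (rule nn_integral_mono_AE, rule AE_mp[OF AE_PiM_A_law_gt_one[OF finite_atLeastAtMost]], intro AE_I2 impI)
    fix x :: "nat \<Rightarrow> real" assume x: "\<forall>i\<in>{0..k}. 1 < x i"
    have x0: "0 \<le> x i" if "i \<le> k" for i
    proof -
      have "1 < x i"
        using x that by simp
      then show ?thesis
        by simp
    qed
    let ?q = "\<lambda>j i. if i = j then x i else if i = (if j = 1 then 2 else 1) then (x i)\<^sup>2
       else x i * indicator {c<..} (x i)"
    have "ennreal (\<Prod>i\<in>{1..k}. max (Min (x ` ({0..k} - {i}))) (x i))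
        \<le> ennreal (c * (\<Prod>i\<in>{1..k}. x i) + (\<Sum>j\<in>{1..k}. \<Prod>i\<in>{1..k}. ?q j i))"
      using x by (intro ennreal_leI prod_star_le k c) auto
    also have "\<dots> = ennreal c * (\<Prod>i\<in>{1..k}. ennreal (x i)) + (\<Sum>j\<in>{1..k}. \<Prod>i\<in>{1..k}. ennreal (?q j i))"
    proof -
      have q: "0 \<le> ?q j i" if "i \<in> {1..k}" for j i
        using x0 that by auto
      then have q_prod: "0 \<le> (\<Prod>i\<in>{1..k}. ?q j i)" for j
        by (rule prod_nonneg)
      have "(\<Sum>j\<in>{1..k}. \<Prod>i\<in>{1..k}. ennreal (?q j i)) = (\<Sum>j\<in>{1..k}. ennreal (\<Prod>i\<in>{1..k}. ?q j i))"
        using q by (intro sum.cong prod_ennreal refl)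
      also have "\<dots> = ennreal (\<Sum>j\<in>{1..k}. \<Prod>i\<in>{1..k}. ?q j i)"
        by (rule sum_ennreal[OF q_prod])
      moreover have "(\<Prod>i\<in>{1..k}. ennreal (x i)) = ennreal (\<Prod>i\<in>{1..k}. x i)"
        using x0 by (intro prod_ennreal) auto
      moreover have "0 \<le> (\<Prod>i\<in>{1..k}. x i)"
        using x0 by (intro prod_nonneg) auto
      moreover have "0 \<le> (\<Sum>j\<in>{1..k}. \<Prod>i\<in>{1..k}. ?q j i)"
        by (rule sum_nonneg[OF q_prod])
      ultimately show ?thesis
        using c by (simp only: ennreal_plus[OF mult_nonneg_nonneg] ennreal_mult less_imp_le[OF less_trans[OF zero_less_one]])
    qed
    also have "(\<Sum>j\<in>{1..k}. \<Prod>i\<in>{1..k}. ennreal (?q j i)) = (\<Sum>j\<in>{1..k}. \<Prod>i\<in>{1..k}. f j i (x i))"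
      by (intro sum.cong prod.cong refl) (auto simp: f_def)
    finally show "ennreal (\<Prod>i\<in>{1..k}. max (Min (x ` ({0..k} - {i}))) (x i))
        \<le> ennreal c * (\<Prod>i\<in>{1..k}. ennreal (x i)) + (\<Sum>j\<in>{1..k}. \<Prod>i\<in>{1..k}. f j i (x i))" .
  qed
  also have "\<dots> = ennreal c * (\<integral>\<^sup>+x. (\<Prod>i\<in>{1..k}. ennreal (x i)) \<partial>Pi\<^sub>M {0..k} (\<lambda>_. A_law)) +
      (\<Sum>j\<in>{1..k}. \<integral>\<^sup>+x. (\<Prod>i\<in>{1..k}. f j i (x i)) \<partial>Pi\<^sub>M {0..k} (\<lambda>_. A_law))"
  proof -
    have m1: "(\<lambda>x. \<Prod>i\<in>{1..k}. f j i (x i)) \<in> borel_measurable (Pi\<^sub>M {0..k} (\<lambda>_. A_law))" for j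
      by (intro borel_measurable_prod_ennreal measurable_compose[OF measurable_component_singleton]) auto
    have m2: "(\<lambda>x. \<Prod>i\<in>{1..k}. ennreal (x i)) \<in> borel_measurable (Pi\<^sub>M {0..k} (\<lambda>_. A_law))"
      by (intro borel_measurable_prod_ennreal measurable_compose[OF measurable_component_singleton]) auto
    have m3: "(\<lambda>x. \<Sum>j\<in>{1..k}. \<Prod>i\<in>{1..k}. f j i (x i)) \<in> borel_measurable (Pi\<^sub>M {0..k} (\<lambda>_. A_law))"
      using m1 by (rule borel_measurable_sum)
    show ?thesis
      unfolding nn_integral_add[OF borel_measurable_times_ennreal[OF borel_measurable_const m2] m3]
        nn_integral_cmult[OF m2] nn_integral_sum[OF m1] by (rule refl)
  qed
  also have "\<dots> \<le> ennreal (c * zeta 2 ^ k) + ennreal (real k * (5 * zeta 2 * \<rho> ^ (k - 2)))"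
  proof (rule add_mono)
    have "(\<integral>\<^sup>+x. (\<Prod>i\<in>{1..k}. ennreal (x i)) \<partial>Pi\<^sub>M {0..k} (\<lambda>_. A_law)) = ennreal (zeta 2 ^ k)"
      using zeta_2_pos
      by (subst nn_integral_PiM_A_law_prod) (auto simp: nn_integral_A_law_id ennreal_power)
    then show "ennreal c * (\<integral>\<^sup>+x. (\<Prod>i\<in>{1..k}. ennreal (x i)) \<partial>Pi\<^sub>M {0..k} (\<lambda>_. A_law))
        \<le> ennreal (c * zeta 2 ^ k)"
      using c zeta_2_pos by (simp add: ennreal_mult)
  next
    have "(\<integral>\<^sup>+x. (\<Prod>i\<in>{1..k}. f j i (x i)) \<partial>Pi\<^sub>M {0..k} (\<lambda>_. A_law)) \<le> ennreal (5 * zeta 2 * \<rho> ^ (k - 2))"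
      if j: "j \<in> {1..k}" for j
    proof -
      define l where "l = (if j = 1 then 2 else 1 :: nat)"
      have l: "l \<in> {1..k} - {j}"
        using k by (auto simp: l_def)
      have fl: "f j i = (if i = j then ennreal else if i = l then (\<lambda>a. ennreal (a\<^sup>2))
         else (\<lambda>a. ennreal (a * indicator {c<..} a)))" for i
        by (auto simp: f_def l_def fun_eq_iff)
      have "(\<Prod>i\<in>{1..k} - {j} - {l}. \<integral>\<^sup>+a. f j i a \<partial>A_law) = (\<Prod>i\<in>{1..k} - {j} - {l}. ennreal \<rho>)"
        by (intro prod.cong refl) (simp add: fl I\<rho>)
      also have "\<dots> = ennreal (\<rho> ^ (k - 2))"
        using j l \<rho> by (simp add: ennreal_power card_Diff_singleton numeral_2_eq_2)
      finally have rest: "(\<Prod>i\<in>{1..k} - {j} - {l}. \<integral>\<^sup>+a. f j i a \<partial>A_law) = ennreal (\<rho> ^ (k - 2))" .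
      have fj: "(\<integral>\<^sup>+a. f j j a \<partial>A_law) = ennreal (zeta 2)"
        by (simp add: fl nn_integral_A_law_id)
      have "(\<integral>\<^sup>+x. (\<Prod>i\<in>{1..k}. f j i (x i)) \<partial>Pi\<^sub>M {0..k} (\<lambda>_. A_law)) = (\<Prod>i\<in>{1..k}. \<integral>\<^sup>+a. f j i a \<partial>A_law)"
        by (rule nn_integral_PiM_A_law_prod) auto
      also have "\<dots> = ennreal (zeta 2) * ((\<integral>\<^sup>+a. f j l a \<partial>A_law) * ennreal (\<rho> ^ (k - 2)))"
        unfolding prod.remove[OF finite_atLeastAtMost j] prod.remove[OF finite_Diff[OF finite_atLeastAtMost] l]
          rest fj by (rule refl)
      also have "\<dots> \<le> ennreal (zeta 2) * (ennreal 5 * ennreal (\<rho> ^ (k - 2)))"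
        using l nn_integral_A_law_square by (intro mult_left_mono mult_right_mono) (auto simp: fl)
      also have "\<dots> = ennreal (5 * zeta 2 * \<rho> ^ (k - 2))"
        using \<rho> zeta_2_pos by (simp add: ennreal_mult[symmetric] mult_ac del: ennreal_numeral)
      finally show ?thesis .
    qed
    then have "(\<Sum>j\<in>{1..k}. \<integral>\<^sup>+x. (\<Prod>i\<in>{1..k}. f j i (x i)) \<partial>Pi\<^sub>M {0..k} (\<lambda>_. A_law))
        \<le> (\<Sum>j\<in>{1..k}. ennreal (5 * zeta 2 * \<rho> ^ (k - 2)))"
      by (rule sum_mono)
    also have "\<dots> = ennreal (real k * (5 * zeta 2 * \<rho> ^ (k - 2)))"
      using \<rho> zeta_2_pos by (subst sum_ennreal) auto
    finally show "(\<Sum>j\<in>{1..k}. \<integral>\<^sup>+x. (\<Prod>i\<in>{1..k}. f j i (x i)) \<partial>Pi\<^sub>M {0..k} (\<lambda>_. A_law))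
        \<le> ennreal (real k * (5 * zeta 2 * \<rho> ^ (k - 2)))" .
  qed
  also have "\<dots> = ennreal (c * zeta 2 ^ k + real k * (5 * zeta 2 * \<rho> ^ (k - 2)))"
    using \<rho> zeta_2_pos c by (intro ennreal_plus[symmetric]) auto
  finally show ?thesis .
qed

lemma Psi_star_graph_asymp: "(\<lambda>k. Psi (star_graph k)) \<sim>[sequentially] (\<lambda>k. zeta 2 ^ k)"
proof (rule asymp_equivI', rule order_tendstoI)
  let ?I = "\<lambda>k. \<integral>\<^sup>+x. ennreal (\<Prod>i\<in>{1..k}. max (Min (x ` ({0..k} - {i}))) (x i)) \<partial>Pi\<^sub>M {0..k} (\<lambda>_. A_law)"
  note \<mu> = zeta_2_pos
  have upper: "Psi (star_graph k) \<le> c * zeta 2 ^ k + real k * (5 * zeta 2 * \<rho> ^ (k - 2))"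
    if "2 \<le> k" "1 < c" "0 \<le> \<rho>" "(\<integral>\<^sup>+a. ennreal (a * indicator {c<..} a) \<partial>A_law) = ennreal \<rho>" for k c \<rho>
    unfolding Psi_star_graph using that \<mu> by (intro enn2real_leI nn_integral_star_le) auto
  have lower: "zeta 2 ^ k \<le> Psi (star_graph k)" if k: "2 \<le> k" for k
  proof -
    \<comment> \<open>The upper bound with c = 2 serves only to make the integral finite:
      \<open>enn2real\<close> sends infinity to 0, so monotonicity would otherwise fail.\<close>
    obtain \<rho> where "0 \<le> \<rho>" "(\<integral>\<^sup>+a. ennreal (a * indicator {2<..} a) \<partial>A_law) = ennreal \<rho>"
      using nn_integral_A_law_truncated[of 2] by auto
    then have "?I k < \<top>"
      using nn_integral_star_le[OF k, of 2] by (auto intro: le_less_trans)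
    then have "enn2real (ennreal (zeta 2 ^ k)) \<le> enn2real (?I k)"
      using nn_integral_star_ge[of k] by (intro enn2real_mono)
    then show ?thesis
      unfolding Psi_star_graph using \<mu> by simp
  qed
  fix a :: real
  {
    assume "a < 1"
    show "\<forall>\<^sub>F k in sequentially. a < Psi (star_graph k) / zeta 2 ^ k"
      using eventually_ge_at_top[of 2]
    proof eventually_elim
      case (elim k)
      then have "1 \<le> Psi (star_graph k) / zeta 2 ^ k"
        using lower[of k] \<mu> by simp
      then show ?case
        using \<open>a < 1\<close> by linarith
    qed
  next
    assume a: "1 < a"
    define c where "c = (1 + a) / 2"
    have c: "1 < c" "c < a"
      using a by (auto simp: c_def)
    obtain \<rho> where \<rho>: "0 \<le> \<rho>" "\<rho> < zeta 2" "(\<integral>\<^sup>+a. ennreal (a * indicator {c<..} a) \<partial>A_law) = ennreal \<rho>"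
      using nn_integral_A_law_truncated[OF c(1)] by auto
    define q where "q = \<rho> / zeta 2"
    have q: "norm q < 1"
      using \<rho> by (simp add: q_def)
    \<comment> \<open>With k = n + 2 the error term divided by \<open>zeta 2 ^ k\<close> is (n + 2)
      (5 / zeta 2) q^n; the index shift removes the truncated subtraction k - 2.\<close>
    have "(\<lambda>n. c + 5 / zeta 2 * (real n * q ^ n) + 10 / zeta 2 * q ^ n)
        \<longlonglongrightarrow> c + 5 / zeta 2 * 0 + 10 / zeta 2 * 0"
      using q by (intro tendsto_intros powser_times_n_limit_0 LIMSEQ_power_zero)
    then have "\<forall>\<^sub>F n in sequentially. c + 5 / zeta 2 * (real n * q ^ n) + 10 / zeta 2 * q ^ n < a"
      using c by (intro order_tendstoD(2)) auto
    then have "\<forall>\<^sub>F n in sequentially. Psi (star_graph (n + 2)) / zeta 2 ^ (n + 2) < a"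
    proof eventually_elim
      case (elim n)
      have "Psi (star_graph (n + 2)) / zeta 2 ^ (n + 2)
          \<le> (c * zeta 2 ^ (n + 2) + real (n + 2) * (5 * zeta 2 * \<rho> ^ n)) / zeta 2 ^ (n + 2)"
        using upper[of "n + 2" c \<rho>] c \<rho> \<mu> by (intro divide_right_mono) auto
      also have "\<dots> = c + 5 / zeta 2 * (real n * q ^ n) + 10 / zeta 2 * q ^ n"
        using \<mu> by (simp add: q_def field_simps power_divide)
      finally show ?case
        using elim by linarith
    qed
    then show "\<forall>\<^sub>F k in sequentially. Psi (star_graph k) / zeta 2 ^ k < a"
      by (rule eventually_sequentially_seg[THEN iffD1])
  }
qed

section \<open>Decomposition at the minimum\<close>

lemma prob_space_PiM_A_law: "prob_space (Pi\<^sub>M I (\<lambda>_. A_law))"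
  by (intro prob_space_PiM A_law.prob_space_axioms)

lemma measurable_PiM_A_law_Min [measurable]:
  assumes "finite J" "J \<subseteq> I"
  shows "(\<lambda>x. Min (x ` J)) \<in> borel_measurable (Pi\<^sub>M I (\<lambda>_. A_law))"
proof (rule borel_measurable_Min[OF assms(1), where f = "\<lambda>i x. x i"])
  fix i assume "i \<in> J"
  then have "i \<in> I"
    using assms(2) by auto
  then show "(\<lambda>x. x i) \<in> borel_measurable (Pi\<^sub>M I (\<lambda>_. A_law))"
    by measurable
qed

text \<open>Integrating the coordinate \<open>i\<close> first reduces the claim to the absence of
  atoms.\<close>

lemma AE_PiM_A_law_neq:
  assumes "finite I" "i \<in> I" "j \<in> I" "i \<noteq> j"
  shows "AE x in Pi\<^sub>M I (\<lambda>_. A_law). x i \<noteq> x j"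
proof -
  let ?f = "\<lambda>x. indicator {0 :: real} (x i - x j) :: ennreal"
  have I: "insert i (I - {i}) = I"
    using assms by auto
  have f: "?f \<in> borel_measurable (Pi\<^sub>M I (\<lambda>_. A_law))"
    using assms by measurable
  have "(\<integral>\<^sup>+x. ?f x \<partial>Pi\<^sub>M I (\<lambda>_. A_law))
      = (\<integral>\<^sup>+x. \<integral>\<^sup>+y. ?f (x(i := y)) \<partial>A_law \<partial>Pi\<^sub>M (I - {i}) (\<lambda>_. A_law))"
    using A_prod.product_nn_integral_insert[of "I - {i}" i ?f] f assms(1) unfolding I by simp
  also have "\<dots> = (\<integral>\<^sup>+x. 0 \<partial>Pi\<^sub>M (I - {i}) (\<lambda>_. A_law))"
  proof (rule nn_integral_cong)
    fix x :: "'a \<Rightarrow> real"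
    have "(\<integral>\<^sup>+y. ?f (x(i := y)) \<partial>A_law) = (\<integral>\<^sup>+y. indicator {x j} y \<partial>A_law)"
      using assms(4) by (intro nn_integral_cong) (auto split: split_indicator)
    also have "\<dots> = 0"
      using A_law_no_atoms by simp
    finally show "(\<integral>\<^sup>+y. ?f (x(i := y)) \<partial>A_law) = 0" .
  qed
  finally have "(\<integral>\<^sup>+x. ?f x \<partial>Pi\<^sub>M I (\<lambda>_. A_law)) = 0"
    by simp
  then have "AE x in Pi\<^sub>M I (\<lambda>_. A_law). ?f x = 0"
    unfolding nn_integral_0_iff_AE[OF f] .
  then show ?thesis
    by eventually_elim (auto split: split_indicator_asm)
qed

text \<open>Written as a partition of unity, so that multiplying an integrand by it splits the
  integral according to the position of the minimum.\<close>

lemma AE_PiM_A_law_unique_argmin: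
  assumes "finite I" "I \<noteq> {}"
  shows "AE x in Pi\<^sub>M I (\<lambda>_. A_law).
    (\<Sum>j\<in>I. if \<forall>i\<in>I - {j}. x j < x i then 1 else 0) = (1 :: ennreal)"
proof -
  have "AE x in Pi\<^sub>M I (\<lambda>_. A_law). \<forall>p\<in>{(i, j) \<in> I \<times> I. i \<noteq> j}. x (fst p) \<noteq> x (snd p)"
  proof (rule AE_finite_allI)
    show "finite {(i, j) \<in> I \<times> I. i \<noteq> j}"
      using assms(1) by (auto intro: finite_subset[of _ "I \<times> I"])
    show "AE x in Pi\<^sub>M I (\<lambda>_. A_law). x (fst p) \<noteq> x (snd p)" if "p \<in> {(i, j) \<in> I \<times> I. i \<noteq> j}" for p
      using that by (intro AE_PiM_A_law_neq assms(1)) auto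
  qed
  then show ?thesis
  proof eventually_elim
    case (elim x)
    then have neq: "x i \<noteq> x j" if "i \<in> I" "j \<in> I" "i \<noteq> j" for i j
      using that by auto
    obtain j where j: "j \<in> I" "\<And>i. i \<in> I \<Longrightarrow> x j \<le> x i"
      using ex_min_if_finite[of "x ` I"] assms by (metis arg_min_if_finite(1) arg_min_least)
    have "(\<Sum>l\<in>I. if \<forall>i\<in>I - {l}. x l < x i then 1 else 0) = (\<Sum>l\<in>I. if l = j then 1 else 0 :: ennreal)"
    proof (intro sum.cong if_cong refl)
      fix l assume l: "l \<in> I"
      show "(\<forall>i\<in>I - {l}. x l < x i) \<longleftrightarrow> l = j"
      proof
        assume "\<forall>i\<in>I - {l}. x l < x i"
        then show "l = j"
          using j(1) j(2)[OF l] by (metis DiffI not_less singletonD)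
      next
        assume "l = j"
        then show "\<forall>i\<in>I - {l}. x l < x i"
          using j neq[OF _ j(1)] by (metis DiffE less_le singletonI)
      qed
    qed
    then show ?case
      using assms(1) j(1) by simp
  qed
qed

text \<open>After inserting the partition of unity the coordinate \<open>j\<close> is integrated
  outermost; \<open>b\<close> is thus the value of the minimum, and the remaining coordinates are
  independent and constrained to exceed it.\<close>

lemma nn_integral_PiM_A_law_argmin:
  assumes "finite I" "I \<noteq> {}" and f[measurable]: "f \<in> borel_measurable (Pi\<^sub>M I (\<lambda>_. A_law))"
  shows "(\<integral>\<^sup>+x. f x \<partial>Pi\<^sub>M I (\<lambda>_. A_law)) = (\<Sum>j\<in>I. \<integral>\<^sup>+b. \<integral>\<^sup>+x.
    (if \<forall>i\<in>I - {j}. b < x i then f (x(j := b)) else 0) \<partial>Pi\<^sub>M (I - {j}) (\<lambda>_. A_law) \<partial>A_law)"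
proof -
  let ?g = "\<lambda>j x. if \<forall>i\<in>I - {j}. x j < x i then f x else 0"
  have g: "?g j \<in> borel_measurable (Pi\<^sub>M I (\<lambda>_. A_law))" if "j \<in> I" for j
  proof -
    have "(\<lambda>x. \<forall>i\<in>I - {j}. x j < x i) \<in> measurable (Pi\<^sub>M I (\<lambda>_. A_law)) (count_space UNIV)"
      using that assms(1) by (intro pred_intros_finite) (auto simp: Ball_def intro!: borel_measurable_pred_less)
    then show ?thesis
      by measurable
  qed
  have "(\<integral>\<^sup>+x. f x \<partial>Pi\<^sub>M I (\<lambda>_. A_law)) = (\<integral>\<^sup>+x. (\<Sum>j\<in>I. ?g j x) \<partial>Pi\<^sub>M I (\<lambda>_. A_law))"
    using AE_PiM_A_law_unique_argmin[OF assms(1,2)]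
  proof (intro nn_integral_cong_AE, eventually_elim)
    case (elim x)
    have "f x = f x * (\<Sum>j\<in>I. if \<forall>i\<in>I - {j}. x j < x i then 1 else 0)"
      unfolding elim by simp
    also have "\<dots> = (\<Sum>j\<in>I. ?g j x)"
      unfolding sum_distrib_left by (intro sum.cong refl) simp
    finally show ?case .
  qed
  also have "\<dots> = (\<Sum>j\<in>I. \<integral>\<^sup>+x. ?g j x \<partial>Pi\<^sub>M I (\<lambda>_. A_law))"
    using g by (rule nn_integral_sum)
  also have "\<dots> = (\<Sum>j\<in>I. \<integral>\<^sup>+b. \<integral>\<^sup>+x.
    (if \<forall>i\<in>I - {j}. b < x i then f (x(j := b)) else 0) \<partial>Pi\<^sub>M (I - {j}) (\<lambda>_. A_law) \<partial>A_law)"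
  proof (rule sum.cong[OF refl])
    fix j assume j: "j \<in> I"
    then have I: "insert j (I - {j}) = I"
      by auto
    have "(\<integral>\<^sup>+x. ?g j x \<partial>Pi\<^sub>M I (\<lambda>_. A_law))
        = (\<integral>\<^sup>+b. \<integral>\<^sup>+x. ?g j (x(j := b)) \<partial>Pi\<^sub>M (I - {j}) (\<lambda>_. A_law) \<partial>A_law)"
      using A_prod.product_nn_integral_insert_rev[of "I - {j}" j "?g j"] g[OF j] assms(1) unfolding I by simp
    also have "\<dots> = (\<integral>\<^sup>+b. \<integral>\<^sup>+x.
        (if \<forall>i\<in>I - {j}. b < x i then f (x(j := b)) else 0) \<partial>Pi\<^sub>M (I - {j}) (\<lambda>_. A_law) \<partial>A_law)"
      by (intro nn_integral_cong) (auto intro!: if_cong)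
    finally show "(\<integral>\<^sup>+x. ?g j x \<partial>Pi\<^sub>M I (\<lambda>_. A_law)) = (\<integral>\<^sup>+b. \<integral>\<^sup>+x.
        (if \<forall>i\<in>I - {j}. b < x i then f (x(j := b)) else 0) \<partial>Pi\<^sub>M (I - {j}) (\<lambda>_. A_law) \<partial>A_law)" .
  qed
  finally show ?thesis .
qed

text \<open>The use of \<open>restrict\<close> in the assumption on \<open>f\<close> expresses that
  the two factors depend on disjoint blocks of coordinates.\<close>

lemma nn_integral_PiM_A_law_split:
  assumes IJ: "I \<inter> J = {}" "finite I" "finite J"
    and g[measurable]: "g \<in> borel_measurable (Pi\<^sub>M I (\<lambda>_. A_law))"
    and h[measurable]: "h \<in> borel_measurable (Pi\<^sub>M J (\<lambda>_. A_law))"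
    and f: "\<And>x. f x = g (restrict x I) * h (restrict x J)"
  shows "(\<integral>\<^sup>+x. f x \<partial>Pi\<^sub>M (I \<union> J) (\<lambda>_. A_law))
    = (\<integral>\<^sup>+x. g x \<partial>Pi\<^sub>M I (\<lambda>_. A_law)) * (\<integral>\<^sup>+x. h x \<partial>Pi\<^sub>M J (\<lambda>_. A_law))"
proof -
  have [measurable]: "(\<lambda>x. g (restrict x I) * h (restrict x J)) \<in> borel_measurable (Pi\<^sub>M (I \<union> J) (\<lambda>_. A_law))"
    by measurable
  have "(\<integral>\<^sup>+x. f x \<partial>Pi\<^sub>M (I \<union> J) (\<lambda>_. A_law))
      = (\<integral>\<^sup>+x. \<integral>\<^sup>+y. g (restrict (merge I J (x, y)) I) * h (restrict (merge I J (x, y)) J)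
        \<partial>Pi\<^sub>M J (\<lambda>_. A_law) \<partial>Pi\<^sub>M I (\<lambda>_. A_law))"
    unfolding f by (rule A_prod.product_nn_integral_fold[OF IJ]) simp
  also have "\<dots> = (\<integral>\<^sup>+x. \<integral>\<^sup>+y. g x * h y \<partial>Pi\<^sub>M J (\<lambda>_. A_law) \<partial>Pi\<^sub>M I (\<lambda>_. A_law))"
    using IJ(1) by (intro nn_integral_cong)
      (simp add: space_PiM PiE_def extensional_restrict)
  also have "\<dots> = (\<integral>\<^sup>+x. g x \<partial>Pi\<^sub>M I (\<lambda>_. A_law)) * (\<integral>\<^sup>+x. h x \<partial>Pi\<^sub>M J (\<lambda>_. A_law))"
    by (simp add: nn_integral_cmult nn_integral_multc)
  finally show ?thesis .
qed

section \<open>One side of the path: products of running minima\<close>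

definition prefix_min_prod :: "nat \<Rightarrow> (nat \<Rightarrow> real) \<Rightarrow> ennreal" where
  "prefix_min_prod n x = (\<Prod>i<n. ennreal (Min (x ` {..i})))"

text \<open>On the event that vertex \<open>j\<close> of the path carries the minimum \<open>b\<close>, the vertices on either side
  contribute \<open>F j b\<close> and \<open>F (k - j) b\<close>: the far component of an edge has minimum \<open>b\<close>, which never
  exceeds the minimum of the near one.\<close>

definition F :: "nat \<Rightarrow> real \<Rightarrow> ennreal" where
  "F n a = (\<integral>\<^sup>+x. (if \<forall>i\<in>{..<n}. a < x i then prefix_min_prod n x else 0) \<partial>Pi\<^sub>M {..<n} (\<lambda>_. A_law))"

lemma prefix_min_prod_cong:
  assumes "\<And>i. i < n \<Longrightarrow> x i = y i"
  shows "prefix_min_prod n x = prefix_min_prod n y"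
  unfolding prefix_min_prod_def
proof (intro prod.cong refl)
  fix i assume "i \<in> {..<n}"
  then have "x ` {..i} = y ` {..i}"
    using assms by (intro image_cong) auto
  then show "ennreal (Min (x ` {..i})) = ennreal (Min (y ` {..i}))"
    by simp
qed

lemma prefix_min_prod_restrict: "prefix_min_prod n (restrict x {..<n}) = prefix_min_prod n x"
  by (rule prefix_min_prod_cong) simp

lemma prefix_min_prod_measurable:
  assumes "{..<n} \<subseteq> I"
  shows "prefix_min_prod n \<in> borel_measurable (Pi\<^sub>M I (\<lambda>_. A_law))"
  unfolding prefix_min_prod_def
proof (rule borel_measurable_prod_ennreal)
  fix i assume "i \<in> {..<n}"
  then have "{..i} \<subseteq> I"
    using assms by auto
  then show "(\<lambda>x. ennreal (Min (x ` {..i}))) \<in> borel_measurable (Pi\<^sub>M I (\<lambda>_. A_law))"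
    by (intro measurable_compose[OF measurable_PiM_A_law_Min measurable_ennreal]) auto
qed

lemma measurable_all_greater:
  assumes "finite J" "J \<subseteq> I" "f \<in> borel_measurable (Pi\<^sub>M I (\<lambda>_. A_law))"
  shows "(\<lambda>x. if \<forall>i\<in>J. b < x i then f x else (0 :: ennreal)) \<in> borel_measurable (Pi\<^sub>M I (\<lambda>_. A_law))"
proof (rule measurable_If_set[of f _ _ "\<lambda>_. 0" "{x. \<forall>i\<in>J. b < x i}", simplified mem_Collect_eq, OF assms(3)])
  have "{x \<in> space (Pi\<^sub>M I (\<lambda>_. A_law)). \<forall>i\<in>J. b < x i} \<in> sets (Pi\<^sub>M I (\<lambda>_. A_law))"
  proof (rule sets.sets_Collect_finite_All[OF _ assms(1)])
    fix i assume "i \<in> J"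
    then have [measurable]: "(\<lambda>x. x i) \<in> borel_measurable (Pi\<^sub>M I (\<lambda>_. A_law))"
      using measurable_component_singleton[of i I "\<lambda>_. A_law"] assms(2) by (auto cong: measurable_cong_sets)
    show "{x \<in> space (Pi\<^sub>M I (\<lambda>_. A_law)). b < x i} \<in> sets (Pi\<^sub>M I (\<lambda>_. A_law))"
      by measurable
  qed
  then show "{x. \<forall>i\<in>J. b < x i} \<inter> space (Pi\<^sub>M I (\<lambda>_. A_law)) \<in> sets (Pi\<^sub>M I (\<lambda>_. A_law))"
    by (simp add: Collect_conj_eq Int_commute)
qed simp

lemma F_0: "F 0 a = 1"
  using prob_space.emeasure_space_1[OF prob_space_PiM_A_law[of "{}"]]
  by (simp add: F_def prefix_min_prod_def)

lemma emeasure_all_greater: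
  assumes "finite J"
  shows "(\<integral>\<^sup>+x. (if \<forall>i\<in>J. b < x i then 1 else 0) \<partial>Pi\<^sub>M J (\<lambda>_. A_law)) = emeasure A_law {b<..} ^ card J"
proof -
  have "(\<integral>\<^sup>+x. (if \<forall>i\<in>J. b < x i then 1 else 0) \<partial>Pi\<^sub>M J (\<lambda>_. A_law))
      = (\<integral>\<^sup>+x. (\<Prod>i\<in>J. indicator {b<..} (x i)) \<partial>Pi\<^sub>M J (\<lambda>_. A_law))"
  proof (rule nn_integral_cong)
    fix x
    show "(if \<forall>i\<in>J. b < x i then 1 else 0) = (\<Prod>i\<in>J. indicator {b<..} (x i) :: ennreal)"
    proof (cases "\<forall>i\<in>J. b < x i")
      case False
      then obtain i where "i \<in> J" "\<not> b < x i"
        by blast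
      then have "(\<Prod>i\<in>J. indicator {b<..} (x i) :: ennreal) = 0"
        by (intro prod_zero[OF assms] bexI[of _ i]) auto
      then show ?thesis
        by (simp only: False if_False)
    qed simp
  qed
  also have "\<dots> = (\<Prod>i\<in>J. \<integral>\<^sup>+a. indicator {b<..} a \<partial>A_law)"
    by (rule A_prod.product_nn_integral_prod[OF assms]) simp
  also have "\<dots> = emeasure A_law {b<..} ^ card J"
    by simp
  finally show ?thesis .
qed

lemma Min_fun_upd_less:
  assumes "finite J" "j \<in> J" "\<And>i. i \<in> J - {j} \<Longrightarrow> b < x i"
  shows "Min ((x(j := b)) ` J) = (b :: real)"
proof (rule Min_eqI)
  show "finite ((x(j := b)) ` J)"
    using assms(1) by simp
  show "b \<in> (x(j := b)) ` J"
    using assms(2) by (intro image_eqI[of _ _ j]) auto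
  show "b \<le> y" if "y \<in> (x(j := b)) ` J" for y
    using that assms(3) by (auto intro: less_imp_le split: if_splits)
qed

text \<open>If the minimum \<open>b\<close> of the n values sits at position \<open>j\<close>, the
  running minima from \<open>j\<close> on all equal \<open>b\<close>, which gives n - j factors. The
  j vertices before it contribute \<open>F j b\<close>, and the n - j - 1 vertices after it only
  have to exceed \<open>b\<close>.\<close>

lemma F_rec:
  assumes n: "0 < n"
  shows "F n a = (\<Sum>j<n. \<integral>\<^sup>+b. (if a < b then ennreal b ^ (n - j) * F j b * emeasure A_law {b<..} ^ (n - j - 1) else 0) \<partial>A_law)"
proof -
  let ?f = "\<lambda>x. if \<forall>i\<in>{..<n}. a < x i then prefix_min_prod n x else 0"
  have "F n a = (\<Sum>j<n. \<integral>\<^sup>+b. \<integral>\<^sup>+x. (if \<forall>i\<in>{..<n} - {j}. b < x i then ?f (x(j := b)) else 0)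
      \<partial>Pi\<^sub>M ({..<n} - {j}) (\<lambda>_. A_law) \<partial>A_law)"
    unfolding F_def using n
    by (intro nn_integral_PiM_A_law_argmin measurable_all_greater prefix_min_prod_measurable) auto
  also have "\<dots> = (\<Sum>j<n. \<integral>\<^sup>+b. (if a < b then ennreal b ^ (n - j) * F j b * emeasure A_law {b<..} ^ (n - j - 1) else 0) \<partial>A_law)"
  proof (intro sum.cong refl nn_integral_cong)
    fix j b assume j: "j \<in> {..<n}"
    define c where "c = (if a < b then ennreal b ^ (n - j) else 0)"
    let ?g = "\<lambda>x. if \<forall>i\<in>{..<j}. b < x i then prefix_min_prod j x else 0"
    let ?h = "\<lambda>x. c * (if \<forall>i\<in>{j<..<n}. b < x i then 1 else 0)"
    have split: "{..<n} - {j} = {..<j} \<union> {j<..<n}"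
      using j by auto
    have eq: "(if \<forall>i\<in>{..<n} - {j}. b < x i then ?f (x(j := b)) else 0)
        = (if \<forall>i\<in>{..<j}. b < restrict x {..<j} i then prefix_min_prod j (restrict x {..<j}) else 0) *
          (c * (if \<forall>i\<in>{j<..<n}. b < restrict x {j<..<n} i then 1 else 0))" for x
    proof (cases "\<forall>i\<in>{..<n} - {j}. b < x i")
      case True
      have "(\<forall>i\<in>{..<n}. a < (x(j := b)) i) \<longleftrightarrow> a < b"
        using True j by (auto intro: less_trans)
      moreover have "prefix_min_prod n (x(j := b)) = prefix_min_prod j x * ennreal b ^ (n - j)"
      proof -
        have n_eq: "{..<n} = {..<j} \<union> {j..<n}"
          using j by auto
        have 1: "prefix_min_prod n (x(j := b))
            = prefix_min_prod j (x(j := b)) * (\<Prod>i\<in>{j..<n}. ennreal (Min ((x(j := b)) ` {..i})))"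
          unfolding prefix_min_prod_def n_eq by (rule prod.union_disjoint) auto
        have 2: "prefix_min_prod j (x(j := b)) = prefix_min_prod j x"
          by (rule prefix_min_prod_cong) simp
        have 3: "(\<Prod>i\<in>{j..<n}. ennreal (Min ((x(j := b)) ` {..i}))) = (\<Prod>i\<in>{j..<n}. ennreal b)"
          using True by (intro prod.cong refl arg_cong[where f = ennreal] Min_fun_upd_less) auto
        show ?thesis
          unfolding 1 2 3 by (simp only: prod_constant card_atLeastLessThan)
      qed
      moreover have "(\<forall>i\<in>{..<j}. b < restrict x {..<j} i)" "(\<forall>i\<in>{j<..<n}. b < restrict x {j<..<n} i)"
        using True j by auto
      ultimately show ?thesis
        using True by (simp add: prefix_min_prod_restrict c_def)
    next
      case False
      then have "\<not> (\<forall>i\<in>{..<j}. b < restrict x {..<j} i) \<or> \<not> (\<forall>i\<in>{j<..<n}. b < restrict x {j<..<n} i)"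
        unfolding split by auto
      then show ?thesis
        unfolding if_not_P[OF False] by (elim disjE) (simp_all only: if_False mult_zero_left mult_zero_right)
    qed
    have "(\<integral>\<^sup>+x. (if \<forall>i\<in>{..<n} - {j}. b < x i then ?f (x(j := b)) else 0) \<partial>Pi\<^sub>M ({..<n} - {j}) (\<lambda>_. A_law))
        = F j b * (\<integral>\<^sup>+x. ?h x \<partial>Pi\<^sub>M {j<..<n} (\<lambda>_. A_law))"
      unfolding F_def split
    proof (rule nn_integral_PiM_A_law_split[where g = ?g and h = ?h])
      show "?g \<in> borel_measurable (Pi\<^sub>M {..<j} (\<lambda>_. A_law))"
        by (intro measurable_all_greater prefix_min_prod_measurable) auto
      show "?h \<in> borel_measurable (Pi\<^sub>M {j<..<n} (\<lambda>_. A_law))"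
        by (intro borel_measurable_times_ennreal measurable_all_greater) auto
      show "(if \<forall>i\<in>{..<j} \<union> {j<..<n}. b < x i then ?f (x(j := b)) else 0)
          = ?g (restrict x {..<j}) * ?h (restrict x {j<..<n})" for x
        using eq[of x] unfolding split .
    qed auto
    also have "(\<integral>\<^sup>+x. ?h x \<partial>Pi\<^sub>M {j<..<n} (\<lambda>_. A_law))
        = c * (\<integral>\<^sup>+x. (if \<forall>i\<in>{j<..<n}. b < x i then 1 else 0) \<partial>Pi\<^sub>M {j<..<n} (\<lambda>_. A_law))"
      by (intro nn_integral_cmult measurable_all_greater) auto
    also have "\<dots> = c * emeasure A_law {b<..} ^ (n - j - 1)"
      unfolding emeasure_all_greater[OF finite_greaterThanLessThan] by simp
    finally show "(\<integral>\<^sup>+x. (if \<forall>i\<in>{..<n} - {j}. b < x i then ?f (x(j := b)) else 0) \<partial>Pi\<^sub>M ({..<n} - {j}) (\<lambda>_. A_law))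
        = (if a < b then ennreal b ^ (n - j) * F j b * emeasure A_law {b<..} ^ (n - j - 1) else 0)"
      by (simp add: c_def mult_ac)
  qed
  finally show ?thesis .
qed

text \<open>The reflection sending i to k - i turns minima over final segments into running minima
  and leaves the i.i.d. law unchanged.\<close>

lemma F_reversed:
  assumes "j \<le> k"
  shows "(\<integral>\<^sup>+x. (if \<forall>i\<in>{j<..k}. b < x i then \<Prod>i\<in>{j..<k}. ennreal (Min (x ` {Suc i..k})) else 0)
    \<partial>Pi\<^sub>M {j<..k} (\<lambda>_. A_law)) = F (k - j) b"
proof -
  let ?t = "\<lambda>x. \<lambda>i\<in>{..<k - j}. x (k - i) :: real"
  let ?f = "\<lambda>x. if \<forall>i\<in>{..<k - j}. b < x i then prefix_min_prod (k - j) x else 0"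
  have inj: "inj_on (\<lambda>i. k - i) {..<k - j}" and im: "(\<lambda>i. k - i) \<in> {..<k - j} \<rightarrow> {j<..k}"
    by (auto simp: inj_on_def)
  have t: "?t \<in> measurable (Pi\<^sub>M {j<..k} (\<lambda>_. A_law)) (Pi\<^sub>M {..<k - j} (\<lambda>_. A_law))"
    using im by (intro measurable_restrict measurable_component_singleton) auto
  have f: "?f \<in> borel_measurable (Pi\<^sub>M {..<k - j} (\<lambda>_. A_law))"
    by (intro measurable_all_greater prefix_min_prod_measurable) auto
  have "F (k - j) b = (\<integral>\<^sup>+x. ?f x \<partial>distr (Pi\<^sub>M {j<..k} (\<lambda>_. A_law)) (Pi\<^sub>M {..<k - j} (\<lambda>_. A_law)) ?t)"
    unfolding F_def using distr_PiM_reindex[of "{j<..k}" "\<lambda>_. A_law", OF A_law.prob_space_axioms inj im] by simp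
  also have "\<dots> = (\<integral>\<^sup>+x. ?f (?t x) \<partial>Pi\<^sub>M {j<..k} (\<lambda>_. A_law))"
    using f by (intro nn_integral_distr[OF t]) simp
  also have "\<dots> = (\<integral>\<^sup>+x. (if \<forall>i\<in>{j<..k}. b < x i then \<Prod>i\<in>{j..<k}. ennreal (Min (x ` {Suc i..k})) else 0)
      \<partial>Pi\<^sub>M {j<..k} (\<lambda>_. A_law))"
  proof (intro nn_integral_cong if_cong refl)
    fix x :: "nat \<Rightarrow> real"
    have bij: "{j<..k} = (\<lambda>i. k - i) ` {..<k - j}"
    proof (intro equalityI subsetI)
      fix i assume "i \<in> {j<..k}"
      then show "i \<in> (\<lambda>i. k - i) ` {..<k - j}"
        by (intro image_eqI[of _ _ "k - i"]) auto
    qed auto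
    show "(\<forall>i\<in>{..<k - j}. b < ?t x i) \<longleftrightarrow> (\<forall>i\<in>{j<..k}. b < x i)"
      unfolding bij by simp
    have "prefix_min_prod (k - j) (?t x) = (\<Prod>i<k - j. ennreal (Min (x ` {Suc (k - Suc i)..k})))"
      unfolding prefix_min_prod_def
    proof (intro prod.cong refl arg_cong[where f = ennreal] arg_cong[where f = Min])
      fix i assume i: "i \<in> {..<k - j}"
      have "(\<lambda>i. k - i) ` {..i} = {Suc (k - Suc i)..k}"
      proof (intro equalityI subsetI)
        fix l assume "l \<in> {Suc (k - Suc i)..k}"
        then show "l \<in> (\<lambda>i. k - i) ` {..i}"
          by (intro image_eqI[of _ _ "k - l"]) auto
      qed (use i in auto)
      moreover have "?t x ` {..i} = x ` ((\<lambda>i. k - i) ` {..i})"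
        unfolding image_image using i by (intro image_cong) auto
      ultimately show "?t x ` {..i} = x ` {Suc (k - Suc i)..k}"
        by simp
    qed
    also have "\<dots> = (\<Prod>i\<in>{j..<k}. ennreal (Min (x ` {Suc i..k})))"
      by (rule prod.reindex_bij_witness[of _ "\<lambda>i. k - Suc i" "\<lambda>i. k - Suc i"]) (use assms in auto)
    finally show "prefix_min_prod (k - j) (?t x) = (\<Prod>i\<in>{j..<k}. ennreal (Min (x ` {Suc i..k})))" .
  qed
  finally show ?thesis
    by simp
qed

section \<open>The path functional as a convolution\<close>

lemma tau_path_graph:
  assumes "i < k"
  shows "tau (path_graph k) {i, Suc i} x = max (Min (x ` {0..i})) (Min (x ` {Suc i..k}))"
  unfolding tau_def components_path_delete_edge[OF assms] by simp

lemma prod_edges_path_graph: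
  "(\<Prod>e\<in>edges (path_graph k). tau (path_graph k) e x) = (\<Prod>i<k. max (Min (x ` {0..i})) (Min (x ` {Suc i..k})))"
proof -
  have "inj_on (\<lambda>i. {i, Suc i}) {..<k}"
    by (auto simp: inj_on_def doubleton_eq_iff)
  then have "(\<Prod>e\<in>edges (path_graph k). tau (path_graph k) e x) = (\<Prod>i<k. tau (path_graph k) {i, Suc i} x)"
    by (subst path_graph_def) (simp add: prod.reindex)
  also have "\<dots> = (\<Prod>i<k. max (Min (x ` {0..i})) (Min (x ` {Suc i..k})))"
    by (intro prod.cong refl tau_path_graph) simp
  finally show ?thesis .
qed

text \<open>The j edges to the left of the minimal vertex \<open>j\<close> match the j nonempty
  prefixes of the vertices 0, ..., j - 1, so exactly the factors of \<open>prefix_min_prod j\<close>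
  occur; the k - j edges on the right are treated by \<open>F_reversed\<close>.\<close>

lemma Psi_path_graph:
  "Psi (path_graph k) = enn2real (\<Sum>j\<le>k. \<integral>\<^sup>+b. F j b * F (k - j) b \<partial>A_law)"
proof -
  let ?r = "\<lambda>i x. max (Min (x ` {0..i})) (Min (x ` {Suc i..k}))"
  have verts: "verts (path_graph k) = {0..k}"
    by (simp add: path_graph_def)
  have r: "?r i \<in> borel_measurable (Pi\<^sub>M {0..k} (\<lambda>_. A_law))" if "i < k" for i
    using that by (intro borel_measurable_max measurable_PiM_A_law_Min) auto
  have "AE x in Pi\<^sub>M {0..k} (\<lambda>_. A_law). \<forall>i\<in>{0..k}. 1 < x i"
    by (rule AE_PiM_A_law_gt_one) simp
  then have nonneg: "AE x in Pi\<^sub>M {0..k} (\<lambda>_. A_law). \<forall>i<k. 0 \<le> ?r i x"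
  proof eventually_elim
    case (elim x)
    show ?case
    proof (intro allI impI)
      fix i assume "i < k"
      then have "Min (x ` {0..i}) \<in> x ` {0..i}"
        by (intro Min_in) auto
      then obtain l where "Min (x ` {0..i}) = x l" "l \<in> {0..i}"
        by (rule imageE)
      moreover have "1 < x l"
        using \<open>l \<in> {0..i}\<close> \<open>i < k\<close> elim by simp
      ultimately show "0 \<le> ?r i x"
        by simp
    qed
  qed
  have "Psi (path_graph k) = enn2real (\<integral>\<^sup>+x. ennreal (\<Prod>i<k. ?r i x) \<partial>Pi\<^sub>M {0..k} (\<lambda>_. A_law))"
    unfolding Psi_def prod_edges_path_graph verts
  proof (rule integral_eq_nn_integral)
    show "(\<lambda>x. \<Prod>i<k. ?r i x) \<in> borel_measurable (Pi\<^sub>M {0..k} (\<lambda>_. A_law))"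
      using r by (intro borel_measurable_prod) auto
    show "AE x in Pi\<^sub>M {0..k} (\<lambda>_. A_law). 0 \<le> (\<Prod>i<k. ?r i x)"
      using nonneg by eventually_elim (auto intro!: prod_nonneg)
  qed
  also have "(\<integral>\<^sup>+x. ennreal (\<Prod>i<k. ?r i x) \<partial>Pi\<^sub>M {0..k} (\<lambda>_. A_law))
      = (\<integral>\<^sup>+x. (\<Prod>i<k. ennreal (?r i x)) \<partial>Pi\<^sub>M {0..k} (\<lambda>_. A_law))"
  proof (rule nn_integral_cong_AE)
    from nonneg show "AE x in Pi\<^sub>M {0..k} (\<lambda>_. A_law). ennreal (\<Prod>i<k. ?r i x) = (\<Prod>i<k. ennreal (?r i x))"
    proof eventually_elim
      case (elim x)
      show ?case
        by (rule prod_ennreal[symmetric]) (use elim in simp)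
    qed
  qed
  also have "\<dots> = (\<Sum>j\<in>{0..k}. \<integral>\<^sup>+b. \<integral>\<^sup>+x. (if \<forall>i\<in>{0..k} - {j}. b < x i then \<Prod>i<k. ennreal (?r i (x(j := b))) else 0)
      \<partial>Pi\<^sub>M ({0..k} - {j}) (\<lambda>_. A_law) \<partial>A_law)"
  proof (rule nn_integral_PiM_A_law_argmin)
    show "(\<lambda>x. \<Prod>i<k. ennreal (?r i x)) \<in> borel_measurable (Pi\<^sub>M {0..k} (\<lambda>_. A_law))"
    proof (rule borel_measurable_prod_ennreal)
      fix i assume "i \<in> {..<k}"
      then have [measurable]: "?r i \<in> borel_measurable (Pi\<^sub>M {0..k} (\<lambda>_. A_law))"
        by (intro r) simp
      show "(\<lambda>x. ennreal (?r i x)) \<in> borel_measurable (Pi\<^sub>M {0..k} (\<lambda>_. A_law))"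
        by measurable
    qed
  qed auto
  also have "\<dots> = (\<Sum>j\<le>k. \<integral>\<^sup>+b. F j b * F (k - j) b \<partial>A_law)"
  proof (intro sum.cong nn_integral_cong)
    fix j b assume "j \<in> {..k}"
    then have j: "j \<le> k"
      by simp
    let ?g = "\<lambda>x. if \<forall>i\<in>{..<j}. b < x i then prefix_min_prod j x else 0"
    let ?h = "\<lambda>x. if \<forall>i\<in>{j<..k}. b < x i then \<Prod>i\<in>{j..<k}. ennreal (Min (x ` {Suc i..k})) else 0"
    have split: "{0..k} - {j} = {..<j} \<union> {j<..k}"
      using j by auto
    have eq: "(if \<forall>i\<in>{..<j} \<union> {j<..k}. b < x i then \<Prod>i<k. ennreal (?r i (x(j := b))) else 0)
        = ?g (restrict x {..<j}) * ?h (restrict x {j<..k})" for x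
    proof (cases "\<forall>i\<in>{..<j} \<union> {j<..k}. b < x i")
      case True
      have k_eq: "{..<k} = {..<j} \<union> {j..<k}"
        using j by auto
      have "(\<Prod>i<k. ennreal (?r i (x(j := b)))) = (\<Prod>i<j. ennreal (?r i (x(j := b)))) * (\<Prod>i\<in>{j..<k}. ennreal (?r i (x(j := b))))"
        unfolding k_eq by (rule prod.union_disjoint) auto
      also have "(\<Prod>i<j. ennreal (?r i (x(j := b)))) = prefix_min_prod j (restrict x {..<j})"
        unfolding prefix_min_prod_restrict unfolding prefix_min_prod_def
      proof (intro prod.cong refl arg_cong[where f = ennreal])
        fix i assume i: "i \<in> {..<j}"
        have "Min ((x(j := b)) ` {Suc i..k}) = b"
          using True i j by (intro Min_fun_upd_less) auto
        moreover have im: "(x(j := b)) ` {0..i} = x ` {..i}"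
          using i by (auto simp: image_def)
        moreover have "b \<le> Min (x ` {..i})"
          using True i by (intro Min.boundedI) (auto intro: less_imp_le)
        ultimately show "?r i (x(j := b)) = Min (x ` {..i})"
          by (simp only: im max_absorb1)
      qed
      also have "(\<Prod>i\<in>{j..<k}. ennreal (?r i (x(j := b)))) = (\<Prod>i\<in>{j..<k}. ennreal (Min (restrict x {j<..k} ` {Suc i..k})))"
      proof (intro prod.cong refl arg_cong[where f = ennreal])
        fix i assume i: "i \<in> {j..<k}"
        have "Min ((x(j := b)) ` {0..i}) = b"
          using True i j by (intro Min_fun_upd_less) auto
        moreover have im: "(x(j := b)) ` {Suc i..k} = restrict x {j<..k} ` {Suc i..k}"
          using i by (intro image_cong) auto
        moreover have "b \<le> Min (restrict x {j<..k} ` {Suc i..k})"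
          using True i by (intro Min.boundedI) (auto intro: less_imp_le)
        ultimately show "?r i (x(j := b)) = Min (restrict x {j<..k} ` {Suc i..k})"
          by (simp only: im max_absorb2)
      qed
      finally have prod: "(\<Prod>i<k. ennreal (?r i (x(j := b)))) = prefix_min_prod j (restrict x {..<j}) *
          (\<Prod>i\<in>{j..<k}. ennreal (Min (restrict x {j<..k} ` {Suc i..k})))" .
      have left: "\<forall>i\<in>{..<j}. b < restrict x {..<j} i" and right: "\<forall>i\<in>{j<..k}. b < restrict x {j<..k} i"
        using True by auto
      show ?thesis
        unfolding if_P[OF True] if_P[OF left] if_P[OF right] by (rule prod)
    next
      case False
      then have "\<not> (\<forall>i\<in>{..<j}. b < restrict x {..<j} i) \<or> \<not> (\<forall>i\<in>{j<..k}. b < restrict x {j<..k} i)"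
        by auto
      then show ?thesis
        unfolding if_not_P[OF False] by (elim disjE) (simp_all only: if_False mult_zero_left mult_zero_right)
    qed
    have "(\<integral>\<^sup>+x. (if \<forall>i\<in>{0..k} - {j}. b < x i then \<Prod>i<k. ennreal (?r i (x(j := b))) else 0)
        \<partial>Pi\<^sub>M ({0..k} - {j}) (\<lambda>_. A_law)) = F j b * (\<integral>\<^sup>+x. ?h x \<partial>Pi\<^sub>M {j<..k} (\<lambda>_. A_law))"
      unfolding F_def split
    proof (rule nn_integral_PiM_A_law_split[where g = ?g and h = ?h])
      show "?h \<in> borel_measurable (Pi\<^sub>M {j<..k} (\<lambda>_. A_law))"
        by (intro measurable_all_greater borel_measurable_prod_ennreal
            measurable_compose[OF measurable_PiM_A_law_Min measurable_ennreal]) auto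
      show "?g \<in> borel_measurable (Pi\<^sub>M {..<j} (\<lambda>_. A_law))"
        by (intro measurable_all_greater prefix_min_prod_measurable) auto
      show "(if \<forall>i\<in>{..<j} \<union> {j<..k}. b < x i then \<Prod>i<k. ennreal (?r i (x(j := b))) else 0)
          = ?g (restrict x {..<j}) * ?h (restrict x {j<..k})" for x
        by (rule eq)
    qed auto
    then show "(\<integral>\<^sup>+x. (if \<forall>i\<in>{0..k} - {j}. b < x i then \<Prod>i<k. ennreal (?r i (x(j := b))) else 0)
        \<partial>Pi\<^sub>M ({0..k} - {j}) (\<lambda>_. A_law)) = F j b * F (k - j) b"
      unfolding F_reversed[OF j] .
  qed auto
  finally show ?thesis .
qed

section \<open>The differential equation of the generating function\<close>

text \<open>\<open>h\<close> and \<open>R\<close> only matter on the open half-line: at \<open>0\<close> they are the junk value \<open>0 / 0 = 0\<close>.\<close>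

definition h :: "real \<Rightarrow> real" where
  "h y = y / (exp y - 1)"

definition h' :: "real \<Rightarrow> real" where
  "h' y = (exp y - 1 - y * exp y) / (exp y - 1)\<^sup>2"

text \<open>The defect of \<open>h\<close> in the equation h' = - h / 2, which exp (- y / 2)
  satisfies. Near 0 it is about y / 6.\<close>

definition \<kappa> :: "real \<Rightarrow> real" where
  "\<kappa> y = - h y - 2 * h' y"

text \<open>\<open>R\<close> solves \<open>R' = - \<kappa> / (1 - h) R\<close> with \<open>R(\<infinity>) = 1\<close>; in terms of \<open>u = 1 - exp (- y)\<close> it is
  \<open>u\<^sup>2 / (1 - (1 + y) (1 - u))\<close>.\<close>

definition R :: "real \<Rightarrow> real" where
  "R y = (exp y - 1)\<^sup>2 / (exp y * (exp y - 1 - y))"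

lemma exp_gt_one_plus:
  fixes y :: real
  assumes "0 < y"
  shows "1 + y < exp y"
proof -
  have "exp y \<noteq> 1 + y"
    using ln_eq_minus_one[of "exp y"] assms by auto
  then show ?thesis
    using exp_ge_add_one_self[of y] by linarith
qed

lemma DERIV_h:
  assumes "0 < y"
  shows "(h has_real_derivative h' y) (at y)"
proof -
  have "((\<lambda>y. exp y - 1) has_real_derivative exp y) (at y)"
    by (auto intro!: derivative_eq_intros)
  from DERIV_divide[OF DERIV_ident this] assms show ?thesis
    unfolding h_def h'_def by (simp add: power2_eq_square)
qed

lemma h_pos: "0 < y \<Longrightarrow> 0 < h y"
  by (simp add: h_def)

lemma h_less_one: "0 < y \<Longrightarrow> h y < 1"
  using exp_gt_one_plus[of y] by (simp add: h_def)

text \<open>Equivalent to y / 2 \<ge> tanh (y / 2). After clearing denominators the numerator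
  \<open>f\<close> vanishes at 0, and its derivative is nonnegative by
  \<open>1 - x \<le> exp (- x)\<close>. This sign drives every comparison from infinity.\<close>

lemma \<kappa>_nonneg:
  assumes "0 < y"
  shows "0 \<le> \<kappa> y"
proof -
  define f where "f y = y * exp y + y - 2 * exp y + 2" for y :: real
  have "f 0 \<le> f y"
  proof (rule DERIV_nonneg_imp_nondecreasing[of 0 y f])
    fix x :: real assume "0 \<le> x" "x \<le> y"
    have "exp x * (1 - x) \<le> exp x * exp (- x)"
      using exp_ge_add_one_self[of "- x"] by (intro mult_left_mono) auto
    then have "0 \<le> x * exp x + 1 - exp x"
      by (simp add: exp_minus algebra_simps)
    moreover have "(f has_real_derivative (x * exp x + 1 - exp x)) (at x)"
      unfolding f_def by (auto intro!: derivative_eq_intros)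
    ultimately show "\<exists>d. (f has_real_derivative d) (at x) \<and> 0 \<le> d"
      by blast
  qed (use assms in simp)
  moreover have "\<kappa> y = f y / (exp y - 1)\<^sup>2"
    using assms by (simp add: \<kappa>_def h_def h'_def f_def power2_eq_square divide_simps) (simp add: algebra_simps)
  ultimately show ?thesis
    by (simp add: f_def)
qed

text \<open>This is sinh (y / 2) \<ge> y / 2. It provides both the decay of the coefficients in y
  and the majorant for dominated convergence.\<close>

lemma h_le_exp:
  assumes "0 < y"
  shows "h y \<le> exp (- (y / 2))"
proof -
  define f where "f y = exp y - 1 - y * exp (y / 2)" for y :: real
  have "f 0 \<le> f y"
  proof (rule DERIV_nonneg_imp_nondecreasing[of 0 y f])
    fix x :: real
    have "0 \<le> exp (x / 2) - 1 - x / 2"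
      using exp_ge_add_one_self[of "x / 2"] by linarith
    then have "0 \<le> exp (x / 2) * (exp (x / 2) - 1 - x / 2)"
      by (rule mult_nonneg_nonneg[OF exp_ge_zero])
    moreover have "(f has_real_derivative (exp (x / 2) * (exp (x / 2) - 1 - x / 2))) (at x)"
      unfolding f_def
      by (rule derivative_eq_intros refl | simp add: algebra_simps flip: exp_add)+
    ultimately show "\<exists>d. (f has_real_derivative d) (at x) \<and> 0 \<le> d"
      by blast
  qed (use assms in simp)
  then have "y * exp (y / 2) \<le> exp y - 1"
    by (simp add: f_def)
  then show ?thesis
    using assms by (simp add: h_def exp_minus field_simps)
qed

lemma h_antimono:
  assumes "0 < y" "y \<le> z"
  shows "h z \<le> h y"
proof (rule DERIV_nonpos_imp_nonincreasing[OF assms(2)])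
  fix x assume "y \<le> x"
  then have x: "0 < x"
    using assms by simp
  have "h' x \<le> 0"
    using \<kappa>_nonneg[OF x] h_pos[OF x] by (simp add: \<kappa>_def)
  then show "\<exists>d. (h has_real_derivative d) (at x) \<and> d \<le> 0"
    using DERIV_h[OF x] by blast
qed

lemma tendsto_h_at_top: "(h \<longlongrightarrow> 0) at_top"
  unfolding h_def by real_asymp

lemma R_pos: "0 < y \<Longrightarrow> 0 < R y"
  using exp_gt_one_plus[of y] by (simp add: R_def)

lemma DERIV_R:
  assumes "0 < y"
  shows "(R has_real_derivative (- (\<kappa> y / (1 - h y) * R y))) (at y)"
proof -
  \<comment> \<open>In terms of \<open>w\<close> and \<open>q\<close> all functions are rational,
    and substituting y = w - 1 - q leaves a polynomial identity.\<close>
  define w q where "w = exp y" and "q = exp y - 1 - y"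
  have q: "q \<noteq> 0" "w \<noteq> 0" "w - 1 \<noteq> 0" "w \<noteq> 1"
    using exp_gt_one_plus[OF assms] assms by (auto simp: q_def w_def)
  have num: "((\<lambda>y. (exp y - 1)\<^sup>2) has_real_derivative 2 * (w - 1) * w) (at y)"
    unfolding w_def by (auto intro!: derivative_eq_intros)
  have den: "((\<lambda>y. exp y * (exp y - 1 - y)) has_real_derivative w * q + w * (w - 1)) (at y)"
    unfolding w_def q_def by (auto intro!: derivative_eq_intros)
  have "(R has_real_derivative ((2 * (w - 1) * w) * (w * q) - (w - 1)\<^sup>2 * (w * q + w * (w - 1))) / (w * q)\<^sup>2) (at y)"
  proof -
    have "exp y * (exp y - 1 - y) \<noteq> 0"
      using q by (simp add: q_def)
    from DERIV_divide[OF num den this] show ?thesis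
      unfolding R_def w_def q_def power2_eq_square .
  qed
  moreover have "((2 * (w - 1) * w) * (w * q) - (w - 1)\<^sup>2 * (w * q + w * (w - 1))) / (w * q)\<^sup>2
      = - (\<kappa> y / (1 - h y) * R y)"
  proof -
    have y: "y = w - 1 - q"
      by (simp add: w_def q_def)
    have 1: "1 - h y = q / (w - 1)"
      using q by (simp add: h_def w_def[symmetric] field_simps) (simp add: y)
    have 2: "\<kappa> y = (y * w + y - 2 * w + 2) / (w - 1)\<^sup>2"
      using q by (simp add: \<kappa>_def h_def h'_def w_def[symmetric] divide_simps power2_eq_square)
        (simp add: algebra_simps)
    have 3: "R y = (w - 1)\<^sup>2 / (w * q)"
      by (simp add: R_def w_def q_def)
    show ?thesis
      unfolding 1 2 3 using q by (simp add: divide_simps power2_eq_square) (simp add: y algebra_simps)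
  qed
  ultimately show ?thesis
    by simp
qed

lemma tendsto_R_at_top: "(R \<longlongrightarrow> 1) at_top"
  unfolding R_def by real_asymp

lemma tendsto_R_at_right_0: "(R \<longlongrightarrow> 2) (at_right 0)"
  unfolding R_def by real_asymp

text \<open>All comparisons below follow the pattern of integrating a differential inequality from \<open>\<infinity>\<close>.\<close>

lemma DERIV_nonpos_ge_limit:
  fixes f :: "real \<Rightarrow> real"
  assumes deriv: "\<And>x. y \<le> x \<Longrightarrow> (f has_real_derivative f' x) (at x)"
    and nonpos: "\<And>x. y \<le> x \<Longrightarrow> f' x \<le> 0"
    and lim: "(f \<longlongrightarrow> l) at_top"
  shows "l \<le> f y"
proof (rule tendsto_upperbound[OF lim])
  have "f z \<le> f y" if "y \<le> z" for z
    using that deriv nonpos by (intro DERIV_nonpos_imp_nonincreasing[of y z f]) blast+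
  then show "\<forall>\<^sub>F z in at_top. f z \<le> f y"
    using eventually_ge_at_top[of y] by (rule eventually_mono[rotated])
qed simp

lemma R_le_2:
  assumes "0 < y"
  shows "R y \<le> 2"
proof (rule tendsto_lowerbound[OF tendsto_R_at_right_0])
  have "R y \<le> R z" if "0 < z" "z \<le> y" for z
  proof (rule DERIV_nonpos_imp_nonincreasing[OF that(2)])
    fix x assume "z \<le> x"
    then have x: "0 < x"
      using that by simp
    have "0 \<le> \<kappa> x / (1 - h x) * R x"
      using \<kappa>_nonneg[OF x] h_less_one[OF x] R_pos[OF x] by simp
    then show "\<exists>d. (R has_real_derivative d) (at x) \<and> d \<le> 0"
      using DERIV_R[OF x] by (intro exI[of _ "- (\<kappa> x / (1 - h x) * R x)"]) simp
  qed
  then show "\<forall>\<^sub>F z in at_right 0. R y \<le> R z"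
    using assms by (auto simp: eventually_at_right_field intro!: exI[of _ y])
qed simp

section \<open>Coefficientwise derivatives and limits of formal power series\<close>

lemma fps_mult_has_real_derivative:
  fixes U V :: "real \<Rightarrow> real fps"
  assumes "\<And>n. ((\<lambda>x. U x $ n) has_real_derivative U' $ n) (at y)"
    and "\<And>n. ((\<lambda>x. V x $ n) has_real_derivative V' $ n) (at y)"
  shows "((\<lambda>x. (U x * V x) $ n) has_real_derivative (U' * V y + U y * V') $ n) (at y)"
proof -
  have "((\<lambda>x. \<Sum>i = 0..n. U x $ i * V x $ (n - i)) has_real_derivative
      (\<Sum>i = 0..n. U' $ i * V y $ (n - i) + V' $ (n - i) * U y $ i)) (at y)"
    by (intro DERIV_sum DERIV_mult assms)
  then show ?thesis
    by (simp add: fps_mult_nth sum.distrib mult.commute[of "V' $ j" "U y $ l" for j l])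
qed

lemma fps_mult_tendsto:
  fixes U V :: "'a \<Rightarrow> real fps"
  assumes "\<And>n. ((\<lambda>x. U x $ n) \<longlongrightarrow> u $ n) A" "\<And>n. ((\<lambda>x. V x $ n) \<longlongrightarrow> v $ n) A"
  shows "((\<lambda>x. (U x * V x) $ n) \<longlongrightarrow> (u * v) $ n) A"
  unfolding fps_mult_nth by (rule tendsto_sum, rule tendsto_mult) (rule assms)+

text \<open>Each coefficient of the inverse is a polynomial in earlier ones and the coefficients of
  \<open>U\<close>; limits and differentiability pass to the inverse by induction along this
  recursion.\<close>

lemma fps_inverse_nth_rec:
  fixes U :: "real fps"
  assumes "U $ 0 = 1"
  shows "inverse U $ n = (if n = 0 then 1 else - (\<Sum>i = 1..n. U $ i * inverse U $ (n - i)))"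
proof (cases "n = 0")
  case False
  have "0 = (U * inverse U) $ n"
    using assms False by (simp add: inverse_mult_eq_1')
  also have "\<dots> = inverse U $ n + (\<Sum>i = 1..n. U $ i * inverse U $ (n - i))"
    using assms by (simp add: fps_mult_nth sum.atLeast_Suc_atMost)
  finally show ?thesis
    using False by simp
qed (use assms in simp)

lemma fps_inverse_tendsto:
  fixes U :: "'a \<Rightarrow> real fps"
  assumes lim: "\<And>n. ((\<lambda>x. U x $ n) \<longlongrightarrow> u $ n) A" and U: "\<And>x. U x $ 0 = 1" and u: "u $ 0 = 1"
  shows "((\<lambda>x. inverse (U x) $ n) \<longlongrightarrow> inverse u $ n) A"
proof (induction n rule: less_induct)
  case (less n)
  have "((\<lambda>x. if n = 0 then 1 else - (\<Sum>i = 1..n. U x $ i * inverse (U x) $ (n - i)))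
      \<longlongrightarrow> (if n = 0 then 1 else - (\<Sum>i = 1..n. u $ i * inverse u $ (n - i)))) A"
    by (cases "n = 0") (auto intro!: tendsto_intros lim less.IH)
  then show ?case
    using fps_inverse_nth_rec[OF U, of _ n] fps_inverse_nth_rec[OF u, of n] by simp
qed

text \<open>The recursion gives differentiability with unspecified derivatives; their value then
  follows from the product rule applied to U * inverse U = 1.\<close>

lemma fps_inverse_has_real_derivative:
  fixes U :: "real \<Rightarrow> real fps"
  assumes deriv: "\<And>n. ((\<lambda>x. U x $ n) has_real_derivative U' $ n) (at y)" and U: "\<And>x. U x $ 0 = 1"
  shows "((\<lambda>x. inverse (U x) $ n) has_real_derivative (- U' * inverse (U y) * inverse (U y)) $ n) (at y)"
proof -
  have "\<exists>d. ((\<lambda>x. inverse (U x) $ n) has_real_derivative d) (at y)" for n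
  proof (induction n rule: less_induct)
    case (less n)
    then obtain d where d: "\<And>m. m < n \<Longrightarrow> ((\<lambda>x. inverse (U x) $ m) has_real_derivative d m) (at y)"
      by metis
    show ?case
    proof (cases "n = 0")
      case True
      then show ?thesis
        using U by (auto intro: exI[of _ 0])
    next
      case False
      have "((\<lambda>x. - (\<Sum>i = 1..n. U x $ i * inverse (U x) $ (n - i))) has_real_derivative
          - (\<Sum>i = 1..n. U' $ i * inverse (U y) $ (n - i) + d (n - i) * U y $ i)) (at y)"
        using False by (intro DERIV_minus DERIV_sum DERIV_mult deriv d) auto
      then show ?thesis
        using False fps_inverse_nth_rec[OF U, of _ n] by auto
    qed
  qed
  then obtain d where d: "\<And>n. ((\<lambda>x. inverse (U x) $ n) has_real_derivative d n) (at y)"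
    by metis
  define V' where "V' = Abs_fps d"
  have V': "((\<lambda>x. inverse (U x) $ n) has_real_derivative V' $ n) (at y)" for n
    by (simp add: V'_def d)
  have "U' * inverse (U y) + U y * V' = 0"
  proof (rule fps_ext)
    fix n
    have "((\<lambda>x. (U x * inverse (U x)) $ n) has_real_derivative (U' * inverse (U y) + U y * V') $ n) (at y)"
      by (rule fps_mult_has_real_derivative[OF deriv V'])
    moreover have "U x * inverse (U x) = 1" for x
      using U by (simp add: inverse_mult_eq_1')
    ultimately show "(U' * inverse (U y) + U y * V') $ n = (0 :: real fps) $ n"
      by (auto dest: DERIV_unique[OF _ DERIV_const])
  qed
  then have "inverse (U y) * (U y * V') = inverse (U y) * (- U' * inverse (U y))"
    by (simp add: add_eq_0_iff)
  moreover have "inverse (U y) * (U y * V') = V'"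
    using U by (simp add: inverse_mult_eq_1 mult.assoc[symmetric])
  ultimately have "V' = - U' * inverse (U y) * inverse (U y)"
    by (simp only: mult_ac)
  with V' show ?thesis
    by simp
qed

section \<open>The geometric series 1 / (1 - h X)\<close>

definition H :: "real \<Rightarrow> real fps" where
  "H y = Abs_fps (\<lambda>n. h y ^ n)"

definition D :: "real \<Rightarrow> real fps" where
  "D y = 1 - fps_const (h y) * fps_X"

lemma H_mult_D: "H y * D y = 1"
proof (rule fps_ext)
  fix n
  have "H y * D y = H y - fps_const (h y) * (fps_X * H y)"
    by (simp add: D_def algebra_simps)
  then show "(H y * D y) $ n = (1 :: real fps) $ n"
    by (cases n) (auto simp: H_def)
qed

lemma D_mult_H_cancel: "D y * (H y * U) = U"
proof -
  have "D y * (H y * U) = H y * D y * U"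
    by (simp only: mult_ac)
  then show ?thesis
    by (simp add: H_mult_D)
qed

lemma D_nth: "D y $ n = (if n = 0 then 1 else if n = 1 then - h y else 0)"
  by (cases n) (auto simp: D_def)

lemma DERIV_D:
  assumes "0 < y"
  shows "((\<lambda>x. D x $ n) has_real_derivative (- (fps_const (h' y) * fps_X)) $ n) (at y)"
proof -
  consider "n = 0" | "n = 1" | m where "n = Suc (Suc m)"
    by (metis One_nat_def not0_implies_Suc)
  then show ?thesis
    by cases (use DERIV_minus[OF DERIV_h[OF assms]] in \<open>simp_all add: D_nth\<close>)
qed

lemma tendsto_D_at_top: "((\<lambda>y. D y $ n) \<longlongrightarrow> 1 $ n) at_top"
proof -
  consider "n = 0" | "n = 1" | m where "n = Suc (Suc m)"
    by (metis One_nat_def not0_implies_Suc)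
  then show ?thesis
    by cases (use tendsto_minus[OF tendsto_h_at_top] in \<open>simp_all add: D_nth\<close>)
qed

lemma H_mult_nth_Suc: "(H y * U) $ Suc n = h y * (H y * U) $ n + U $ Suc n"
proof -
  have "(D y * (H y * U)) $ Suc n = U $ Suc n"
    by (simp only: D_mult_H_cancel)
  moreover have "D y * (H y * U) = H y * U - fps_const (h y) * (fps_X * (H y * U))"
    by (simp add: D_def algebra_simps)
  ultimately show ?thesis
    by simp
qed

lemma H_mult_nth: "(H y * U) $ n = (\<Sum>i\<le>n. U $ i * h y ^ (n - i))"
  unfolding mult.commute[of "H y"] fps_mult_nth atLeast0AtMost by (simp add: H_def)

text \<open>Finite form of evaluating \<open>D y * (H y * U) = U\<close> at X = 1. Truncation leaves
  the single boundary term \<open>(H y * U) $ N\<close>, whose sign or size is controlled in each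
  application.\<close>

lemma sum_H_mult_nth: "(1 - h y) * (\<Sum>m<N. (H y * U) $ m) = (\<Sum>m\<le>N. U $ m) - (H y * U) $ N"
proof (induction N)
  case (Suc N)
  have "(1 - h y) * (\<Sum>m<Suc N. (H y * U) $ m)
      = (1 - h y) * (\<Sum>m<N. (H y * U) $ m) + (1 - h y) * (H y * U) $ N"
    by (simp add: distrib_left)
  also have "\<dots> = (\<Sum>m\<le>Suc N. U $ m) - (H y * U) $ Suc N"
    unfolding Suc.IH by (simp add: H_mult_nth_Suc left_diff_distrib)
  finally show ?case .
qed (simp add: H_def)

lemma shift_nth: "(fps_const c * fps_X * U) $ n = (if n = 0 then 0 else c * U $ (n - 1))" for c :: real
  by (simp add: mult.assoc)

lemma sum_shift_nth: "(\<Sum>m\<le>N. (fps_const c * fps_X * U) $ m) = c * (\<Sum>m<N. U $ m)" for c :: real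
  unfolding shift_nth by (induction N) (simp_all add: distrib_left)

text \<open>With \<open>P = \<Sum>n p n X^n\<close> the recursion reads \<open>P' = - P h X / (1 - h X)\<close>. If \<open>\<kappa>\<close> vanished, the
  solution would be \<open>(1 - h X)\<^sup>-\<^sup>2\<close>; the series \<open>E = P (1 - h X)\<^sup>2\<close> measures the deviation
  from it, and its coefficients turn out to be summable uniformly in \<open>y\<close>.\<close>

locale path_recursion =
  fixes p :: "nat \<Rightarrow> real \<Rightarrow> real"
  assumes p_0: "p 0 y = 1"
    and p_nonneg: "0 \<le> p n y"
    and p_measurable [measurable]: "p n \<in> borel_measurable borel"
    and DERIV_p: "0 < y \<Longrightarrow> (p n has_real_derivative - (\<Sum>j<n. p j y * h y ^ (n - j))) (at y)"
    and tendsto_p: "0 < n \<Longrightarrow> (p n \<longlongrightarrow> 0) at_top"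
begin

definition P :: "real \<Rightarrow> real fps" where
  "P y = Abs_fps (\<lambda>n. p n y)"

definition E :: "real \<Rightarrow> real fps" where
  "E y = P y * D y * D y"

definition V :: "real \<Rightarrow> real fps" where
  "V y = inverse (E y)"

lemma P_eq: "P y = E y * (H y * H y)"
proof -
  have "E y * (H y * H y) = P y * (H y * D y) * (H y * D y)"
    unfolding E_def by (simp only: mult_ac)
  then show ?thesis
    by (simp add: H_mult_D)
qed

lemma E_nth_0: "E y $ 0 = 1"
  by (simp add: E_def P_def D_nth p_0)

lemma V_nth_0: "V y $ 0 = 1"
  using E_nth_0 by (simp add: V_def)

lemma DERIV_P:
  assumes "0 < y"
  shows "((\<lambda>x. P x $ n) has_real_derivative (- (P y * (fps_const (h y) * fps_X * H y))) $ n) (at y)"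
proof -
  have "(P y * (fps_const (h y) * fps_X * H y)) $ n
      = (\<Sum>j\<le>n. p j y * (if n - j = 0 then 0 else h y * h y ^ (n - j - 1)))"
    unfolding fps_mult_nth[of "P y"] shift_nth atLeast0AtMost
    by (intro sum.cong refl) (auto simp: P_def H_def)
  also have "\<dots> = (\<Sum>j<n. p j y * h y ^ (n - j))"
    by (rule sum.mono_neutral_cong_right) (auto simp: Suc_diff_Suc simp flip: power_Suc)
  finally show ?thesis
    using DERIV_p[OF assms, of n] by (simp add: P_def)
qed

text \<open>In E' = P' D^2 + 2 P D D' the identity H D = 1 turns every term into a multiple of X P D
  = X H E, and the factors add up to - h - 2 h'.\<close>

lemma DERIV_E:
  assumes "0 < y"
  shows "((\<lambda>x. E x $ n) has_real_derivative (fps_const (\<kappa> y) * fps_X * (H y * E y)) $ n) (at y)"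
proof -
  define X :: "real fps" where "X = fps_X"
  define a b where "a = fps_const (h y)" and "b = fps_const (h' y)"
  note HD = H_mult_D[of y]
  have "((\<lambda>x. (P x * D x * D x) $ n) has_real_derivative
      ((- (P y * (a * X * H y)) * D y + P y * - (b * X)) * D y + P y * D y * - (b * X)) $ n) (at y)"
    unfolding a_def b_def X_def
    by (intro fps_mult_has_real_derivative DERIV_P DERIV_D assms)
  moreover have "(- (P y * (a * X * H y)) * D y + P y * - (b * X)) * D y + P y * D y * - (b * X)
      = fps_const (\<kappa> y) * X * (H y * E y)"
  proof -
    have "(- (P y * (a * X * H y)) * D y + P y * - (b * X)) * D y + P y * D y * - (b * X)
        = - (P y * a * X * D y * (H y * D y)) - (b + b) * X * P y * D y"
      by (simp add: algebra_simps)
    also have "\<dots> = (- a - (b + b)) * X * P y * D y * (H y * D y)"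
      unfolding HD by (simp add: algebra_simps)
    also have "\<dots> = (- a - (b + b)) * X * (H y * E y)"
      unfolding E_def by (simp only: mult_ac)
    also have "- a - (b + b) = fps_const (\<kappa> y)"
      unfolding a_def b_def \<kappa>_def by (rule fps_ext) simp
    finally show ?thesis .
  qed
  ultimately show ?thesis
    by (simp only: E_def X_def)
qed

text \<open>From V' = - E' / E^2: the linear system of \<open>E\<close> with the opposite sign. That
  sign makes integration from infinity preserve nonnegativity.\<close>

lemma DERIV_V:
  assumes "0 < y"
  shows "((\<lambda>x. V x $ n) has_real_derivative (- (fps_const (\<kappa> y) * fps_X * (H y * V y))) $ n) (at y)"
proof -
  have EV: "E y * V y = 1"
    unfolding V_def using E_nth_0 by (simp add: inverse_mult_eq_1')
  have "- (fps_const (\<kappa> y) * fps_X * (H y * E y)) * V y * V y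
      = - (fps_const (\<kappa> y) * fps_X * (H y * V y) * (E y * V y))"
    by (simp add: mult_ac)
  also have "\<dots> = - (fps_const (\<kappa> y) * fps_X * (H y * V y))"
    unfolding EV by simp
  finally show ?thesis
    using fps_inverse_has_real_derivative[OF DERIV_E[OF assms] E_nth_0, of n]
    unfolding V_def[symmetric] by (simp only:)
qed

lemma tendsto_E_at_top: "((\<lambda>y. E y $ n) \<longlongrightarrow> 1 $ n) at_top"
proof -
  have P: "((\<lambda>y. P y $ n) \<longlongrightarrow> 1 $ n) at_top" for n
    using tendsto_p[of n] by (cases n) (auto simp: P_def p_0)
  have "((\<lambda>y. E y $ n) \<longlongrightarrow> (1 * 1 * 1) $ n) at_top"
    unfolding E_def by (intro fps_mult_tendsto P tendsto_D_at_top)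
  then show ?thesis
    by simp
qed

lemma tendsto_V_at_top: "((\<lambda>y. V y $ n) \<longlongrightarrow> 1 $ n) at_top"
  using fps_inverse_tendsto[OF tendsto_E_at_top E_nth_0, of n] by (simp add: V_def)

text \<open>The factor X makes the derivative of a coefficient depend only on earlier coefficients.
  By induction the coefficient is nonincreasing in y, and for positive index it tends to 0 at
  infinity.\<close>

lemma V_nonneg: "0 < y \<Longrightarrow> 0 \<le> V y $ n"
proof (induction n arbitrary: y rule: less_induct)
  case (less n)
  show ?case
  proof (cases n)
    case (Suc m)
    have "0 \<le> V y $ n"
    proof (rule DERIV_nonpos_ge_limit[where f = "\<lambda>y. V y $ n" and y = y])
      fix x assume "y \<le> x"
      then have x: "0 < x"
        using less.prems by simp
      show "((\<lambda>y. V y $ n) has_real_derivative - (\<kappa> x * (H x * V x) $ m)) (at x)"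
        using DERIV_V[OF x, of n] by (simp add: shift_nth Suc)
      have "0 \<le> (H x * V x) $ m"
        unfolding H_mult_nth using x h_pos[OF x] less.IH Suc by (intro sum_nonneg mult_nonneg_nonneg) auto
      then show "- (\<kappa> x * (H x * V x) $ m) \<le> 0"
        using \<kappa>_nonneg[OF x] by simp
    qed (use tendsto_V_at_top[of n] Suc in simp)
    then show ?thesis .
  qed (simp add: V_nth_0)
qed

text \<open>The coefficients of \<open>V = 1 / E\<close> dominate those of \<open>E\<close> because both satisfy the same linear system up to sign.\<close>

lemma abs_E_le_V: "0 < y \<Longrightarrow> \<bar>E y $ n\<bar> \<le> V y $ n"
proof (induction n arbitrary: y rule: less_induct)
  case (less n)
  show ?case
  proof (cases n)
    case (Suc m)
    \<comment> \<open>The cases c = 1 and c = - 1 give the two halves of the modulus bound. The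
      derivative of V + c E involves V - c E, hence the induction must bound the modulus and not one
      side only.\<close>
    have "0 \<le> V y $ n + c * E y $ n" if c: "\<bar>c\<bar> = 1" for c
    proof (rule DERIV_nonpos_ge_limit[where f = "\<lambda>y. V y $ n + c * E y $ n" and y = y])
      fix x assume "y \<le> x"
      then have x: "0 < x"
        using less.prems by simp
      show "((\<lambda>y. V y $ n + c * E y $ n) has_real_derivative
          - (\<kappa> x * (\<Sum>i\<le>m. (V x $ i - c * E x $ i) * h x ^ (m - i)))) (at x)"
      proof (rule DERIV_cong[OF DERIV_add[OF DERIV_V[OF x] DERIV_cmult[OF DERIV_E[OF x]]]])
        show "(- (fps_const (\<kappa> x) * fps_X * (H x * V x))) $ n + c * (fps_const (\<kappa> x) * fps_X * (H x * E x)) $ n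
            = - (\<kappa> x * (\<Sum>i\<le>m. (V x $ i - c * E x $ i) * h x ^ (m - i)))"
          by (simp add: shift_nth Suc H_mult_nth left_diff_distrib sum_subtractf sum_distrib_left algebra_simps)
      qed
      have "0 \<le> V x $ i - c * E x $ i" if "i \<le> m" for i
      proof -
        have "\<bar>c * E x $ i\<bar> \<le> V x $ i"
          using less.IH[of i x] x that c Suc by (simp add: abs_mult)
        then show ?thesis
          by linarith
      qed
      then have "0 \<le> (\<Sum>i\<le>m. (V x $ i - c * E x $ i) * h x ^ (m - i))"
        using h_pos[OF x] by (intro sum_nonneg mult_nonneg_nonneg) auto
      then show "- (\<kappa> x * (\<Sum>i\<le>m. (V x $ i - c * E x $ i) * h x ^ (m - i))) \<le> 0"
        using \<kappa>_nonneg[OF x] by simp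
    next
      have "((\<lambda>y. V y $ n + c * E y $ n) \<longlongrightarrow> 1 $ n + c * 1 $ n) at_top"
        by (intro tendsto_intros tendsto_V_at_top tendsto_E_at_top)
      then show "((\<lambda>y. V y $ n + c * E y $ n) \<longlongrightarrow> 0) at_top"
        using Suc by simp
    qed
    from this[of 1] this[of "-1"] show ?thesis
      by (simp add: abs_le_iff)
  qed (simp add: V_nth_0 E_nth_0)
qed

section \<open>Summability of the coefficients, uniformly in y\<close>

lemma V_antimono:
  assumes "0 < y" "y \<le> z"
  shows "V z $ n \<le> V y $ n"
proof (rule DERIV_nonpos_imp_nonincreasing[OF assms(2), where f = "\<lambda>y. V y $ n"])
  fix x assume "y \<le> x"
  then have x: "0 < x"
    using assms by simp
  have "0 \<le> (fps_const (\<kappa> x) * fps_X * (H x * V x)) $ n"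
    unfolding shift_nth H_mult_nth using x h_pos[OF x] \<kappa>_nonneg[OF x] V_nonneg
    by (auto intro!: sum_nonneg mult_nonneg_nonneg)
  then show "\<exists>d. ((\<lambda>y. V y $ n) has_real_derivative d) (at x) \<and> d \<le> 0"
    using DERIV_V[OF x, of n] by (intro exI conjI) auto
qed

text \<open>At X = 1 the equation of \<open>V\<close> is formally that of \<open>R\<close>, with the
  same limit 1 at infinity, and truncation loses only nonnegative terms. The induction is on N
  because the factor X makes the derivative of the sum up to N + 1 depend on the sum up to
  N.\<close>

lemma sum_V_le_R: "0 < y \<Longrightarrow> (\<Sum>m\<le>N. V y $ m) \<le> R y"
proof (induction N arbitrary: y)
  case (0 y)
  have "1 \<le> R y"
  proof (rule DERIV_nonpos_ge_limit[OF DERIV_R _ tendsto_R_at_top])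
    fix x assume "y \<le> x"
    then show x: "0 < x"
      using 0 by simp
    show "- (\<kappa> x / (1 - h x) * R x) \<le> 0"
      using \<kappa>_nonneg[OF x] h_less_one[OF x] R_pos[OF x] by simp
  qed
  then show ?case
    by (simp add: V_nth_0)
next
  case (Suc N y)
  have "0 \<le> R y - (\<Sum>m\<le>Suc N. V y $ m)"
  proof (rule DERIV_nonpos_ge_limit[where f = "\<lambda>y. R y - (\<Sum>m\<le>Suc N. V y $ m)" and y = y])
    fix x assume "y \<le> x"
    then have x: "0 < x"
      using Suc.prems by simp
    let ?S = "\<Sum>m<Suc N. (H x * V x) $ m"
    have "((\<lambda>y. R y - (\<Sum>m\<le>Suc N. V y $ m)) has_real_derivative - (\<kappa> x / (1 - h x) * R x) -
        (\<Sum>m\<le>Suc N. (- (fps_const (\<kappa> x) * fps_X * (H x * V x))) $ m)) (at x)"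
      by (intro DERIV_diff DERIV_sum DERIV_R DERIV_V x)
    moreover have "(\<Sum>m\<le>Suc N. (- (fps_const (\<kappa> x) * fps_X * (H x * V x))) $ m) = - (\<kappa> x * ?S)"
      unfolding sum_shift_nth[symmetric] by (simp add: sum_negf)
    ultimately show "((\<lambda>y. R y - (\<Sum>m\<le>Suc N. V y $ m)) has_real_derivative
        - (\<kappa> x / (1 - h x) * R x) + \<kappa> x * ?S) (at x)"
      by simp
    have "0 \<le> (H x * V x) $ N"
      unfolding H_mult_nth using x h_pos[OF x] V_nonneg by (intro sum_nonneg mult_nonneg_nonneg) auto
    \<comment> \<open>The boundary term \<open>(H x * V x) $ Suc N\<close> is
      \<open>V x $ Suc N\<close> plus the nonnegative \<open>h x * (H x * V x) $ N\<close>; it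
      cancels the last coefficient, and dropping the rest leaves the sum covered by the induction
      hypothesis.\<close>
    then have "(1 - h x) * ?S \<le> (\<Sum>m\<le>N. V x $ m)"
      unfolding sum_H_mult_nth using h_pos[OF x] by (simp add: H_mult_nth_Suc)
    also have "\<dots> \<le> R x"
      by (rule Suc.IH[OF x])
    finally have "?S \<le> R x / (1 - h x)"
      using h_less_one[OF x] by (simp add: pos_le_divide_eq mult.commute)
    then have "\<kappa> x * ?S \<le> \<kappa> x * (R x / (1 - h x))"
      using \<kappa>_nonneg[OF x] by (rule mult_left_mono)
    then show "- (\<kappa> x / (1 - h x) * R x) + \<kappa> x * ?S \<le> 0"
      by simp
  next
    have "((\<lambda>y. R y - (\<Sum>m\<le>Suc N. V y $ m)) \<longlongrightarrow> 1 - (\<Sum>m\<le>Suc N. 1 $ m)) at_top"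
      by (intro tendsto_diff tendsto_sum tendsto_R_at_top tendsto_V_at_top)
    moreover have "(\<Sum>m\<le>Suc N. (1 :: real fps) $ m) = (\<Sum>m\<le>Suc N. if m = 0 then 1 else 0)"
      by (intro sum.cong) auto
    ultimately show "((\<lambda>y. R y - (\<Sum>m\<le>Suc N. V y $ m)) \<longlongrightarrow> 0) at_top"
      by simp
  qed
  then show ?case
    by simp
qed

text \<open>Each coefficient increases as y decreases to 0, so its limit along y = 1 / (j + 1) is
  its supremum over y > 0. The bound 2 on partial sums survives this limit, which makes the suprema
  summable.\<close>

lemma V_bound:
  obtains b :: "nat \<Rightarrow> real" where "\<And>n. 0 \<le> b n" "\<And>n y. 0 < y \<Longrightarrow> V y $ n \<le> b n" "summable b"
proof -
  let ?y = "\<lambda>j. inverse (real (Suc j))"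
  have V_le: "V y $ n \<le> 2" if "0 < y" for y n
  proof -
    have "V y $ n \<le> (\<Sum>m\<le>n. V y $ m)"
      using V_nonneg[OF that] by (intro member_le_sum) auto
    also have "\<dots> \<le> 2"
      using sum_V_le_R[OF that] R_le_2[OF that] by (rule order_trans)
    finally show ?thesis .
  qed
  have "\<exists>L. (\<lambda>j. V (?y j) $ n) \<longlonglongrightarrow> L \<and> (\<forall>j. V (?y j) $ n \<le> L)" for n
  proof -
    have "incseq (\<lambda>j. V (?y j) $ n)"
      by (intro incseq_SucI V_antimono) (auto simp: field_simps)
    moreover have "\<forall>j. V (?y j) $ n \<le> 2"
      using V_le by simp
    ultimately show ?thesis
      by (rule incseq_convergent) blast
  qed
  then obtain b where b: "\<And>n. (\<lambda>j. V (?y j) $ n) \<longlonglongrightarrow> b n" "\<And>n j. V (?y j) $ n \<le> b n"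
    by metis
  show ?thesis
  proof
    show b_nonneg: "0 \<le> b n" for n
      using b(2)[of 0 n] V_nonneg[of "?y 0" n] by (intro order_trans[OF V_nonneg[of "?y 0" n] b(2)]) simp
    show "V y $ n \<le> b n" if y: "0 < y" for y n
    proof -
      obtain j where "?y j < y"
        using reals_Archimedean[OF y] by blast
      then have "V y $ n \<le> V (?y j) $ n"
        by (intro V_antimono) auto
      then show ?thesis
        using b(2) by (rule order_trans)
    qed
    have "(\<Sum>m\<le>N. b m) \<le> 2" for N
    proof (rule LIMSEQ_le_const2)
      show "(\<lambda>j. \<Sum>m\<le>N. V (?y j) $ m) \<longlonglongrightarrow> (\<Sum>m\<le>N. b m)"
        by (intro tendsto_sum b(1))
      show "\<exists>M. \<forall>j\<ge>M. (\<Sum>m\<le>N. V (?y j) $ m) \<le> 2"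
        using order_trans[OF sum_V_le_R R_le_2] by auto
    qed
    moreover have "(\<Sum>m<N. b m) \<le> (\<Sum>m\<le>N. b m)" for N
      using b_nonneg by (intro sum_mono2) auto
    ultimately show "summable b"
      using b_nonneg by (intro summableI_nonneg_bounded[of b 2]) (auto intro: order_trans)
  qed
qed

text \<open>The product of \<open>R\<close> with a partial sum of the coefficients would be constant
  in y but for the boundary term \<open>(H x * E x) $ N\<close>. On the half-line from y on, that
  term is at most \<open>\<eta> N\<close>, so integration from infinity, where the product tends to
  1, leaves an error of at most \<open>\<eta> N * (R y - 1)\<close>.\<close>

lemma sums_E:
  assumes y: "0 < y"
  shows "(\<lambda>m. E y $ m) sums (1 / R y)"
proof -
  obtain b :: "nat \<Rightarrow> real" where b: "\<And>n. 0 \<le> b n" "\<And>n y. 0 < y \<Longrightarrow> V y $ n \<le> b n" "summable b"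
    using V_bound by blast
  \<comment> \<open>A coefficient of the Cauchy product of two absolutely summable series, hence
    tending to 0; freezing \<open>h\<close> at y is legitimate because \<open>h\<close>
    decreases.\<close>
  define \<eta> where "\<eta> N = (\<Sum>i\<le>N. b i * h y ^ (N - i))" for N
  define T where "T N x = (\<Sum>m\<le>N. E x $ m)" for N x
  have "summable (\<lambda>k. norm (b k))" "summable (\<lambda>k. norm (h y ^ k))"
    using b(1,3) h_pos[OF y] h_less_one[OF y] by (simp_all add: summable_geometric)
  then have "\<eta> \<longlonglongrightarrow> 0"
    unfolding \<eta>_def by (intro summable_LIMSEQ_zero summable_Cauchy_product)
  have bound: "\<bar>(H x * E x) $ N\<bar> \<le> \<eta> N" if "y \<le> x" for x N
  proof -
    have x: "0 < x"
      using y that by simp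
    have "\<bar>(H x * E x) $ N\<bar> \<le> (\<Sum>i\<le>N. \<bar>E x $ i * h x ^ (N - i)\<bar>)"
      unfolding H_mult_nth by (rule sum_abs)
    also have "\<dots> \<le> \<eta> N"
      unfolding \<eta>_def
    proof (rule sum_mono)
      fix i
      have "\<bar>E x $ i\<bar> \<le> b i"
        using abs_E_le_V[OF x] b(2)[OF x] by (rule order_trans)
      then show "\<bar>E x $ i * h x ^ (N - i)\<bar> \<le> b i * h y ^ (N - i)"
        unfolding abs_mult using h_pos[OF x] h_antimono[OF y that] b(1)
        by (intro mult_mono) (auto intro: power_mono)
    qed
    finally show ?thesis .
  qed
  have T_R: "((\<lambda>x. T N x * R x) has_real_derivative - (\<kappa> x / (1 - h x) * R x) * (H x * E x) $ N) (at x)"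
    if "0 < x" for x N
  proof -
    have T': "(T N has_real_derivative \<kappa> x * (\<Sum>m<N. (H x * E x) $ m)) (at x)"
      unfolding T_def sum_shift_nth[symmetric] by (intro DERIV_sum DERIV_E that)
    have "(\<Sum>m<N. (H x * E x) $ m) = (T N x - (H x * E x) $ N) / (1 - h x)"
      using sum_H_mult_nth[of x "E x" N] h_less_one[OF that] by (simp add: T_def field_simps)
    with DERIV_mult[OF T' DERIV_R[OF that]] show ?thesis
      by (simp add: algebra_simps diff_divide_distrib)
  qed
  have one: "(\<Sum>m\<le>N. (1 :: real fps) $ m) = 1" for N
    by (simp add: fps_one_nth)
  \<comment> \<open>Adding \<open>\<eta> N * (R - 1)\<close> compensates the boundary term: its
    derivative is \<open>- \<eta> N\<close> times the same weight
    \<open>\<kappa> / (1 - h) * R\<close>, and it vanishes at infinity.\<close>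
  have diff: "0 + c * 1 \<le> \<eta> N * (R y - 1) + c * (T N y * R y)" if c: "\<bar>c\<bar> = 1" for c N
  proof (rule DERIV_nonpos_ge_limit[where f = "\<lambda>y. \<eta> N * (R y - 1) + c * (T N y * R y)" and y = y])
    fix x assume yx: "y \<le> x"
    then have x: "0 < x"
      using y by simp
    show "((\<lambda>y. \<eta> N * (R y - 1) + c * (T N y * R y)) has_real_derivative
        \<eta> N * (- (\<kappa> x / (1 - h x) * R x) - 0) + c * (- (\<kappa> x / (1 - h x) * R x) * (H x * E x) $ N)) (at x)"
      by (intro DERIV_add DERIV_cmult DERIV_diff DERIV_const DERIV_R T_R x)
    have "\<bar>c * (H x * E x) $ N\<bar> \<le> \<eta> N"
      using bound[OF yx, of N] c by (simp add: abs_mult)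
    then have "0 \<le> \<eta> N + c * (H x * E x) $ N"
      by linarith
    then have "0 \<le> \<kappa> x / (1 - h x) * R x * (\<eta> N + c * (H x * E x) $ N)"
      using \<kappa>_nonneg[OF x] h_less_one[OF x] R_pos[OF x] by simp
    then show "\<eta> N * (- (\<kappa> x / (1 - h x) * R x) - 0) + c * (- (\<kappa> x / (1 - h x) * R x) * (H x * E x) $ N) \<le> 0"
      by (simp add: algebra_simps)
  next
    have "((\<lambda>y. \<eta> N * (R y - 1) + c * (T N y * R y)) \<longlongrightarrow> \<eta> N * (1 - 1) + c * ((\<Sum>m\<le>N. 1 $ m) * 1)) at_top"
      unfolding T_def by (intro tendsto_intros tendsto_R_at_top tendsto_E_at_top)
    then show "((\<lambda>y. \<eta> N * (R y - 1) + c * (T N y * R y)) \<longlongrightarrow> 0 + c * 1) at_top"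
      by (simp add: one)
  qed
  have "\<bar>T N y * R y - 1\<bar> \<le> \<eta> N * (R y - 1)" for N
    using diff[of 1 N] diff[of "-1" N] by (simp add: abs_le_iff)
  moreover have "(\<lambda>N. \<eta> N * (R y - 1)) \<longlonglongrightarrow> 0"
    using tendsto_mult_right[OF \<open>\<eta> \<longlonglongrightarrow> 0\<close>, of "R y - 1"] by simp
  ultimately have "(\<lambda>N. T N y * R y - 1) \<longlonglongrightarrow> 0"
    by (intro Lim_null_comparison[of "\<lambda>N. T N y * R y - 1"]) auto
  then have "(\<lambda>N. (T N y * R y - 1 + 1) / R y) \<longlonglongrightarrow> (0 + 1) / R y"
    using R_pos[OF y] by (intro tendsto_intros) auto
  then have "(\<lambda>N. T N y) \<longlonglongrightarrow> 1 / R y"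
    using R_pos[OF y] by simp
  then show ?thesis
    by (simp add: T_def sums_def_le)
qed

end

section \<open>Asymptotics of the convolution\<close>

lemma choose_3_eq: "real (n + 3 choose 3) = (real n + 1) * (real n + 2) * (real n + 3) / 6"
  unfolding binomial_gbinomial by (simp add: gbinomial_prod_rev numeral_3_eq_3 algebra_simps)

lemma H_mult_self: "H y * H y * (H y * H y) = Abs_fps (\<lambda>n. real (n + 3 choose 3) * h y ^ n)"
proof -
  have D0: "D y $ 0 \<noteq> 0"
    by (simp add: D_nth)
  have "inverse (D y) * (H y * D y) = H y"
    using D0 by (simp add: inverse_mult_eq_1 mult.left_commute[of "inverse (D y)"])
  then have H_eq: "H y = inverse (D y)"
    by (simp add: H_mult_D)
  have "H y * H y * (H y * H y) = inverse (D y ^ 4)"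
    unfolding H_eq fps_inverse_power by (simp only: power4_eq_xxxx mult.assoc)
  also have "\<dots> = Abs_fps (\<lambda>n. real (4 + n - 1 choose n) * h y ^ n)"
    unfolding D_def by (rule one_minus_const_fps_X_neg_power') simp
  also have "(\<lambda>n. real (4 + n - 1 choose n) * h y ^ n) = (\<lambda>n. real (n + 3 choose 3) * h y ^ n)"
    using binomial_symmetric[of 3 "n + 3" for n] by (simp add: add.commute)
  finally show ?thesis .
qed

text \<open>For small j the exponential decays in s only at a rate of order j / k, but then the
  cubic factor of order (j / k)^3 is small as well. Trading one against the other gives a majorant
  integrable in s and uniform in j.\<close>

lemma kernel_le:
  assumes s: "0 < s" and jk: "j \<le> k" "0 < k"
  shows "real (j + 3 choose 3) / real k ^ 3 * h (s / real k) ^ j * exp (- (s / real k)) \<le> 9 / (1 + s)\<^sup>2"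
proof -
  \<comment> \<open>Chosen so that both factors become functions of x: the decay rate (j + 2) / (2
    k) is 3 x / 2, and (j + 1) (j + 3) \<le> (j + 2)^2 bounds the binomial by (j + 2)^3 / 6 = (9 /
    2) x^3 k^3. The 3 in the denominator ensures x \<le> 1.\<close>
  define x where "x = (real j + 2) / (3 * real k)"
  have x: "0 < x" "x \<le> 1"
    using jk by (auto simp: x_def field_simps)
  have k: "0 < real k"
    using jk by simp
  have hs: "0 < h (s / real k)" "h (s / real k) \<le> exp (- (s / real k / 2))"
    using h_pos[of "s / real k"] h_le_exp[of "s / real k"] divide_pos_pos[OF s k] by blast+
  have "real (j + 3 choose 3) \<le> (real j + 2) ^ 3 / 6"
    unfolding choose_3_eq by (simp add: power3_eq_cube algebra_simps)
  also have "\<dots> = 9 / 2 * x ^ 3 * real k ^ 3"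
    using k by (simp add: x_def power_divide power_mult_distrib)
  finally have 1: "real (j + 3 choose 3) / real k ^ 3 \<le> 9 / 2 * x ^ 3"
    using k by (simp add: pos_divide_le_eq)
  have "h (s / real k) ^ j * exp (- (s / real k)) \<le> exp (- (s / real k / 2)) ^ j * exp (- (s / real k))"
    using hs by (intro mult_right_mono power_mono) auto
  also have "\<dots> = exp (- (3 / 2 * (s * x)))"
    using k by (simp add: exp_of_nat_mult[symmetric] mult_exp_exp x_def field_simps)
  also have "\<dots> \<le> exp (- (s * x))"
    using s x by simp
  also have "\<dots> \<le> 2 / (1 + s * x)\<^sup>2"
  proof -
    have sx: "0 < s * x"
      using s x by simp
    have "(1 + s * x)\<^sup>2 / 2 \<le> 1 + s * x + (s * x)\<^sup>2 / 2"
      by (simp add: power2_eq_square algebra_simps)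
    also have "\<dots> \<le> exp (s * x)"
      using sx by (intro exp_lower_Taylor_quadratic) simp
    finally show ?thesis
      using sx by (simp add: exp_minus field_simps)
  qed
  finally have 2: "h (s / real k) ^ j * exp (- (s / real k)) \<le> 2 / (1 + s * x)\<^sup>2" .
  have "real (j + 3 choose 3) / real k ^ 3 * (h (s / real k) ^ j * exp (- (s / real k)))
      \<le> 9 / 2 * x ^ 3 * (2 / (1 + s * x)\<^sup>2)"
    using 1 2 hs x by (intro mult_mono) auto
  also have "\<dots> = 9 * x * (x / (1 + s * x))\<^sup>2"
    by (simp add: power2_eq_square power3_eq_cube)
  \<comment> \<open>The map sending x to x / (1 + s x) is increasing, so its largest value is at x =
    1.\<close>
  also have "\<dots> \<le> 9 * 1 * (1 / (1 + s))\<^sup>2"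
  proof (intro mult_mono power_mono)
    have "x * (1 + s) \<le> 1 * (1 + s * x)"
      using x by (simp add: algebra_simps)
    then show "x / (1 + s * x) \<le> 1 / (1 + s)"
      using s x by (simp add: divide_simps add_pos_pos)
  qed (use s x in auto)
  finally show ?thesis
    by (simp add: power_divide mult.assoc)
qed

text \<open>Since h y = 1 - y / 2 + O(y^2), the power \<open>h (s / real k) ^ k\<close> tends to exp
  (- s / 2). The fixed shift \<open>m\<close> only costs the factor
  \<open>h (s / real k) ^ m\<close>, which tends to 1.\<close>

lemma kernel_tendsto:
  assumes s: "0 < s"
  shows "(\<lambda>k. if m \<le> k then real (k - m + 3 choose 3) / real k ^ 3 * h (s / real k) ^ (k - m) * exp (- (s / real k)) else 0)
    \<longlonglongrightarrow> exp (- (s / 2)) / 6"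
proof -
  define M where "M = real m"
  have 1: "(\<lambda>k. (real k - M + 1) * (real k - M + 2) * (real k - M + 3) / 6 / real k ^ 3) \<longlonglongrightarrow> 1 / 6"
    by real_asymp
  have 2: "(\<lambda>k. h (s / real k) ^ k) \<longlonglongrightarrow> exp (- (s / 2))"
    unfolding h_def using s by real_asymp (simp add: field_simps)
  have 3: "(\<lambda>k. h (s / real k)) \<longlonglongrightarrow> 1"
    unfolding h_def using s by real_asymp
  have 4: "(\<lambda>k. exp (- (s / real k))) \<longlonglongrightarrow> 1"
    by real_asymp
  have "(\<lambda>k. (real k - M + 1) * (real k - M + 2) * (real k - M + 3) / 6 / real k ^ 3 *
      (h (s / real k) ^ k / h (s / real k) ^ m) * exp (- (s / real k)))
      \<longlonglongrightarrow> 1 / 6 * (exp (- (s / 2)) / 1 ^ m) * 1"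
    by (intro tendsto_mult tendsto_divide tendsto_power 1 2 3 4) simp
  then have lim: "(\<lambda>k. (real k - M + 1) * (real k - M + 2) * (real k - M + 3) / 6 / real k ^ 3 *
      (h (s / real k) ^ k / h (s / real k) ^ m) * exp (- (s / real k))) \<longlonglongrightarrow> exp (- (s / 2)) / 6"
    by simp
  show ?thesis
  proof (rule Lim_transform_eventually[OF lim])
    show "\<forall>\<^sub>F k in sequentially. (real k - M + 1) * (real k - M + 2) * (real k - M + 3) / 6 / real k ^ 3 *
        (h (s / real k) ^ k / h (s / real k) ^ m) * exp (- (s / real k)) =
        (if m \<le> k then real (k - m + 3 choose 3) / real k ^ 3 * h (s / real k) ^ (k - m) * exp (- (s / real k)) else 0)"
      using eventually_ge_at_top[of "Suc m"]
    proof eventually_elim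
      case (elim k)
      then have "h (s / real k) \<noteq> 0"
        using h_pos[of "s / real k"] s by simp
      then show ?case
        using elim unfolding choose_3_eq by (simp add: power_diff of_nat_diff M_def)
    qed
  qed
qed

context path_recursion
begin

lemma E_square_bound:
  obtains \<beta> :: "nat \<Rightarrow> real" where "\<And>n. 0 \<le> \<beta> n" "\<And>n y. 0 < y \<Longrightarrow> \<bar>(E y * E y) $ n\<bar> \<le> \<beta> n" "summable \<beta>"
    "\<And>y. 0 < y \<Longrightarrow> (\<lambda>n. (E y * E y) $ n) sums ((1 / R y) * (1 / R y))"
proof -
  obtain b :: "nat \<Rightarrow> real" where b: "\<And>n. 0 \<le> b n" "\<And>n y. 0 < y \<Longrightarrow> V y $ n \<le> b n" "summable b"
    using V_bound by blast
  have E_le: "\<bar>E y $ n\<bar> \<le> b n" if "0 < y" for y n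
    using abs_E_le_V[OF that] b(2)[OF that] by (rule order_trans)
  have norm_b: "summable (\<lambda>k. norm (b k))"
    using b(1,3) by simp
  have EE: "(E y * E y) $ n = (\<Sum>i\<le>n. E y $ i * E y $ (n - i))" for y n
    by (simp add: fps_mult_nth atLeast0AtMost)
  show ?thesis
  proof
    show "0 \<le> (\<Sum>i\<le>n. b i * b (n - i))" for n
      using b(1) by (intro sum_nonneg mult_nonneg_nonneg)
    show "summable (\<lambda>n. \<Sum>i\<le>n. b i * b (n - i))"
      using norm_b norm_b by (rule summable_Cauchy_product)
    fix y :: real assume y: "0 < y"
    show "\<bar>(E y * E y) $ n\<bar> \<le> (\<Sum>i\<le>n. b i * b (n - i))" for n
    proof -
      have "\<bar>(E y * E y) $ n\<bar> \<le> (\<Sum>i\<le>n. \<bar>E y $ i * E y $ (n - i)\<bar>)"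
        unfolding EE by (rule sum_abs)
      also have "\<dots> \<le> (\<Sum>i\<le>n. b i * b (n - i))"
        unfolding abs_mult using b(1) E_le[OF y] by (intro sum_mono mult_mono) auto
      finally show ?thesis .
    qed
    have "summable (\<lambda>k. norm (E y $ k))"
      by (rule summable_comparison_test[OF _ b(3)]) (use E_le[OF y] in auto)
    then have "(\<lambda>n. (E y * E y) $ n) sums ((\<Sum>n. E y $ n) * (\<Sum>n. E y $ n))"
      unfolding EE by (intro Cauchy_product_sums)
    then show "(\<lambda>n. (E y * E y) $ n) sums ((1 / R y) * (1 / R y))"
      using sums_unique[OF sums_E[OF y]] by simp
  qed
qed

lemma convolution_eq:
  "(\<Sum>j\<le>k. p j y * p (k - j) y) = (\<Sum>m\<le>k. (E y * E y) $ m * (real (k - m + 3 choose 3) * h y ^ (k - m)))"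
proof -
  have "P y * P y = E y * E y * (H y * H y * (H y * H y))"
    unfolding P_eq by (simp only: mult_ac)
  then have "(P y * P y) $ k = (E y * E y * Abs_fps (\<lambda>n. real (n + 3 choose 3) * h y ^ n)) $ k"
    by (simp only: H_mult_self)
  then show ?thesis
    unfolding fps_mult_nth[of "P y"] fps_mult_nth[of "E y * E y"] by (simp add: P_def atLeast0AtMost)
qed

text \<open>The integrand of \<open>Psi (path_graph k) / k\<^sup>2\<close> after the substitution \<open>y = s / k\<close>.\<close>

definition w :: "nat \<Rightarrow> real \<Rightarrow> real" where
  "w k s = (\<Sum>j\<le>k. p j (s / real k) * p (k - j) (s / real k)) * exp (- (s / real k)) / real k ^ 3"

lemma w_nonneg: "0 \<le> w k s"
  unfolding w_def using p_nonneg by (intro divide_nonneg_nonneg mult_nonneg_nonneg sum_nonneg) auto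

lemma w_measurable [measurable]: "w k \<in> borel_measurable borel"
  unfolding w_def by measurable

lemma w_eq:
  "w k s = (\<Sum>m\<le>k. (E (s / real k) * E (s / real k)) $ m *
    (real (k - m + 3 choose 3) / real k ^ 3 * h (s / real k) ^ (k - m) * exp (- (s / real k))))"
proof -
  have "c * (C * H) * x / z = c * (C / z * H * x)" for c C H x z :: real
    by simp
  then show ?thesis
    unfolding w_def convolution_eq sum_distrib_right sum_divide_distrib by (intro sum.cong refl)
qed

lemma w_bound:
  obtains B where "\<And>k s. 0 < k \<Longrightarrow> 0 < s \<Longrightarrow> w k s \<le> B / (1 + s)\<^sup>2"
proof -
  obtain \<beta> :: "nat \<Rightarrow> real" where \<beta>: "\<And>n. 0 \<le> \<beta> n" "\<And>n y. 0 < y \<Longrightarrow> \<bar>(E y * E y) $ n\<bar> \<le> \<beta> n" "summable \<beta>"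
    "\<And>y. 0 < y \<Longrightarrow> (\<lambda>n. (E y * E y) $ n) sums ((1 / R y) * (1 / R y))"
    using E_square_bound by blast
  show ?thesis
  proof
    fix k :: nat and s :: real assume k: "0 < k" and s: "0 < s"
    let ?c = "\<lambda>m. real (k - m + 3 choose 3) / real k ^ 3 * h (s / real k) ^ (k - m) * exp (- (s / real k))"
    have "w k s \<le> (\<Sum>m\<le>k. \<beta> m * (9 / (1 + s)\<^sup>2))"
      unfolding w_eq
    proof (rule sum_mono)
      fix m assume "m \<in> {..k}"
      have "(E (s / real k) * E (s / real k)) $ m * ?c m \<le> \<beta> m * ?c m"
        using \<beta>(2)[of "s / real k" m] k s h_pos[of "s / real k"] by (intro mult_right_mono) auto
      also have "\<dots> \<le> \<beta> m * (9 / (1 + s)\<^sup>2)"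
        using kernel_le[OF s _ k, of "k - m"] \<beta>(1) by (intro mult_left_mono) auto
      finally show "(E (s / real k) * E (s / real k)) $ m * ?c m \<le> \<beta> m * (9 / (1 + s)\<^sup>2)" .
    qed
    also have "\<dots> = (\<Sum>m\<le>k. \<beta> m) * (9 / (1 + s)\<^sup>2)"
      by (rule sum_distrib_right[symmetric])
    also have "\<dots> \<le> suminf \<beta> * (9 / (1 + s)\<^sup>2)"
      using \<beta> by (intro mult_right_mono sum_le_suminf) auto
    finally show "w k s \<le> suminf \<beta> * 9 / (1 + s)\<^sup>2"
      by simp
  qed
qed

text \<open>For the coefficients \<open>\<epsilon> m k\<close> of E^2 only a summable majorant and
  the total 1 / R^2 are at hand. The kernel \<open>a m k\<close> is therefore replaced by its limit
  \<open>L\<close>: the error vanishes by Tannery's theorem, and the main term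
  \<open>L / R^2\<close> tends to L / 4.\<close>

lemma w_tendsto:
  assumes s: "0 < s"
  shows "(\<lambda>k. w k s) \<longlonglongrightarrow> exp (- (s / 2)) / 24"
proof -
  obtain \<beta> :: "nat \<Rightarrow> real" where \<beta>: "\<And>n. 0 \<le> \<beta> n" "\<And>n y. 0 < y \<Longrightarrow> \<bar>(E y * E y) $ n\<bar> \<le> \<beta> n" "summable \<beta>"
    and sums: "\<And>y. 0 < y \<Longrightarrow> (\<lambda>n. (E y * E y) $ n) sums ((1 / R y) * (1 / R y))"
    using E_square_bound by blast
  define \<epsilon> where "\<epsilon> m k = (E (s / real k) * E (s / real k)) $ m" for m k
  define a where "a m k = (if m \<le> k then real (k - m + 3 choose 3) / real k ^ 3 * h (s / real k) ^ (k - m) * exp (- (s / real k)) else 0)" for m k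
  define L where "L = exp (- (s / 2)) / 6"
  have \<epsilon>_le: "\<bar>\<epsilon> m k\<bar> \<le> \<beta> m" if "0 < k" for m k
    unfolding \<epsilon>_def using that s by (intro \<beta>(2)) simp
  have a_le: "\<bar>a m k\<bar> \<le> 9" if "0 < k" for m k
  proof -
    have "0 \<le> a m k"
      using s that h_pos[of "s / real k"] by (simp add: a_def)
    moreover have "9 / (1 + s)\<^sup>2 \<le> 9"
      using s by (simp add: divide_le_eq power2_eq_square) (simp add: algebra_simps add_nonneg_nonneg)
    moreover have "a m k \<le> 9 / (1 + s)\<^sup>2"
    proof (cases "m \<le> k")
      case True
      show ?thesis
        unfolding a_def if_P[OF True] by (rule kernel_le[OF s diff_le_self that])
    qed (simp add: a_def)
    ultimately show ?thesis
      by simp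
  qed
  have diff_le: "\<bar>\<epsilon> m k * (a m k - L)\<bar> \<le> \<beta> m * (9 + \<bar>L\<bar>)" if "0 < k" for m k
    unfolding abs_mult using \<epsilon>_le[OF that, of m] a_le[OF that, of m] \<beta>(1)[of m]
    by (intro mult_mono) auto
  have s1: "summable (\<lambda>m. \<beta> m * (9 + \<bar>L\<bar>))"
    using \<beta>(3) by (rule summable_mult2)
  have "(\<lambda>k. \<Sum>m. \<epsilon> m k * (a m k - L)) \<longlonglongrightarrow> (\<Sum>m. 0)"
  proof (rule tannerys_theorem[THEN conjunct2, THEN conjunct2])
    show "(\<lambda>k. \<epsilon> m k * (a m k - L)) \<longlonglongrightarrow> 0" for m
    proof (rule Lim_null_comparison)
      show "\<forall>\<^sub>F k in sequentially. norm (\<epsilon> m k * (a m k - L)) \<le> \<beta> m * \<bar>a m k - L\<bar>"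
        using eventually_gt_at_top[of 0] by eventually_elim (simp add: abs_mult mult_right_mono \<epsilon>_le)
      have "a m \<longlonglongrightarrow> L"
        unfolding a_def L_def by (rule kernel_tendsto[OF s])
      then have "(\<lambda>k. \<beta> m * \<bar>a m k - L\<bar>) \<longlonglongrightarrow> \<beta> m * \<bar>L - L\<bar>"
        by (intro tendsto_intros)
      then show "(\<lambda>k. \<beta> m * \<bar>a m k - L\<bar>) \<longlonglongrightarrow> 0"
        by simp
    qed
    show "\<forall>\<^sub>F (m, k) in at_top \<times>\<^sub>F sequentially. norm (\<epsilon> m k * (a m k - L)) \<le> \<beta> m * (9 + \<bar>L\<bar>)"
    proof -
      have "\<forall>\<^sub>F mk in at_top \<times>\<^sub>F sequentially. 0 < snd mk"
        by (rule eventually_compose_filterlim[OF eventually_gt_at_top filterlim_snd])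
      then show ?thesis
        by eventually_elim (auto simp: diff_le split: prod.split)
    qed
  qed (use s1 in auto)
  then have lim1: "(\<lambda>k. \<Sum>m. \<epsilon> m k * (a m k - L)) \<longlonglongrightarrow> 0"
    by simp
  have y0: "filterlim (\<lambda>k. s / real k) (at_right 0) sequentially"
    using s by real_asymp
  have "(\<lambda>k. R (s / real k)) \<longlonglongrightarrow> 2"
    using tendsto_R_at_right_0 y0 by (rule filterlim_compose)
  then have "(\<lambda>k. (\<Sum>m. \<epsilon> m k * (a m k - L)) + (1 / R (s / real k)) * (1 / R (s / real k)) * L)
      \<longlonglongrightarrow> 0 + (1 / 2) * (1 / 2) * L"
    by (intro tendsto_intros lim1) auto
  moreover have "\<forall>\<^sub>F k in sequentially.
      (\<Sum>m. \<epsilon> m k * (a m k - L)) + (1 / R (s / real k)) * (1 / R (s / real k)) * L = w k s"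
    using eventually_gt_at_top[of 0]
  proof eventually_elim
    case (elim k)
    have "summable (\<lambda>m. \<epsilon> m k * (a m k - L))"
      by (rule summable_comparison_test[OF _ s1]) (use diff_le[OF elim] in auto)
    moreover have "(\<lambda>m. \<epsilon> m k * L) sums ((1 / R (s / real k)) * (1 / R (s / real k)) * L)"
      unfolding \<epsilon>_def using s elim by (intro sums_mult2 sums) simp
    ultimately have "(\<lambda>m. \<epsilon> m k * (a m k - L) + \<epsilon> m k * L) sums
        ((\<Sum>m. \<epsilon> m k * (a m k - L)) + (1 / R (s / real k)) * (1 / R (s / real k)) * L)"
      by (intro sums_add summable_sums)
    moreover have "\<epsilon> m k * (a m k - L) + \<epsilon> m k * L = \<epsilon> m k * a m k" for m
      by (simp add: algebra_simps)
    ultimately have S1: "(\<lambda>m. \<epsilon> m k * a m k) sums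
        ((\<Sum>m. \<epsilon> m k * (a m k - L)) + (1 / R (s / real k)) * (1 / R (s / real k)) * L)"
      by simp
    have S2: "(\<lambda>m. \<epsilon> m k * a m k) sums (\<Sum>m\<le>k. \<epsilon> m k * a m k)"
      by (rule sums_finite) (auto simp: a_def)
    have "(\<Sum>m\<le>k. \<epsilon> m k * a m k) = w k s"
      unfolding w_eq by (intro sum.cong) (auto simp: a_def \<epsilon>_def)
    with sums_unique2[OF S1 S2] show ?case
      by simp
  qed
  ultimately have "(\<lambda>k. w k s) \<longlonglongrightarrow> 0 + (1 / 2) * (1 / 2) * L"
    by (rule Lim_transform_eventually)
  then show ?thesis
    by (simp add: L_def)
qed

lemma nn_integral_w_tendsto:
  "(\<lambda>k. \<integral>\<^sup>+s. ennreal (w k s) * indicator {0<..} s \<partial>lborel)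
    \<longlonglongrightarrow> (\<integral>\<^sup>+s. ennreal (exp (- (s / 2)) / 24) * indicator {0<..} s \<partial>lborel)"
proof -
  obtain B where B: "\<And>k s. 0 < k \<Longrightarrow> 0 < s \<Longrightarrow> w k s \<le> B / (1 + s)\<^sup>2"
    using w_bound by blast
  have B0: "0 \<le> B"
    using order_trans[OF w_nonneg B[of 1 1]] by simp
  \<comment> \<open>The majorant holds for positive indices only, hence the shift by
    \<open>Suc\<close>.\<close>
  have "(\<lambda>k. \<integral>\<^sup>+s. ennreal (w (Suc k) s) * indicator {0<..} s \<partial>lborel)
      \<longlonglongrightarrow> (\<integral>\<^sup>+s. ennreal (exp (- (s / 2)) / 24) * indicator {0<..} s \<partial>lborel)"
  proof (rule nn_integral_dominated_convergence)
    show "AE s in lborel. ennreal (w (Suc k) s) * indicator {0<..} s \<le> ennreal (B / (1 + s)\<^sup>2) * indicator {0..} s" for k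
      using B by (intro AE_I2) (auto intro!: ennreal_leI split: split_indicator)
    have "(\<integral>\<^sup>+s. ennreal (B / (1 + s)\<^sup>2) * indicator {0..} s \<partial>lborel) = ennreal (0 - - B / (1 + 0))"
    proof (rule nn_integral_FTC_atLeast)
      show "((\<lambda>s. - B / (1 + s)) has_real_derivative B / (1 + s)\<^sup>2) (at s)" if "0 \<le> s" for s
        using that by (auto intro!: derivative_eq_intros simp: power2_eq_square)
      show "((\<lambda>s. - B / (1 + s)) \<longlongrightarrow> 0) at_top"
        by real_asymp
    qed (use B0 in auto)
    then show "(\<integral>\<^sup>+s. ennreal (B / (1 + s)\<^sup>2) * indicator {0..} s \<partial>lborel) < \<infinity>"
      by simp
    show "AE s in lborel. (\<lambda>k. ennreal (w (Suc k) s) * indicator {0<..} s)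
        \<longlonglongrightarrow> ennreal (exp (- (s / 2)) / 24) * indicator {0<..} s"
    proof (rule AE_I2)
      fix s :: real
      show "(\<lambda>k. ennreal (w (Suc k) s) * indicator {0<..} s)
        \<longlonglongrightarrow> ennreal (exp (- (s / 2)) / 24) * indicator {0<..} s"
        using LIMSEQ_Suc[OF w_tendsto[of s]] by (cases "0 < s") auto
    qed
  qed auto
  then show ?thesis
    by (rule LIMSEQ_imp_Suc)
qed

end

section \<open>Paths\<close>

text \<open>Converts the integral recursion into a differential one while keeping track of
  finiteness and decay. Continuity is asked only on the open half-line, because \<open>h\<close>
  takes a default value at 0.\<close>

lemma nn_integral_tail:
  fixes i :: "real \<Rightarrow> real"
  assumes i[measurable]: "i \<in> borel_measurable borel" and cont: "\<And>z. 0 < z \<Longrightarrow> isCont i z"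
    and nonneg: "\<And>z. 0 < z \<Longrightarrow> 0 \<le> i z" and bound: "\<And>z. 0 < z \<Longrightarrow> i z \<le> C * exp (- (z / 2))"
  obtains Q where "\<And>y. 0 < y \<Longrightarrow> (\<integral>\<^sup>+z. ennreal (i z) * indicator {y<..} z \<partial>lborel) = ennreal (Q y)"
    "\<And>y. 0 < y \<Longrightarrow> 0 \<le> Q y" "\<And>y. 0 < y \<Longrightarrow> Q y \<le> 2 * C * exp (- (y / 2))"
    "\<And>y. 0 < y \<Longrightarrow> (Q has_real_derivative - i y) (at y)"
proof -
  define J where "J y = (\<integral>\<^sup>+z. ennreal (i z) * indicator {y<..} z \<partial>lborel)" for y
  define Q where "Q y = enn2real (J y)" for y
  have C: "0 \<le> C"
  proof -
    have "0 \<le> C * exp (- (1 / 2))"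
      using nonneg[of 1] bound[of 1] by simp
    then show ?thesis
      by (simp add: zero_le_mult_iff)
  qed
  have J_le: "J y \<le> ennreal (2 * C * exp (- (y / 2)))" if y: "0 < y" for y
  proof -
    have "J y \<le> (\<integral>\<^sup>+z. ennreal (C * exp (- (z / 2))) * indicator {y..} z \<partial>lborel)"
      unfolding J_def using y bound by (intro nn_integral_mono) (auto intro!: ennreal_leI split: split_indicator)
    also have "\<dots> = ennreal (0 - - (2 * C * exp (- (y / 2))))"
    proof (rule nn_integral_FTC_atLeast)
      show "((\<lambda>z. - (2 * C * exp (- (z / 2)))) has_real_derivative C * exp (- (z / 2))) (at z)" for z
        by (auto intro!: derivative_eq_intros)
      show "((\<lambda>z. - (2 * C * exp (- (z / 2)))) \<longlongrightarrow> 0) at_top"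
        by real_asymp
    qed (use C in auto)
    finally show ?thesis
      by simp
  qed
  have Q_nonneg: "0 \<le> Q y" for y
    by (simp add: Q_def)
  have J_eq: "J y = ennreal (Q y)" if "0 < y" for y
  proof -
    have "J y < \<top>"
      using J_le[OF that] ennreal_less_top by (rule le_less_trans)
    then show ?thesis
      by (simp add: Q_def)
  qed
  have "\<exists>A. \<forall>z. (0 :: ereal) < ereal z \<longrightarrow> ereal z < \<infinity> \<longrightarrow> (A has_vector_derivative i z) (at z)"
    by (rule einterval_antiderivative) (use cont in auto)
  then obtain A where "\<And>z. (0 :: ereal) < ereal z \<Longrightarrow> ereal z < \<infinity> \<Longrightarrow> (A has_vector_derivative i z) (at z)"
    by blast
  then have A: "(A has_real_derivative i z) (at z)" if "0 < z" for z
    using that by (simp add: has_real_derivative_iff_has_vector_derivative)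
  have Q_diff: "Q a = A y - A a + Q y" if a: "0 < a" "a \<le> y" for a y
  proof -
    have "A a \<le> A y"
    proof (rule DERIV_nonneg_imp_nondecreasing[OF a(2)])
      fix z assume "a \<le> z"
      then have "0 < z"
        using a by simp
      then show "\<exists>d. (A has_real_derivative d) (at z) \<and> 0 \<le> d"
        using A nonneg by blast
    qed
    have "J a = (\<integral>\<^sup>+z. ennreal (i z) * indicator {a..y} z + ennreal (i z) * indicator {y<..} z \<partial>lborel)"
      unfolding J_def
    proof (rule nn_integral_cong_AE, rule AE_mp[OF AE_lborel_singleton[of a]], intro AE_I2 impI)
      fix z assume "z \<noteq> a"
      then show "ennreal (i z) * indicator {a<..} z = ennreal (i z) * indicator {a..y} z + ennreal (i z) * indicator {y<..} z"
        using a by (auto split: split_indicator)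
    qed
    also have "\<dots> = (\<integral>\<^sup>+z. ennreal (i z) * indicator {a..y} z \<partial>lborel) + J y"
      unfolding J_def by (rule nn_integral_add) auto
    also have "(\<integral>\<^sup>+z. ennreal (i z) * indicator {a..y} z \<partial>lborel) = ennreal (A y - A a)"
      using a A nonneg by (intro nn_integral_FTC_Icc) auto
    finally have "ennreal (Q a) = ennreal (A y - A a) + ennreal (Q y)"
      using a by (simp add: J_eq)
    then have "ennreal (Q a) = ennreal (A y - A a + Q y)"
      using \<open>A a \<le> A y\<close> Q_nonneg by simp
    then show ?thesis
      by (subst (asm) ennreal_inj) (use \<open>A a \<le> A y\<close> Q_nonneg in auto)
  qed
  show ?thesis
  proof
    fix y :: real assume y: "0 < y"
    show "(\<integral>\<^sup>+z. ennreal (i z) * indicator {y<..} z \<partial>lborel) = ennreal (Q y)"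
      using J_eq[OF y] by (simp add: J_def)
    show "0 \<le> Q y"
      by (rule Q_nonneg)
    show "Q y \<le> 2 * C * exp (- (y / 2))"
      using J_le[OF y] C by (simp add: J_eq[OF y])
    \<comment> \<open>Near y the tail equals a constant minus the antiderivative; y / 2 is a base
      point to the left of y that is still positive.\<close>
    have "((\<lambda>x. Q (y / 2) + A (y / 2) - A x) has_real_derivative 0 - i y) (at y)"
      by (intro DERIV_diff DERIV_const A y)
    then have "(Q has_real_derivative 0 - i y) (at y)"
    proof (rule has_field_derivative_transform_within_open[where S = "{y / 2<..}"])
      show "Q (y / 2) + A (y / 2) - A x = Q x" if "x \<in> {y / 2<..}" for x
        using Q_diff[of "y / 2" x] y that by simp
    qed (use y in auto)
    then show "(Q has_real_derivative - i y) (at y)"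
      by simp
  qed
qed

lemma theta_measurable [measurable]: "theta \<in> borel_measurable borel"
  by (intro borel_measurable_mono monoI theta_mono)

lemma F_measurable [measurable]: "F n \<in> borel_measurable borel"
proof (induction n rule: less_induct)
  case (less n)
  show ?case
  proof (cases "n = 0")
    case True
    then show ?thesis
      by (simp add: F_0[abs_def])
  next
    case False
    have "(\<lambda>a. \<integral>\<^sup>+b. (if a < b then ennreal b ^ (n - j) * F j b * emeasure A_law {b<..} ^ (n - j - 1) else 0) \<partial>A_law)
        \<in> borel_measurable borel" if "j < n" for j
    proof -
      note [measurable] = less.IH[OF that]
      show ?thesis
        unfolding emeasure_A_law_greaterThan by measurable
    qed
    then have "(\<lambda>a. \<Sum>j<n. \<integral>\<^sup>+b. (if a < b then ennreal b ^ (n - j) * F j b * emeasure A_law {b<..} ^ (n - j - 1) else 0) \<partial>A_law)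
        \<in> borel_measurable borel"
      by (intro borel_measurable_sum) simp
    then show ?thesis
      using F_rec[of n] False by (simp add: fun_eq_iff[symmetric] cong: measurable_cong)
  qed
qed

lemma G_mult_exp: "0 < y \<Longrightarrow> G y * exp (- y) = h y"
  by (simp add: G_def h_def exp_minus field_simps)

text \<open>Under b = G z the survival probability is exp (- z). The n - j - 1 survival factors
  together with the density exp (- z) pair off with the n - j factors \<open>G z\<close>, each pair
  being \<open>h z\<close>.\<close>

lemma F_G_rec:
  assumes n: "0 < n" and y: "0 < y"
  shows "F n (G y) = (\<Sum>j<n. \<integral>\<^sup>+z. (F j (G z) * ennreal (h z) ^ (n - j)) * indicator {y<..} z \<partial>lborel)"
  unfolding F_rec[OF n]
proof (rule sum.cong[OF refl])
  fix j assume "j \<in> {..<n}"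
  then obtain m where m: "n - j = Suc m"
    by (metis Suc_diff_Suc lessThan_iff)
  have "(\<integral>\<^sup>+b. (if G y < b then ennreal b ^ (n - j) * F j b * emeasure A_law {b<..} ^ (n - j - 1) else 0) \<partial>A_law)
      = (\<integral>\<^sup>+z. (if G y < G z then ennreal (G z) ^ (n - j) * F j (G z) * emeasure A_law {G z<..} ^ (n - j - 1) else 0)
        * ennreal (exp (- z)) * indicator {0<..} z \<partial>lborel)"
    unfolding emeasure_A_law_greaterThan by (rule nn_integral_A_law) measurable
  also have "\<dots> = (\<integral>\<^sup>+z. (F j (G z) * ennreal (h z) ^ (n - j)) * indicator {y<..} z \<partial>lborel)"
  proof (rule nn_integral_cong)
    fix z :: real
    show "(if G y < G z then ennreal (G z) ^ (n - j) * F j (G z) * emeasure A_law {G z<..} ^ (n - j - 1) else 0)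
        * ennreal (exp (- z)) * indicator {0<..} z = (F j (G z) * ennreal (h z) ^ (n - j)) * indicator {y<..} z"
    proof (cases "y < z")
      case True
      then have z: "0 < z"
        using y by simp
      have "ennreal (h z) = ennreal (G z) * ennreal (exp (- z))"
        by (simp add: G_mult_exp[OF z, symmetric] ennreal_mult'')
      then have "ennreal (h z) ^ (n - j) = ennreal (G z) ^ (n - j) * (ennreal (exp (- z)) ^ m * ennreal (exp (- z)))"
        by (simp add: m power_mult_distrib mult_ac)
      then show ?thesis
        using True z G_less_iff[OF y z] by (simp add: emeasure_A_law_greaterThan_G[OF z] m mult_ac)
    next
      case False
      then show ?thesis
        using G_less_iff[OF y, of z] by (auto split: split_indicator)
    qed
  qed
  finally show "(\<integral>\<^sup>+b. (if G y < b then ennreal b ^ (n - j) * F j b * emeasure A_law {b<..} ^ (n - j - 1) else 0) \<partial>A_law)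
      = (\<integral>\<^sup>+z. (F j (G z) * ennreal (h z) ^ (n - j)) * indicator {y<..} z \<partial>lborel)" .
qed

definition p :: "nat \<Rightarrow> real \<Rightarrow> real" where
  "p n y = enn2real (F n (G y))"

lemma p_measurable [measurable]: "p n \<in> borel_measurable borel"
  unfolding p_def by measurable

lemma p_0: "p 0 y = 1"
  by (simp add: p_def F_0)

lemma p_nonneg: "0 \<le> p n y"
  by (simp add: p_def)

lemma h_measurable [measurable]: "h \<in> borel_measurable borel"
  unfolding h_def by measurable

text \<open>The properties are proved jointly: differentiability and boundedness of the earlier
  functions make the next integrand continuous and exponentially dominated, as
  \<open>nn_integral_tail\<close> requires. Boundedness is listed separately since p 0 = 1 does not
  decay.\<close>

lemma p_properties:
  shows "\<exists>C. \<forall>y>0. F n (G y) = ennreal (p n y) \<and> p n y \<le> C \<and>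
    (p n has_real_derivative - (\<Sum>j<n. p j y * h y ^ (n - j))) (at y) \<and>
    (0 < n \<longrightarrow> p n y \<le> C * exp (- (y / 2)))"
proof (induction n rule: less_induct)
  case (less n)
  show ?case
  proof (cases "n = 0")
    case True
    have "p 0 = (\<lambda>_. 1)"
      by (simp add: fun_eq_iff p_0)
    then show ?thesis
      using True by (auto simp: F_0 p_0 intro!: exI[of _ 1])
  next
    case False
    from less.IH obtain C where C: "\<And>j y. j < n \<Longrightarrow> 0 < y \<Longrightarrow> F j (G y) = ennreal (p j y)"
        "\<And>j y. j < n \<Longrightarrow> 0 < y \<Longrightarrow> p j y \<le> C j"
        "\<And>j y. j < n \<Longrightarrow> 0 < y \<Longrightarrow> (p j has_real_derivative - (\<Sum>l<j. p l y * h y ^ (j - l))) (at y)"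
      by metis
    define i where "i z = (\<Sum>j<n. p j z * h z ^ (n - j))" for z
    have 1: "i \<in> borel_measurable borel"
      unfolding i_def by measurable
    have 2: "\<And>z. 0 < z \<Longrightarrow> isCont i z"
      unfolding i_def by (intro continuous_intros DERIV_isCont[OF C(3)] DERIV_isCont[OF DERIV_h]) auto
    have 3: "0 \<le> i z" if "0 < z" for z
      unfolding i_def using p_nonneg h_pos[OF that] by (intro sum_nonneg mult_nonneg_nonneg) auto
    have 4: "i z \<le> (\<Sum>j<n. C j) * exp (- (z / 2))" if z: "0 < z" for z
      unfolding i_def sum_distrib_right
    proof (rule sum_mono)
      fix j assume j: "j \<in> {..<n}"
      then obtain m where m: "n - j = Suc m"
        by (metis Suc_diff_Suc lessThan_iff)
      \<comment> \<open>As j < n, at least one factor \<open>h\<close> is present; it alone supplies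
        the decay, also for j = 0.\<close>
      have "h z ^ (n - j) \<le> h z"
        unfolding m power_Suc using h_pos[OF z] h_less_one[OF z]
        by (intro mult_left_le power_le_one) auto
      also have "\<dots> \<le> exp (- (z / 2))"
        by (rule h_le_exp[OF z])
      finally show "p j z * h z ^ (n - j) \<le> C j * exp (- (z / 2))"
        using C(2)[of j z] j z p_nonneg[of j z] h_pos[OF z] by (intro mult_mono) auto
    qed
    obtain Q where Q: "\<And>y. 0 < y \<Longrightarrow> (\<integral>\<^sup>+z. ennreal (i z) * indicator {y<..} z \<partial>lborel) = ennreal (Q y)"
      "\<And>y. 0 < y \<Longrightarrow> 0 \<le> Q y" "\<And>y. 0 < y \<Longrightarrow> Q y \<le> 2 * (\<Sum>j<n. C j) * exp (- (y / 2))"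
      "\<And>y. 0 < y \<Longrightarrow> (Q has_real_derivative - i y) (at y)"
      using nn_integral_tail[OF 1 2 3 4] by blast
    have F_eq: "F n (G y) = ennreal (Q y)" if y: "0 < y" for y
    proof -
      have "F n (G y) = (\<integral>\<^sup>+z. (\<Sum>j<n. (F j (G z) * ennreal (h z) ^ (n - j)) * indicator {y<..} z) \<partial>lborel)"
        using False y by (subst nn_integral_sum) (auto simp: F_G_rec)
      also have "\<dots> = (\<integral>\<^sup>+z. ennreal (i z) * indicator {y<..} z \<partial>lborel)"
      proof (rule nn_integral_cong)
        fix z :: real
        show "(\<Sum>j<n. (F j (G z) * ennreal (h z) ^ (n - j)) * indicator {y<..} z) = ennreal (i z) * indicator {y<..} z"
        proof (cases "y < z")
          case True
          then have z: "0 < z"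
            using y by simp
          have "(\<Sum>j<n. F j (G z) * ennreal (h z) ^ (n - j)) = (\<Sum>j<n. ennreal (p j z * h z ^ (n - j)))"
            using z h_pos[OF z] p_nonneg
            by (intro sum.cong refl) (simp add: C(1) ennreal_mult ennreal_power)
          also have "\<dots> = ennreal (i z)"
            unfolding i_def using p_nonneg h_pos[OF z] by (intro sum_ennreal mult_nonneg_nonneg) auto
          finally show ?thesis
            using True by simp
        qed simp
      qed
      finally show ?thesis
        using Q(1)[OF y] by simp
    qed
    have p_eq: "p n y = Q y" if "0 < y" for y
      using F_eq[OF that] Q(2)[OF that] by (simp add: p_def)
    have deriv: "(p n has_real_derivative - i y) (at y)" if y: "0 < y" for y
      by (rule has_field_derivative_transform_within_open[OF Q(4)[OF y], of "{0<..}"]) (use y p_eq in auto)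
    have le: "Q y \<le> 2 * (\<Sum>j<n. C j)" if y: "0 < y" for y
    proof -
      have "0 \<le> (\<Sum>j<n. C j)"
        using C(2)[of _ 1] p_nonneg by (intro sum_nonneg) (meson lessThan_iff order_trans zero_less_one)
      then have "2 * (\<Sum>j<n. C j) * exp (- (y / 2)) \<le> 2 * (\<Sum>j<n. C j)"
        using y by (intro mult_right_le_one_le) auto
      then show ?thesis
        using Q(3)[OF y] by linarith
    qed
    show ?thesis
      using F_eq p_eq deriv le Q(3) unfolding i_def
      by (intro exI[of _ "2 * (\<Sum>j<n. C j)"]) simp
  qed
qed

lemma F_G_eq: "0 < y \<Longrightarrow> F n (G y) = ennreal (p n y)"
  using p_properties[of n] by blast

interpretation path: path_recursion p
proof
  fix n :: nat and y :: real
  show "p 0 y = 1" "0 \<le> p n y" "p n \<in> borel_measurable borel"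
    by (simp_all add: p_0 p_nonneg)
  obtain C where C: "\<And>y. 0 < y \<Longrightarrow> (p n has_real_derivative - (\<Sum>j<n. p j y * h y ^ (n - j))) (at y)"
      "\<And>y. 0 < y \<Longrightarrow> 0 < n \<Longrightarrow> p n y \<le> C * exp (- (y / 2))"
    using p_properties[of n] by metis
  show "0 < y \<Longrightarrow> (p n has_real_derivative - (\<Sum>j<n. p j y * h y ^ (n - j))) (at y)"
    by (rule C(1))
  assume n: "0 < n"
  show "(p n \<longlongrightarrow> 0) at_top"
  proof (rule Lim_null_comparison)
    show "\<forall>\<^sub>F y in at_top. norm (p n y) \<le> C * exp (- (y / 2))"
      using eventually_gt_at_top[of 0] by eventually_elim (simp add: C(2) n p_nonneg)
    show "((\<lambda>y. C * exp (- (y / 2))) \<longlongrightarrow> 0) at_top"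
      by real_asymp
  qed
qed

lemma Psi_path_graph_eq:
  assumes k: "0 < k"
  shows "Psi (path_graph k) = (real k)\<^sup>2 * enn2real (\<integral>\<^sup>+s. ennreal (path.w k s) * indicator {0<..} s \<partial>lborel)"
proof -
  define f where "f y = ennreal ((\<Sum>j\<le>k. p j y * p (k - j) y) * exp (- y)) * indicator {0<..} y" for y
  have [measurable]: "f \<in> borel_measurable borel"
    unfolding f_def by measurable
  have "(\<Sum>j\<le>k. \<integral>\<^sup>+b. F j b * F (k - j) b \<partial>A_law)
      = (\<Sum>j\<le>k. \<integral>\<^sup>+y. F j (G y) * F (k - j) (G y) * ennreal (exp (- y)) * indicator {0<..} y \<partial>lborel)"
    by (intro sum.cong refl nn_integral_A_law) measurable
  also have "\<dots> = (\<integral>\<^sup>+y. (\<Sum>j\<le>k. F j (G y) * F (k - j) (G y) * ennreal (exp (- y)) * indicator {0<..} y) \<partial>lborel)"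
    by (rule nn_integral_sum[symmetric]) measurable
  also have "\<dots> = (\<integral>\<^sup>+y. f y \<partial>lborel)"
  proof (rule nn_integral_cong)
    fix y :: real
    show "(\<Sum>j\<le>k. F j (G y) * F (k - j) (G y) * ennreal (exp (- y)) * indicator {0<..} y) = f y"
    proof (cases "0 < y")
      case True
      have "(\<Sum>j\<le>k. F j (G y) * F (k - j) (G y) * ennreal (exp (- y))) = (\<Sum>j\<le>k. ennreal (p j y * p (k - j) y * exp (- y)))"
        by (intro sum.cong refl) (simp add: F_G_eq[OF True] ennreal_mult p_nonneg)
      also have "\<dots> = ennreal ((\<Sum>j\<le>k. p j y * p (k - j) y) * exp (- y))"
        unfolding sum_distrib_right using p_nonneg by (intro sum_ennreal mult_nonneg_nonneg) auto
      finally show ?thesis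
        using True by (simp add: f_def)
    qed (simp add: f_def)
  qed
  \<comment> \<open>Substitution y = s / k: the Jacobian 1 / k against the k^3 in the denominator of
    \<open>path.w\<close> leaves k^2.\<close>
  also have "\<dots> = ennreal (1 / real k) * (\<integral>\<^sup>+s. f (s / real k) \<partial>lborel)"
    using k by (subst nn_integral_real_affine[where c = "1 / real k" and t = 0]) auto
  also have "(\<integral>\<^sup>+s. f (s / real k) \<partial>lborel)
      = (\<integral>\<^sup>+s. ennreal (real k ^ 3) * (ennreal (path.w k s) * indicator {0<..} s) \<partial>lborel)"
  proof (rule nn_integral_cong)
    fix s :: real
    have "(\<Sum>j\<le>k. p j (s / real k) * p (k - j) (s / real k)) * exp (- (s / real k)) = real k ^ 3 * path.w k s"
      using k by (simp add: path.w_def)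
    then show "f (s / real k) = ennreal (real k ^ 3) * (ennreal (path.w k s) * indicator {0<..} s)"
      using k by (auto simp: f_def ennreal_mult path.w_nonneg zero_less_divide_iff split: split_indicator)
  qed
  also have "\<dots> = ennreal (real k ^ 3) * (\<integral>\<^sup>+s. ennreal (path.w k s) * indicator {0<..} s \<partial>lborel)"
    by (rule nn_integral_cmult) measurable
  finally show ?thesis
    using k by (simp add: Psi_path_graph enn2real_mult power2_eq_square power3_eq_cube)
qed

lemma Psi_path_graph_asymp: "(\<lambda>k. Psi (path_graph k)) \<sim>[sequentially] (\<lambda>k. (real k)\<^sup>2 / 12)"
proof (rule asymp_equivI')
  have "(\<integral>\<^sup>+s. ennreal (exp (- (s / 2)) / 24) * indicator {0<..} s \<partial>lborel)
      = (\<integral>\<^sup>+s. ennreal (1 / 24) * (ennreal (s ^ 0 * exp (- (1 / 2 * s))) * indicator {0<..} s) \<partial>lborel)"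
    by (intro nn_integral_cong) (auto simp: ennreal_mult'[symmetric] split: split_indicator)
  also have "\<dots> = ennreal (1 / 24) * (\<integral>\<^sup>+s. ennreal (s ^ 0 * exp (- (1 / 2 * s))) * indicator {0<..} s \<partial>lborel)"
    by (rule nn_integral_cmult) measurable
  also have "\<dots> = ennreal (1 / 12)"
    by (subst nn_integral_power_exp) (simp_all add: ennreal_mult'[symmetric] del: ennreal_numeral)
  finally have "(\<lambda>k. \<integral>\<^sup>+s. ennreal (path.w k s) * indicator {0<..} s \<partial>lborel) \<longlonglongrightarrow> ennreal (1 / 12)"
    using path.nn_integral_w_tendsto by simp
  then have "(\<lambda>k. enn2real (\<integral>\<^sup>+s. ennreal (path.w k s) * indicator {0<..} s \<partial>lborel)) \<longlonglongrightarrow> 1 / 12"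
    by (rule tendsto_enn2real) simp
  then have "(\<lambda>k. 12 * enn2real (\<integral>\<^sup>+s. ennreal (path.w k s) * indicator {0<..} s \<partial>lborel)) \<longlonglongrightarrow> 12 * (1 / 12)"
    by (rule tendsto_mult_left)
  then have lim: "(\<lambda>k. 12 * enn2real (\<integral>\<^sup>+s. ennreal (path.w k s) * indicator {0<..} s \<partial>lborel)) \<longlonglongrightarrow> 1"
    by simp
  show "(\<lambda>k. Psi (path_graph k) / ((real k)\<^sup>2 / 12)) \<longlonglongrightarrow> 1"
  proof (rule Lim_transform_eventually[OF lim])
    show "\<forall>\<^sub>F k in sequentially. 12 * enn2real (\<integral>\<^sup>+s. ennreal (path.w k s) * indicator {0<..} s \<partial>lborel)
        = Psi (path_graph k) / ((real k)\<^sup>2 / 12)"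
      using eventually_gt_at_top[of 0] by eventually_elim (simp add: Psi_path_graph_eq)
  qed
qed

theorem proposition1p5:
  shows "((\<lambda>k. Psi (star_graph k)) \<sim>[sequentially] (\<lambda>k. zeta 2 ^ k)) \<and>
         ((\<lambda>k. Psi (path_graph k)) \<sim>[sequentially] (\<lambda>k. (real k)\<^sup>2 / 12))"
  using Psi_star_graph_asymp Psi_path_graph_asymp by (rule conjI)

end
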